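(* Let $1\le q<\infty$, $-\frac1q\le\lambda<0$, $\alpha\in\mathbb{R}$, and for $j=1,\dots,m$ let $1<q_j<\infty$, $-\frac1{q_j}\le\lambda_j<0$, $\gamma_j\in\mathbb{R}$, with $\frac1q=\frac1{q_1}+\cdots+\frac1{q_m}$ and $\gamma=\gamma_1+\cdots+\gamma_m$. Put $$A_m=\int_{\mathbb{H}^{n}\times\cdots\times\mathbb{H}^n}\frac{\prod_{j=1}^{m}|y_j|_h^{\,Q\lambda_j-\frac{\gamma_j}{q}+\alpha(\lambda_j+\frac{1}{q_j})}}{[\max(1,|y_1|_h^Q,\ldots,|y_m|_h^Q)]^m}\,dy_1\cdots dy_m.$$ Then the operator $P^h_m$ is bounded from $\prod_{j=1}^m L^{q_j,\lambda_j}(\mathbb{H}^n,|x|_h^\alpha,|x|_h^{q_j\gamma_j/q})$ to $L^{q,\lambda}(\mathbb{H}^n,|x|_h^\alpha,|x|_h^\gamma)$ if and only if $A_m<\infty$. Moreover, if $A_m<\infty$, then $$A_m=\frac{mQ\,\omega_Q^{m}}{\left[Q\lambda-\frac{\gamma}{q}+\alpha\left(\lambda+\frac{1}{q}\right)\right]\prod_{i=1}^m\left[Q(1-\lambda_i)+\frac{\gamma_i}{q}-\alpha\left(\lambda_i+\frac{1}{q_i}\right)\right]}.$$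
   Context: The Heisenberg group $\mathbb{H}^n$ is $\mathbb{R}^{2n}\times\mathbb{R}$ with group law $x\circ y=(x_1+y_1,\ldots,x_{2n}+y_{2n},\,x_{2n+1}+y_{2n+1}+2\sum_{j=1}^n(y_jx_{n+j}-x_jy_{n+j}))$ and dilations $\delta_r(x_1,\ldots,x_{2n},x_{2n+1})=(rx_1,\ldots,rx_{2n},r^2x_{2n+1})$, $r>0$. Its Haar measure is Lebesgue measure $dx$ on $\mathbb{R}^{2n+1}$, and $Q=2n+2$ is its homogeneous dimension. The norm is $|x|_h=[(\sum_{i=1}^{2n}x_i^2)^2+x_{2n+1}^2]^{1/4}$, the distance is $d(p,q)=|q^{-1}p|_h$, and $B(a,R)=\{y\in\mathbb{H}^n:d(a,y)<R\}$. $\Omega_Q$ is the volume of the unit ball $B(0,1)$, and $\omega_Q=Q\Omega_Q$. For positive measurable functions $w_1,w_2$ on $\mathbb{H}^n$, $1\le q<\infty$, $-1/q\le\lambda<0$, the two power weighted Morrey space $L^{q,\lambda}(\mathbb{H}^n,w_1,w_2)$ is the set of $f\in L^q_{loc}$ with finite $$\|f\|_{L^{q,\lambda}(\mathbb{H}^n,w_1,w_2)}=\sup_{a\in\mathbb{H}^n,R>0}\Big(\int_{B(a,R)}w_1\,dx\Big)^{-(\lambda+1/q)}\Big(\int_{B(a,R)}|f(x)|^qw_2(x)\,dx\Big)^{1/q}.$$ For nonnegative locally integrable functions $f_1,\ldots,f_m$ on $\mathbb{H}^n$, the $m$-linear $n$-dimensional Hardy-Littlewood-Pólya operator is $$P^h_m(f_1,\ldots,f_m)(x)=\int_{\mathbb{H}^n\times\cdots\times\mathbb{H}^n}\frac{f_1(y_1)\cdots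 f_m(y_m)}{[\max(|x|_h^Q,|y_1|_h^Q,\ldots,|y_m|_h^Q)]^m}\,dy_1\cdots dy_m,\quad x\in\mathbb{H}^n\setminus\{0\}$$ ($m$ factors of $\mathbb{H}^n$). "Bounded" means that there is a finite $C$ such that the target norm of $P^h_m(f_1,\ldots,f_m)$ is at most $C$ times the product of the norms of the $f_j$, for all (nonnegative) $f_j$ in the respective source spaces.
   Formalization: Adds λ=λ_1+…+λ_m (without it A_m<∞ need not give boundedness, by dilation scaling), and corrects signs in the formula: the denominator is −[Qλ−γ/q+α(λ+1/q)]∏[Q(1+λ_i)−γ_i/q+α(λ_i+1/q_i)], as the printed one is negative for m=1. *)

theory Defs
  imports "HOL-Analysis.Analysis"
begin

(* A point of R^(2n) x R, n = CARD('n). The coordinate x_j is "fst x $ Inl j", x_(n+j) is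
   "fst x $ Inr j", and x_(2n+1) is "snd x". Lebesgue (= Haar) measure is lborel. *)
type_synonym 'n heis = "(real ^ ('n + 'n)) \<times> real"

definition heis_mult :: "'n::finite heis \<Rightarrow> 'n heis \<Rightarrow> 'n heis" where
  "heis_mult x y =
     (fst x + fst y,
      snd x + snd y + 2 * (\<Sum>j\<in>UNIV. fst y $ Inl j * fst x $ Inr j - fst x $ Inl j * fst y $ Inr j))"

definition heis_inv :: "'n::finite heis \<Rightarrow> 'n heis" where
  "heis_inv x = - x"

lemma heis_mult_assoc:
  "heis_mult (heis_mult x y) z = heis_mult x (heis_mult y z)"
  by (simp add: heis_mult_def algebra_simps sum.distrib sum_subtractf)

lemma heis_mult_zero: "heis_mult 0 x = x" "heis_mult x 0 = x"
  by (simp_all add: heis_mult_def)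

lemma heis_mult_inv: "heis_mult (heis_inv x) x = 0" "heis_mult x (heis_inv x) = 0"
  by (simp_all add: heis_mult_def heis_inv_def zero_prod_def)

definition heis_norm :: "'n::finite heis \<Rightarrow> real" where
  "heis_norm x = ((\<Sum>i\<in>UNIV. (fst x $ i)\<^sup>2)\<^sup>2 + (snd x)\<^sup>2) powr (1/4)"

definition heis_dist :: "'n::finite heis \<Rightarrow> 'n heis \<Rightarrow> real" where
  "heis_dist p q = heis_norm (heis_mult (heis_inv q) p)"

definition heis_ball :: "'n::finite heis \<Rightarrow> real \<Rightarrow> 'n heis set" where
  "heis_ball a R = {y. heis_dist a y < R}"

definition hom_dim :: "'n::finite itself \<Rightarrow> nat" where
  "hom_dim _ = 2 * CARD('n) + 2"

definition unit_ball_vol :: "'n::finite itself \<Rightarrow> real" where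
  "unit_ball_vol _ = measure lborel (heis_ball (0 :: 'n heis) 1)"

definition omega_Q :: "'n::finite itself \<Rightarrow> real" where
  "omega_Q N = real (hom_dim N) * unit_ball_vol N"

(* Real powers on [0, \<infinity>], with \<infinity> powr s = 0 for s < 0, 0 powr s = \<infinity> for s < 0,
   and x powr 0 = 1 for every x, 0 and \<infinity> included. *)
definition epowr :: "ennreal \<Rightarrow> real \<Rightarrow> ennreal" where
  "epowr x s =
     (if s = 0 then 1
      else if x = \<infinity> then (if s > 0 then \<infinity> else 0)
      else if x = 0 then (if s > 0 then 0 else \<infinity>)
      else ennreal (enn2real x powr s))"

(* F plays the role of |f|; it may be infinite, so that the functional also applies to
   integral operators that have not been shown to be finite. A ball of infinite w1-mass has
   first factor 0 when lam + 1/q > 0, and then contributes 0 to the supremum (0 * \<infinity> = 0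
   in ennreal). *)
definition morrey_norm ::
  "real \<Rightarrow> real \<Rightarrow> ('n::finite heis \<Rightarrow> real) \<Rightarrow> ('n heis \<Rightarrow> real) \<Rightarrow> ('n heis \<Rightarrow> ennreal) \<Rightarrow> ennreal"
where
  "morrey_norm q lam w1 w2 F =
     (SUP (a, R) \<in> UNIV \<times> {0<..}.
        epowr (\<integral>\<^sup>+x\<in>heis_ball a R. ennreal (w1 x) \<partial>lborel) (- (lam + 1/q)) *
        epowr (\<integral>\<^sup>+x\<in>heis_ball a R. epowr (F x) q * ennreal (w2 x) \<partial>lborel) (1/q))"

definition Lq_loc :: "real \<Rightarrow> ('n::finite heis \<Rightarrow> real) set" where
  "Lq_loc q = {f. f \<in> borel_measurable borel \<and>
                  (\<forall>K. compact K \<longrightarrow> set_integrable lborel K (\<lambda>x. \<bar>f x\<bar> powr q))}"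

definition morrey_space ::
  "real \<Rightarrow> real \<Rightarrow> ('n::finite heis \<Rightarrow> real) \<Rightarrow> ('n heis \<Rightarrow> real) \<Rightarrow> ('n heis \<Rightarrow> real) set"
where
  "morrey_space q lam w1 w2 =
     {f \<in> Lq_loc q. morrey_norm q lam w1 w2 (\<lambda>x. ennreal \<bar>f x\<bar>) < \<infinity>}"

(* Meant for nonnegative f 1, ..., f m and x \<noteq> 0. The value at the null set {0} is irrelevant. *)
definition HLP :: "nat \<Rightarrow> (nat \<Rightarrow> 'n::finite heis \<Rightarrow> real) \<Rightarrow> 'n heis \<Rightarrow> ennreal" where
  "HLP m f x =
     (\<integral>\<^sup>+y. ennreal
        ((\<Prod>j\<in>{1..m}. f j (y j)) /
         (Max (insert (heis_norm x ^ hom_dim TYPE('n))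
                 ((\<lambda>j. heis_norm (y j) ^ hom_dim TYPE('n)) ` {1..m}))) ^ m)
      \<partial>(Pi\<^sub>M {1..m} (\<lambda>_. lborel)))"

(* The source spaces have parameters qs j, ls j and weights u1 j, u2 j for j = 1, ..., m,
   the target space has parameters q, lam and weights w1, w2. *)
definition HLP_bounded ::
  "nat \<Rightarrow> (nat \<Rightarrow> real) \<Rightarrow> (nat \<Rightarrow> real) \<Rightarrow>
   (nat \<Rightarrow> 'n::finite heis \<Rightarrow> real) \<Rightarrow> (nat \<Rightarrow> 'n heis \<Rightarrow> real) \<Rightarrow>
   real \<Rightarrow> real \<Rightarrow> ('n heis \<Rightarrow> real) \<Rightarrow> ('n heis \<Rightarrow> real) \<Rightarrow> bool"
where
  "HLP_bounded m qs ls u1 u2 q lam w1 w2 \<longleftrightarrow>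
     (\<exists>C::real. C \<ge> 0 \<and>
       (\<forall>f. (\<forall>j\<in>{1..m}. f j \<in> morrey_space (qs j) (ls j) (u1 j) (u2 j) \<and> (\<forall>x. 0 \<le> f j x)) \<longrightarrow>
          morrey_norm q lam w1 w2 (HLP m f) \<le>
          ennreal C * (\<Prod>j\<in>{1..m}. morrey_norm (qs j) (ls j) (u1 j) (u2 j) (\<lambda>x. ennreal \<bar>f j x\<bar>))))"

definition HLP_const ::
  "'n::finite itself \<Rightarrow> nat \<Rightarrow> real \<Rightarrow> real \<Rightarrow> (nat \<Rightarrow> real) \<Rightarrow> (nat \<Rightarrow> real) \<Rightarrow> (nat \<Rightarrow> real) \<Rightarrow> ennreal"
where
  "HLP_const N m q \<alpha> qs ls gs =
     (\<integral>\<^sup>+y. ennreal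
        ((\<Prod>j\<in>{1..m}. heis_norm (y j) powr
             (real (hom_dim N) * ls j - gs j / q + \<alpha> * (ls j + 1 / qs j))) /
         (Max (insert 1 ((\<lambda>j. heis_norm (y j) ^ hom_dim N) ` {1..m}))) ^ m)
      \<partial>(Pi\<^sub>M {1..m} (\<lambda>_. lborel :: 'n heis measure)))"

end

theory Submission
  imports Defs
begin

text \<open>By the layer-cake formula \<open>max(1,|y|\<^sup>Q)\<^sup>-\<^sup>m = \<integral> 1[t > max(1,|y|)] m Q t\<^sup>-\<^sup>m\<^sup>Q\<^sup>-\<^sup>1 dt\<close> the constant
  \<open>A\<^sub>m\<close> is a one-dimensional integral of a power, which gives its value and shows that it is finite
  iff all \<open>b\<^sub>j + Q > 0\<close> and \<open>\<Sum> b\<^sub>j < 0\<close>, where \<open>b\<^sub>j\<close> is the exponent of \<open>|y\<^sub>j|\<close>.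

  Necessity: by Hoelder's inequality the truncation of \<open>|y|\<^sup>b\<close> (with \<open>b = b\<^sub>j\<close>) to an annulus
  \<open>1 \<le> |y| \<le> e\<^sup>N\<close> has source norm \<open>O(N\<^sup>-\<^sup>\<lambda>)\<close> (\<open>\<lambda> = \<lambda>\<^sub>j\<close>), for every \<open>\<alpha>\<close>, while the operator applied to such
  functions grows like \<open>N\<close> on a fixed ball if one of the conditions fails. The only exception is
  \<open>\<lambda> = - 1/q\<close>, \<open>\<Sum> b\<^sub>j \<ge> 0\<close>, where \<open>|x|\<^sup>\<gamma>\<close> is not integrable at the origin.

  Sufficiency: \<open>max(|x|,|y\<^sub>1|,\<dots>)\<^sup>m\<^sup>Q \<ge> \<Prod> max(|x|,|y\<^sub>j|)\<^sup>s\<close> (exponents \<open>s = s\<^sub>j\<close> with \<open>\<Sum> s\<^sub>j = m Q\<close>) dominates the operator by a product of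
  \<open>m\<close> linear ones, and Hoelder's inequality reduces the claim to each of them. A linear
  operator is controlled on radial regions by the function on dilated radial regions. It
  remains to compare balls with radial regions: annuli are covered by boundedly many balls that
  stay away from the origin, and a ball has a fixed proportion of its points at each scale that it meets.\<close>

section \<open>The Koranyi norm\<close>

text \<open>All exponents meet in one identity. If b belongs to a source space with parameters p, l
  and weights \<open>|x|^\<alpha>\<close>, \<open>|x|^g\<close>, then
  \<open>p * b + g = \<theta> * (Q + \<alpha>) - Q\<close> with \<open>\<theta> = p * l + 1\<close>.
  This exponent lies between \<alpha> and the dilation invariant -Q, and Hoelder's inequality
  between the two loses only the mass for -Q, which counts the scales that a set meets.

  The obstacle is that \<alpha> is arbitrary. If \<alpha> \<le> -Q, a ball containing the origin has
  infinite mass, and unless l = -1/p its factor in the norm is 0, so the norm says nothing about the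
  function there. Centred balls thus cannot control a function on an annulus, and the target
  estimate is due on balls of finite mass only, which may still come arbitrarily close to the
  origin. For \<alpha> = -Q their mass grows just logarithmically. Hence covering balls must keep a
  distance from the origin that is polynomial in the ratio of the radii, and a ball must carry its
  share of mass at each scale that it meets; both facts rest on the shape of Koranyi balls near
  their boundary points.\<close>

definition heis_J :: "real ^ ('n + 'n::finite) \<Rightarrow> real ^ ('n + 'n)" where
  "heis_J z = (\<chi> k. case k of Inl j \<Rightarrow> z $ Inr j | Inr j \<Rightarrow> - (z $ Inl j))"

lemma sum_UNIV_sum_type:
  "(\<Sum>k\<in>(UNIV :: ('a::finite + 'b::finite) set). f k) = (\<Sum>j\<in>UNIV. f (Inl j)) + (\<Sum>j\<in>UNIV. f (Inr j))"
  by (subst UNIV_Plus_UNIV[symmetric], subst sum.Plus) (auto)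

lemma inner_heis_J: "heis_J z \<bullet> w = (\<Sum>j\<in>UNIV. w $ Inl j * z $ Inr j - z $ Inl j * w $ Inr j)"
  by (simp add: inner_vec_def heis_J_def sum_UNIV_sum_type sum_subtractf sum_negf mult.commute)

lemma heis_mult_eq: "heis_mult x y = (fst x + fst y, snd x + snd y + 2 * (heis_J (fst x) \<bullet> fst y))"
  by (simp add: heis_mult_def inner_heis_J)

lemma heis_J_simps [simp]:
  "heis_J (a + b) = heis_J a + heis_J b" "heis_J (r *\<^sub>R a) = r *\<^sub>R heis_J a"
  "heis_J (- a) = - heis_J a" "heis_J (a - b) = heis_J a - heis_J b" "heis_J 0 = 0"
  by (auto simp: heis_J_def vec_eq_iff split: sum.splits)

lemma heis_J_orth [simp]: "heis_J z \<bullet> z = 0" "z \<bullet> heis_J z = 0"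
  by (simp_all add: inner_heis_J inner_commute[of z])

lemma heis_J_skew: "heis_J z \<bullet> w = - (heis_J w \<bullet> z)"
  by (simp add: inner_heis_J algebra_simps sum_subtractf)

lemma inner_heis_J_J [simp]: "heis_J z \<bullet> heis_J w = z \<bullet> w"
  by (subst inner_heis_J) (simp add: heis_J_def inner_vec_def sum_UNIV_sum_type sum.distrib algebra_simps sum_subtractf)

lemma norm_heis_J [simp]: "norm (heis_J z) = norm z"
  by (simp add: norm_eq_sqrt_inner)

lemma heis_norm_nonneg [simp]: "0 \<le> heis_norm x"
  by (simp add: heis_norm_def)

lemma heis_norm_eq: "heis_norm x = (norm (fst x) ^ 4 + (snd x)\<^sup>2) powr (1/4)"
proof -
  have "(\<Sum>i\<in>UNIV. (fst x $ i)\<^sup>2) = (norm (fst x))\<^sup>2"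
    by (simp add: norm_vec_def L2_set_def sum_nonneg)
  then show ?thesis by (simp add: heis_norm_def flip: power_mult)
qed

lemma heis_norm_pow4: "heis_norm x ^ 4 = norm (fst x) ^ 4 + (snd x)\<^sup>2"
proof -
  have "(norm (fst x) ^ 4 + (snd x)\<^sup>2) \<ge> 0" by simp
  then show ?thesis
    unfolding heis_norm_eq by (cases "norm (fst x) ^ 4 + (snd x)\<^sup>2 = 0") (simp_all add: powr_power)
qed

lemma heis_norm_less_iff: "0 \<le> r \<Longrightarrow> heis_norm x < r \<longleftrightarrow> norm (fst x) ^ 4 + (snd x)\<^sup>2 < r ^ 4"
  using power_mono_iff[of r "heis_norm x" 4] by (simp add: heis_norm_pow4 flip: not_le)

lemma heis_norm_le_iff: "0 \<le> r \<Longrightarrow> heis_norm x \<le> r \<longleftrightarrow> norm (fst x) ^ 4 + (snd x)\<^sup>2 \<le> r ^ 4"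
  using power_mono_iff[of "heis_norm x" r 4] by (simp add: heis_norm_pow4)

lemma heis_norm_eqI: "0 \<le> r \<Longrightarrow> norm (fst x) ^ 4 + (snd x)\<^sup>2 = r ^ 4 \<Longrightarrow> heis_norm x = r"
  using heis_norm_le_iff[of r x] heis_norm_less_iff[of r x] by simp

lemma heis_norm_zero [simp]: "heis_norm 0 = 0"
  by (simp add: heis_norm_eq)

lemma heis_norm_eq_0_iff [simp]: "heis_norm x = 0 \<longleftrightarrow> x = 0"
proof
  assume "heis_norm x = 0"
  then have "norm (fst x) ^ 4 + (snd x)\<^sup>2 = 0" using heis_norm_pow4[of x] by simp
  then have "norm (fst x) ^ 4 = 0 \<and> (snd x)\<^sup>2 = 0"
    by (metis add_nonneg_eq_0_iff norm_ge_zero zero_le_power zero_le_power2)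
  then show "x = 0" by (simp add: prod_eq_iff)
qed simp

lemma heis_norm_pos_iff [simp]: "0 < heis_norm x \<longleftrightarrow> x \<noteq> 0"
  by (simp add: less_le)

lemma heis_norm_minus [simp]: "heis_norm (- x) = heis_norm x"
  by (simp add: heis_norm_eq)

lemma continuous_on_heis_norm [continuous_intros]:
  "continuous_on S f \<Longrightarrow> continuous_on S (\<lambda>x. heis_norm (f x))"
  unfolding heis_norm_eq by (intro continuous_on_powr' continuous_intros) auto

lemma continuous_on_heis_mult [continuous_intros]:
  fixes f g :: "'a::topological_space \<Rightarrow> 'n::finite heis"
  shows "continuous_on S f \<Longrightarrow> continuous_on S g \<Longrightarrow> continuous_on S (\<lambda>x. heis_mult (f x) (g x))"
  unfolding heis_mult_def by (intro continuous_intros)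

lemma borel_measurable_heis_norm [measurable]: "heis_norm \<in> borel_measurable borel"
  by (intro borel_measurable_continuous_onI continuous_intros)

text \<open>Since \<open>z\<close> and \<open>heis_J z\<close> are orthogonal and equally long, this
  is Bessel's inequality for \<open>w\<close>. The vector \<open>u\<close> of the proof is
  \<open>|z|^2\<close> times the projection of \<open>w\<close> onto their span; Cauchy-Schwarz for
  \<open>u\<close> and \<open>w\<close> leaves a common factor to cancel.\<close>

lemma inner_heis_J_Bessel: "(z \<bullet> w)\<^sup>2 + (heis_J z \<bullet> w)\<^sup>2 \<le> (norm z)\<^sup>2 * (norm w)\<^sup>2"
proof -
  define a b where "a = z \<bullet> w" and "b = heis_J z \<bullet> w"
  define u where "u = a *\<^sub>R z + b *\<^sub>R heis_J z"
  have uu: "(norm u)\<^sup>2 = (a\<^sup>2 + b\<^sup>2) * (norm z)\<^sup>2"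
    unfolding power2_norm_eq_inner u_def
    by (simp add: inner_add_left inner_add_right power2_eq_square algebra_simps)
  have uw: "u \<bullet> w = a\<^sup>2 + b\<^sup>2"
    by (simp add: u_def inner_add_left a_def b_def power2_eq_square)
  have "(u \<bullet> w)\<^sup>2 \<le> (norm u)\<^sup>2 * (norm w)\<^sup>2"
    using power_mono[OF Cauchy_Schwarz_ineq2[of u w] abs_ge_zero, of 2]
    by (simp add: power_mult_distrib)
  then have "(a\<^sup>2 + b\<^sup>2) * (a\<^sup>2 + b\<^sup>2) \<le> (a\<^sup>2 + b\<^sup>2) * ((norm z)\<^sup>2 * (norm w)\<^sup>2)"
    unfolding uu uw by (simp only: power2_eq_square ac_simps)
  then show ?thesis
    unfolding a_def[symmetric] b_def[symmetric]
    using mult_le_cancel_left_pos[of "a\<^sup>2 + b\<^sup>2"]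
    by (cases "a\<^sup>2 + b\<^sup>2 = 0") (simp_all add: sum_power2_gt_zero_iff)
qed

text \<open>The identity \<open>|x|\<^sup>2 = ||z|\<^sup>2 + \<i>t|\<close> reduces the triangle inequality to the one for complex numbers.\<close>

lemma heis_norm_power2: "(heis_norm x)\<^sup>2 = cmod (Complex ((norm (fst x))\<^sup>2) (snd x))"
proof -
  have "((heis_norm x)\<^sup>2)\<^sup>2 = (norm (fst x) ^ 2)\<^sup>2 + (snd x)\<^sup>2"
    using heis_norm_pow4[of x] by (simp flip: power_mult)
  then have "(heis_norm x)\<^sup>2 = sqrt ((norm (fst x) ^ 2)\<^sup>2 + (snd x)\<^sup>2)"
    by (intro real_sqrt_unique[symmetric]) auto
  then show ?thesis by (simp add: cmod_def)
qed

lemma norm_fst_le_heis_norm: "norm (fst x) \<le> heis_norm x"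
  by (rule power_le_imp_le_base[of _ 3]) (simp_all add: heis_norm_pow4)

lemma heis_norm_triangle: "heis_norm (heis_mult x y) \<le> heis_norm x + heis_norm y"
proof -
  let ?c = "\<lambda>x. Complex ((norm (fst x))\<^sup>2) (snd x)"
  \<comment> \<open>A Hermitian product of the horizontal parts: up to the factor 2 its real part is
    the cross term of the squared Euclidean norm and its imaginary part the twist of the group law,
    so one complex number accounts for both.\<close>
  let ?d = "Complex (fst x \<bullet> fst y) (heis_J (fst x) \<bullet> fst y)"
  have eq: "?c (heis_mult x y) = ?c x + ?c y + 2 * ?d"
    by (simp add: complex_eq_iff heis_mult_eq power2_norm_eq_inner inner_add_left inner_add_right inner_commute)
  have "cmod ?d \<le> norm (fst x) * norm (fst y)"
    using inner_heis_J_Bessel[of "fst x" "fst y"]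
    by (auto simp: cmod_def power_mult_distrib intro!: real_le_lsqrt)
  also have "\<dots> \<le> heis_norm x * heis_norm y"
    by (intro mult_mono norm_fst_le_heis_norm) auto
  finally have d: "cmod ?d \<le> heis_norm x * heis_norm y" .
  have "(heis_norm (heis_mult x y))\<^sup>2 \<le> cmod (?c x) + cmod (?c y) + cmod (2 * ?d)"
    unfolding heis_norm_power2 eq by (intro norm_triangle_mono order_refl)
  also have "\<dots> \<le> (heis_norm x)\<^sup>2 + (heis_norm y)\<^sup>2 + 2 * (heis_norm x * heis_norm y)"
    using d by (simp add: heis_norm_power2 norm_mult)
  also have "\<dots> = (heis_norm x + heis_norm y)\<^sup>2" by (simp add: power2_eq_square algebra_simps)
  finally show ?thesis by (rule power2_le_imp_le) auto
qed

lemma heis_mult_minus [simp]: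
  "heis_mult (- x) (heis_mult x y) = y" "heis_mult x (heis_mult (- x) y) = y"
  using heis_mult_assoc[of "- x" x y] heis_mult_assoc[of x "- x" y]
    heis_mult_inv(1)[of x] heis_mult_inv(2)[of x]
  by (simp_all add: heis_inv_def heis_mult_zero)

lemma heis_inv_mult: "- heis_mult x y = heis_mult (- y) (- x)"
  using heis_J_skew[of "fst x" "fst y"] by (simp add: heis_mult_eq)

lemma heis_dist_eq: "heis_dist p q = heis_norm (heis_mult (- q) p)"
  by (simp add: heis_dist_def heis_inv_def)

lemma heis_dist_eq': "heis_dist p q = heis_norm (heis_mult (- p) q)"
  using heis_inv_mult[of "- q" p] unfolding heis_dist_eq
  by (metis heis_norm_minus minus_minus)

lemma heis_dist_commute: "heis_dist p q = heis_dist q p"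
  using heis_dist_eq heis_dist_eq' by metis

lemma heis_dist_zero [simp]: "heis_dist p 0 = heis_norm p" "heis_dist 0 p = heis_norm p"
  by (simp_all add: heis_dist_eq heis_mult_zero)

lemma heis_dist_triangle: "heis_dist p r \<le> heis_dist p q + heis_dist q r"
proof -
  have "heis_mult (heis_mult (- p) q) (heis_mult (- q) r) = heis_mult (- p) r"
    by (simp add: heis_mult_assoc)
  then show ?thesis
    unfolding heis_dist_eq' using heis_norm_triangle[of "heis_mult (- p) q" "heis_mult (- q) r"] by simp
qed

lemma heis_ball_iff: "y \<in> heis_ball a R \<longleftrightarrow> heis_dist a y < R"
  by (simp add: heis_ball_def)

lemma open_heis_ball: "open (heis_ball a R)"
  unfolding heis_ball_def heis_dist_eq'
  by (intro open_Collect_less continuous_intros)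

lemma heis_ball_borel [measurable]: "heis_ball a R \<in> sets borel"
  by (intro borel_open open_heis_ball)

lemma heis_ball_norm:
  assumes "x \<in> heis_ball a R"
  shows "heis_norm x < heis_norm a + R" "heis_norm a < heis_norm x + R"
  using assms heis_dist_triangle[of 0 x a] heis_dist_triangle[of 0 a x]
  by (simp_all add: heis_ball_iff heis_dist_commute)

lemma heis_ball_0: "heis_ball 0 R = {x. heis_norm x < R}"
  by (simp add: heis_ball_def)

section \<open>Dilations and boundedness of balls\<close>

definition heis_dil :: "real \<Rightarrow> 'n::finite heis \<Rightarrow> 'n heis" where
  "heis_dil r x = (r *\<^sub>R fst x, r\<^sup>2 * snd x)"

lemma heis_norm_dil: "heis_norm (heis_dil r x) = \<bar>r\<bar> * heis_norm x"
  by (rule heis_norm_eqI)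
     (simp_all add: heis_dil_def power_mult_distrib heis_norm_pow4 distrib_left flip: power_mult)

lemma heis_dil_mult: "heis_dil r (heis_mult x y) = heis_mult (heis_dil r x) (heis_dil r y)"
  by (simp add: heis_dil_def heis_mult_eq algebra_simps power2_eq_square)

lemma heis_dil_minus [simp]: "heis_dil r (- x) = - heis_dil r x"
  by (simp add: heis_dil_def)

lemma heis_dil_dil [simp]: "heis_dil r (heis_dil s x) = heis_dil (r * s) x"
  by (simp add: heis_dil_def power_mult_distrib)

lemma heis_dil_1 [simp]: "heis_dil 1 x = x"
  by (simp add: heis_dil_def)

lemma heis_dist_dil: "heis_dist (heis_dil r p) (heis_dil r q) = \<bar>r\<bar> * heis_dist p q"
  unfolding heis_dist_eq by (metis heis_dil_minus heis_dil_mult heis_norm_dil)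

lemma continuous_on_heis_dil [continuous_intros]:
  "continuous_on S f \<Longrightarrow> continuous_on S g \<Longrightarrow> continuous_on S (\<lambda>x. heis_dil (f x) (g x))"
  unfolding heis_dil_def by (intro continuous_intros)

lemma heis_ball_subset_cball: "heis_ball 0 R \<subseteq> cball 0 (R + R\<^sup>2)"
proof
  fix x :: "'a heis" assume "x \<in> heis_ball 0 R"
  then have x: "heis_norm x < R" by (simp add: heis_ball_0)
  then have R: "0 \<le> R" using heis_norm_nonneg[of x] by linarith
  have "norm (fst x) \<le> R" using x norm_fst_le_heis_norm[of x] by simp
  moreover have "\<bar>snd x\<bar> \<le> R\<^sup>2"
  proof (rule power2_le_imp_le)
    have "(snd x)\<^sup>2 \<le> heis_norm x ^ 4" by (simp add: heis_norm_pow4)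
    also have "\<dots> \<le> R ^ 4" using x by (intro power_mono) auto
    finally show "\<bar>snd x\<bar>\<^sup>2 \<le> (R\<^sup>2)\<^sup>2" by simp
  qed simp
  ultimately show "x \<in> cball 0 (R + R\<^sup>2)"
    using norm_Pair_le[of "fst x" "snd x"] by auto
qed

lemma bounded_heis_ball: "bounded (heis_ball a R)"
proof -
  have "heis_ball a R \<subseteq> heis_ball 0 (heis_norm a + R)"
    unfolding heis_ball_0 using heis_ball_norm(1) by blast
  then show ?thesis using heis_ball_subset_cball bounded_cball bounded_subset by metis
qed

section \<open>Haar measure\<close>

abbreviation heis_annulus :: "real \<Rightarrow> real \<Rightarrow> 'n::finite heis set" where
  "heis_annulus s t \<equiv> {x. s \<le> heis_norm x \<and> heis_norm x \<le> t}"

abbreviation power_mass :: "'n::finite heis set \<Rightarrow> real \<Rightarrow> ennreal" where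
  "power_mass S a \<equiv> \<integral>\<^sup>+x\<in>S. ennreal (heis_norm x powr a) \<partial>lborel"

abbreviation source_mass :: "('n::finite heis \<Rightarrow> real) \<Rightarrow> real \<Rightarrow> real \<Rightarrow> 'n heis set \<Rightarrow> ennreal" where
  "source_mass f p g S \<equiv> \<integral>\<^sup>+x\<in>S. ennreal (f x powr p * heis_norm x powr g) \<partial>lborel"

abbreviation source_norm :: "real \<Rightarrow> real \<Rightarrow> real \<Rightarrow> real \<Rightarrow> ('n::finite heis \<Rightarrow> real) \<Rightarrow> ennreal" where
  "source_norm p l \<alpha> g f \<equiv>
     morrey_norm p l (\<lambda>x. heis_norm x powr \<alpha>) (\<lambda>x. heis_norm x powr g) (\<lambda>x. ennreal \<bar>f x\<bar>)"

lemma nn_integral_heis: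
  fixes G :: "'n::finite heis \<Rightarrow> ennreal"
  assumes [measurable]: "G \<in> borel_measurable borel"
  shows "(\<integral>\<^sup>+x. G x \<partial>lborel) = (\<integral>\<^sup>+z. \<integral>\<^sup>+t. G (z, t) \<partial>lborel \<partial>lborel)"
  using lborel.nn_integral_fst[of G lborel] by (simp add: lborel_prod)

lemma nn_integral_lborel_shift:
  fixes c :: "'a::euclidean_space"
  assumes [measurable]: "G \<in> borel_measurable borel"
  shows "(\<integral>\<^sup>+x. G (c + x) \<partial>lborel) = (\<integral>\<^sup>+x. G x \<partial>lborel)"
  by (subst (2) lborel_distr_plus[of c, symmetric], subst nn_integral_distr) auto

lemma measurable_heis_mult [measurable]:
  "heis_mult (a :: 'n::finite heis) \<in> borel_measurable borel"
  by (intro borel_measurable_continuous_onI continuous_intros)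

lemma measurable_heis_dil [measurable]:
  "heis_dil r \<in> (borel :: 'n::finite heis measure) \<rightarrow>\<^sub>M borel"
  by (intro borel_measurable_continuous_onI continuous_intros)

text \<open>For fixed horizontal part z, left translation only shifts t, by an amount that depends
  on z alone. Translation invariance in t, then in z, therefore suffices.\<close>

lemma nn_integral_heis_mult:
  fixes G :: "'n::finite heis \<Rightarrow> ennreal"
  assumes [measurable]: "G \<in> borel_measurable borel"
  shows "(\<integral>\<^sup>+x. G (heis_mult a x) \<partial>lborel) = (\<integral>\<^sup>+x. G x \<partial>lborel)"
proof -
  have "(\<integral>\<^sup>+x. G (heis_mult a x) \<partial>lborel)
      = (\<integral>\<^sup>+z. \<integral>\<^sup>+t. G (fst a + z, (snd a + 2 * (heis_J (fst a) \<bullet> z)) + t) \<partial>lborel \<partial>lborel)"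
    using nn_integral_heis[OF measurable_compose[OF measurable_heis_mult assms], of a]
    by (simp add: heis_mult_eq ac_simps)
  also have "\<dots> = (\<integral>\<^sup>+z. \<integral>\<^sup>+t. G (fst a + z, t) \<partial>lborel \<partial>lborel)"
    by (intro nn_integral_cong nn_integral_lborel_shift) measurable
  also have "\<dots> = (\<integral>\<^sup>+z. \<integral>\<^sup>+t. G (z, t) \<partial>lborel \<partial>lborel)"
    by (rule nn_integral_lborel_shift[of "\<lambda>z. \<integral>\<^sup>+t. G (z, t) \<partial>lborel" "fst a"])
       (auto intro!: lborel.borel_measurable_nn_integral simp: borel_prod split_beta')
  finally show ?thesis by (simp add: nn_integral_heis)
qed

lemma nn_integral_scaleR:
  fixes G :: "'a::euclidean_space \<Rightarrow> ennreal"
  assumes [measurable]: "G \<in> borel_measurable borel" and r: "0 < r"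
  shows "(\<integral>\<^sup>+x. G x \<partial>lborel) = ennreal (r ^ DIM('a)) * (\<integral>\<^sup>+x. G (r *\<^sub>R x) \<partial>lborel)"
  using r by (subst lborel_affine[of r 0])
     (simp_all add: nn_integral_density nn_integral_distr nn_integral_cmult)

lemma nn_integral_heis_dil:
  fixes G :: "'n::finite heis \<Rightarrow> ennreal"
  assumes [measurable]: "G \<in> borel_measurable borel" and r: "0 < r"
  shows "(\<integral>\<^sup>+x. G x \<partial>lborel) = ennreal (r ^ hom_dim TYPE('n)) * (\<integral>\<^sup>+x. G (heis_dil r x) \<partial>lborel)"
proof -
  have [measurable]: "(\<lambda>z. \<integral>\<^sup>+t. G (z, t) \<partial>lborel) \<in> borel_measurable borel"
    "(\<lambda>z. \<integral>\<^sup>+t. G (r *\<^sub>R z, r\<^sup>2 * t) \<partial>lborel) \<in> borel_measurable borel"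
    by (auto intro!: lborel.borel_measurable_nn_integral simp: borel_prod split_beta')
  have [simp]: "(r ^ (2 * CARD('n)) * r\<^sup>2) = r ^ hom_dim TYPE('n)"
    by (simp add: hom_dim_def power_add[symmetric])
  have "(\<integral>\<^sup>+x. G x \<partial>lborel)
      = ennreal (r ^ (2 * CARD('n))) * (\<integral>\<^sup>+z. \<integral>\<^sup>+t. G (r *\<^sub>R z, t) \<partial>lborel \<partial>lborel)"
    by (subst nn_integral_heis, simp, subst nn_integral_scaleR[OF _ r]) (auto simp: card_UNIV_sum mult_2)
  also have "(\<integral>\<^sup>+z. \<integral>\<^sup>+t. G (r *\<^sub>R z, t) \<partial>lborel \<partial>lborel)
      = (\<integral>\<^sup>+z. ennreal (r\<^sup>2) * (\<integral>\<^sup>+t. G (r *\<^sub>R z, r\<^sup>2 * t) \<partial>lborel) \<partial>lborel)"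
    using r by (intro nn_integral_cong, subst nn_integral_real_affine[where c = "r\<^sup>2" and t = 0]) auto
  also have "\<dots> = ennreal (r\<^sup>2) * (\<integral>\<^sup>+x. G (heis_dil r x) \<partial>lborel)"
    using nn_integral_heis[OF measurable_compose[OF measurable_heis_dil assms(1)], of r]
    by (simp add: nn_integral_cmult heis_dil_def)
  finally show ?thesis using r by (simp add: mult.assoc[symmetric] ennreal_mult''[symmetric])
qed

section \<open>Integrals of radial functions\<close>

lemma nn_integral_powr_from_0:
  assumes "0 < c" "0 < t"
  shows "(\<integral>\<^sup>+r. ennreal (r powr (c - 1)) * indicator {0<..<t} r \<partial>lborel) = ennreal (t powr c / c)"
proof -
  have "((\<lambda>r. r powr (c - 1)) has_integral (t powr (c - 1 + 1) / (c - 1 + 1))) {0..t}"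
    using assms by (intro has_integral_powr_from_0) auto
  then have "(\<integral>\<^sup>+r. ennreal (r powr (c - 1)) * indicator {0..t} r \<partial>lborel) = ennreal (t powr c / c)"
    using assms by (subst nn_integral_has_integral_lebesgue') auto
  moreover have "(\<integral>\<^sup>+r. ennreal (r powr (c - 1)) * indicator {0..t} r \<partial>lborel)
      = (\<integral>\<^sup>+r. ennreal (r powr (c - 1)) * indicator {0<..<t} r \<partial>lborel)"
    using AE_lborel_singleton[of "0::real"] AE_lborel_singleton[of t]
    by (intro nn_integral_cong_AE, eventually_elim) (auto simp: indicator_def)
  ultimately show ?thesis by simp
qed

lemma nn_integral_powr_to_inf:
  assumes "c < 0" "0 < t"
  shows "(\<integral>\<^sup>+r. ennreal (r powr (c - 1)) * indicator {t..} r \<partial>lborel) = ennreal (t powr c / - c)"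
proof -
  have "((\<lambda>r. r powr (c - 1)) has_integral (- (t powr (c - 1 + 1)) / (c - 1 + 1))) {t..}"
    using assms by (intro has_integral_powr_to_inf) auto
  then show ?thesis using assms by (subst nn_integral_has_integral_lebesgue') auto
qed

lemma nn_integral_inverse_Icc:
  assumes "0 < s" "s \<le> t"
  shows "(\<integral>\<^sup>+r. ennreal (1 / r) * indicator {s..t} r \<partial>lborel) = ennreal (ln (t / s))"
  using assms by (subst nn_integral_FTC_Icc[where F = ln]) (auto intro!: DERIV_ln_divide simp: ln_div)

lemma ennreal_eq_topI: "(\<And>n::nat. ennreal (real n) \<le> x) \<Longrightarrow> x = top"
  by (metis ennreal_Ex_less_of_nat ennreal_of_nat_eq_real_of_nat less_top linorder_not_le)

lemma nn_integral_powr_from_0_infinite: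
  assumes "c \<le> 0" "0 < t"
  shows "(\<integral>\<^sup>+r. ennreal (r powr (c - 1)) * indicator {0<..<t} r \<partial>lborel) = \<infinity>"
proof -
  have "ennreal (real n) \<le> (\<integral>\<^sup>+r. ennreal (r powr (c - 1)) * indicator {0<..<t} r \<partial>lborel)" for n
  proof -
    \<comment> \<open>Below t the integrand is at least \<open>t powr c / r\<close>, whose integral
      from \<open>t / exp k\<close> to t is \<open>k * t powr c\<close>; this k makes it equal to
      n.\<close>
    define k where "k = real n / t powr c"
    have "ennreal (real n) = ennreal (t powr c) * ennreal k"
      using assms by (simp add: ennreal_mult'[symmetric] k_def)
    also have "ennreal k = (\<integral>\<^sup>+r. ennreal (1 / r) * indicator {t / exp k..t} r \<partial>lborel)"
      using assms by (subst nn_integral_inverse_Icc) (auto simp: k_def divide_simps)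
    also have "ennreal (t powr c) * \<dots> = (\<integral>\<^sup>+r. ennreal (t powr c) * (ennreal (1 / r) * indicator {t / exp k..t} r) \<partial>lborel)"
      by (intro nn_integral_cmult[symmetric]) auto
    also have "\<dots> \<le> (\<integral>\<^sup>+r. ennreal (r powr (c - 1)) * indicator {0<..<t} r \<partial>lborel)"
    proof (intro nn_integral_mono_AE, use AE_lborel_singleton[of t] in eventually_elim)
      fix r assume "r \<noteq> t"
      show "ennreal (t powr c) * (ennreal (1 / r) * indicator {t / exp k..t} r) \<le> ennreal (r powr (c - 1)) * indicator {0<..<t} r"
      proof (cases "r \<in> {t / exp k..t}")
        case True
        then have r: "0 < r" "r < t" using assms \<open>r \<noteq> t\<close>
          by (auto intro: less_le_trans[of 0 "t / exp k"])
        then have "t powr c \<le> r powr c" using assms by (intro powr_mono2') auto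
        then have "t powr c * (1 / r) \<le> r powr (c - 1)" using r by (simp add: powr_diff divide_right_mono)
        then show ?thesis using r True by (simp add: ennreal_mult'[symmetric] ennreal_leI)
      qed simp
    qed
    finally show ?thesis .
  qed
  then show ?thesis using ennreal_eq_topI by (simp add: infinity_ennreal_def)
qed

lemma nn_integral_powr_to_inf_infinite:
  assumes "0 \<le> c" "1 \<le> t"
  shows "(\<integral>\<^sup>+r. ennreal (r powr (c - 1)) * indicator {t..} r \<partial>lborel) = \<infinity>"
proof -
  have "ennreal (real n) \<le> (\<integral>\<^sup>+r. ennreal (r powr (c - 1)) * indicator {t..} r \<partial>lborel)" for n
  proof -
    have "ennreal (real n) = (\<integral>\<^sup>+r. ennreal (1 / r) * indicator {t..t * exp n} r \<partial>lborel)"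
      using assms by (subst nn_integral_inverse_Icc) auto
    also have "\<dots> \<le> (\<integral>\<^sup>+r. ennreal (r powr (c - 1)) * indicator {t..} r \<partial>lborel)"
    proof (intro nn_integral_mono)
      fix r
      show "ennreal (1 / r) * indicator {t..t * exp n} r \<le> ennreal (r powr (c - 1)) * indicator {t..} r"
      proof (cases "r \<in> {t..t * exp n}")
        case True
        then have r: "1 \<le> r" "t \<le> r" using assms by auto
        then have "1 / r \<le> r powr (c - 1)" using assms(1) by (simp add: powr_diff divide_right_mono ge_one_powr_ge_zero)
        then show ?thesis using r True by (simp add: ennreal_leI)
      qed simp
    qed
    finally show ?thesis .
  qed
  then show ?thesis using ennreal_eq_topI by (simp add: infinity_ennreal_def)
qed

section \<open>Volumes of balls and the distribution of the norm\<close>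

lemma hom_dim_ge_4: "4 \<le> hom_dim TYPE('n::finite)"
proof -
  have "1 \<le> CARD('n)" by (simp add: Suc_le_eq)
  then show ?thesis by (simp add: hom_dim_def)
qed

lemma emeasure_heis_ball_finite: "emeasure lborel (heis_ball a R) < \<infinity>"
  using emeasure_bounded_finite[OF bounded_heis_ball] .

lemma unit_ball_vol_nonneg: "0 \<le> unit_ball_vol TYPE('n::finite)"
  by (simp add: unit_ball_vol_def)

lemma emeasure_heis_ball_0:
  assumes "0 < r"
  shows "emeasure lborel (heis_ball (0 :: 'n::finite heis) r)
       = ennreal (r ^ hom_dim TYPE('n) * unit_ball_vol TYPE('n))"
proof -
  have "emeasure lborel (heis_ball (0 :: 'n heis) r)
      = ennreal (r ^ hom_dim TYPE('n)) * (\<integral>\<^sup>+x. indicator (heis_ball 0 r) (heis_dil r x :: 'n heis) \<partial>lborel)"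
    using nn_integral_heis_dil[of "indicator (heis_ball (0 :: 'n heis) r)" r] assms by simp
  also have "(\<lambda>x. indicator (heis_ball 0 r) (heis_dil r x :: 'n heis)) = (indicator (heis_ball 0 1) :: _ \<Rightarrow> ennreal)"
    using assms by (auto simp: fun_eq_iff indicator_def heis_ball_0 heis_norm_dil)
  also have "(\<integral>\<^sup>+x. indicator (heis_ball 0 1) (x :: 'n heis) \<partial>lborel) = ennreal (unit_ball_vol TYPE('n))"
    using emeasure_heis_ball_finite[of "0 :: 'n heis" 1]
    by (simp add: unit_ball_vol_def emeasure_eq_ennreal_measure less_top)
  finally show ?thesis using assms by (simp add: ennreal_mult' unit_ball_vol_nonneg)
qed

lemma emeasure_heis_ball:
  assumes "0 < r"
  shows "emeasure lborel (heis_ball (a :: 'n::finite heis) r)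
       = ennreal (r ^ hom_dim TYPE('n) * unit_ball_vol TYPE('n))"
proof -
  have "emeasure lborel (heis_ball a r) = (\<integral>\<^sup>+x. indicator (heis_ball a r) (heis_mult a x) \<partial>lborel)"
    using nn_integral_heis_mult[of "indicator (heis_ball a r)" a] by simp
  also have "(\<lambda>x. indicator (heis_ball a r) (heis_mult a x)) = (indicator (heis_ball 0 r) :: _ \<Rightarrow> ennreal)"
    by (simp add: fun_eq_iff indicator_def heis_ball_iff heis_dist_eq' heis_mult_zero del: heis_dist_zero)
  finally show ?thesis using emeasure_heis_ball_0[OF assms] by simp
qed

lemma unit_ball_vol_pos: "0 < unit_ball_vol TYPE('n::finite)"
proof -
  have "(0 :: 'n heis) \<in> heis_ball 0 1" by (simp add: heis_ball_0)
  then have "heis_ball (0 :: 'n heis) 1 \<noteq> {}" by blast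
  then have "heis_ball (0 :: 'n heis) 1 \<notin> null_sets lborel"
    using open_not_negligible[OF open_heis_ball] null_sets_completionI
    unfolding negligible_iff_null_sets by blast
  then have "emeasure lborel (heis_ball (0 :: 'n heis) 1) \<noteq> 0"
    by (auto simp: null_sets_def)
  then show ?thesis using emeasure_heis_ball_0[of 1, where ?'n = 'n] unit_ball_vol_nonneg[where ?'n = 'n]
    by (cases "unit_ball_vol TYPE('n) = 0") auto
qed

lemma omega_Q_pos: "0 < omega_Q TYPE('n::finite)"
  using unit_ball_vol_pos[where ?'n = 'n] hom_dim_ge_4[where ?'n = 'n] by (simp add: omega_Q_def)

lemma heis_norm_exists:
  assumes "0 \<le> r"
  shows "\<exists>x :: 'n::finite heis. heis_norm x = r"
  using assms by (intro exI[of _ "(0, r\<^sup>2)"] heis_norm_eqI) (auto simp flip: power_mult)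

text \<open>Both measures agree on the half lines \<open>{..<r}\<close>, where the left one is the
  volume of a centred ball, and these form an intersection-stable generator. This takes the place of
  polar coordinates for radial integrands.\<close>

lemma distr_heis_norm:
  "distr (lborel :: 'n::finite heis measure) borel heis_norm
     = density lborel (\<lambda>r. ennreal (omega_Q TYPE('n) * r ^ (hom_dim TYPE('n) - 1)) * indicator {0<..} r)"
    (is "?M = ?N")
proof -
  let ?Q = "hom_dim TYPE('n)"
  have Q: "0 < ?Q" using hom_dim_ge_4[where ?'n = 'n] by simp
  have M: "emeasure ?M {..<r} = (if 0 < r then ennreal (r ^ ?Q * unit_ball_vol TYPE('n)) else 0)" for r
  proof -
    have "heis_norm -` {..<r} = heis_ball (0 :: 'n heis) r" by (auto simp: heis_ball_0)
    moreover have "heis_ball (0 :: 'n heis) r = {}" if "r \<le> 0"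
      using that by (auto simp: heis_ball_0 not_less intro: order_trans)
    ultimately show ?thesis by (auto simp: emeasure_distr emeasure_heis_ball_0)
  qed
  have N: "emeasure ?N {..<r} = (if 0 < r then ennreal (r ^ ?Q * unit_ball_vol TYPE('n)) else 0)" for r
  proof -
    have "emeasure ?N {..<r} = (\<integral>\<^sup>+x. ennreal (omega_Q TYPE('n)) * (ennreal (x powr (real ?Q - 1)) * indicator {0<..<r} x) \<partial>lborel)"
      using Q omega_Q_pos[where ?'n = 'n]
      by (auto simp: emeasure_density intro!: nn_integral_cong split: split_indicator)
         (auto simp: powr_realpow[symmetric] of_nat_diff ennreal_mult)
    also have "\<dots> = ennreal (omega_Q TYPE('n)) * (\<integral>\<^sup>+x. ennreal (x powr (real ?Q - 1)) * indicator {0<..<r} x \<partial>lborel)"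
      by (intro nn_integral_cmult) auto
    also have "\<dots> = (if 0 < r then ennreal (r ^ ?Q * unit_ball_vol TYPE('n)) else 0)"
    proof (cases "0 < r")
      case True
      then show ?thesis using Q omega_Q_pos[where ?'n = 'n]
        by (subst nn_integral_powr_from_0)
           (auto simp: ennreal_mult'[symmetric] powr_realpow omega_Q_def mult.commute)
    qed simp
    finally show ?thesis .
  qed
  show ?thesis
  proof (rule measure_eqI_generator_eq[where E = "range lessThan" and \<Omega> = UNIV and A = "\<lambda>i. {..<real i}"])
    have "{..<a} \<inter> {..<b} = {..<min a b}" for a b :: real by auto
    then show "Int_stable (range (lessThan :: real \<Rightarrow> _))"
      by (auto simp: Int_stable_def)
    show "sets ?M = sigma_sets UNIV (range lessThan)" "sets ?N = sigma_sets UNIV (range lessThan)"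
      by (simp_all add: borel_Iio)
    show "(\<Union>i. {..<real i}) = UNIV" by (auto intro: reals_Archimedean2)
    show "emeasure ?M X = emeasure ?N X" if "X \<in> range lessThan" for X
      using that by (elim rangeE) (simp only: M N)
    show "emeasure ?M {..<real i} \<noteq> \<infinity>" for i by (simp only: M) simp
  qed auto
qed

lemma nn_integral_radial:
  fixes g :: "real \<Rightarrow> ennreal"
  assumes [measurable]: "g \<in> borel_measurable borel"
  shows "(\<integral>\<^sup>+x. g (heis_norm x) \<partial>(lborel :: 'n::finite heis measure))
       = ennreal (omega_Q TYPE('n)) * (\<integral>\<^sup>+r. ennreal (r powr (real (hom_dim TYPE('n)) - 1)) * g r * indicator {0<..} r \<partial>lborel)"
proof -
  have Q: "0 < hom_dim TYPE('n)" using hom_dim_ge_4[where ?'n = 'n] by simp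
  have "(\<integral>\<^sup>+x. g (heis_norm x) \<partial>(lborel :: 'n heis measure)) = (\<integral>\<^sup>+r. g r \<partial>distr (lborel :: 'n heis measure) borel heis_norm)"
    by (simp add: nn_integral_distr)
  also have "\<dots> = (\<integral>\<^sup>+r. ennreal (omega_Q TYPE('n)) * (ennreal (r powr (real (hom_dim TYPE('n)) - 1)) * g r * indicator {0<..} r) \<partial>lborel)"
    unfolding distr_heis_norm using omega_Q_pos[where ?'n = 'n] Q
    by (auto simp: nn_integral_density intro!: nn_integral_cong split: split_indicator)
       (auto simp: powr_realpow[symmetric] of_nat_diff ennreal_mult ac_simps)
  finally show ?thesis by (simp add: nn_integral_cmult)
qed

lemma nn_integral_heis_powr:
  fixes g :: "real \<Rightarrow> ennreal" and \<beta> :: real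
  assumes [measurable]: "g \<in> borel_measurable borel"
  shows "(\<integral>\<^sup>+x. ennreal (heis_norm x powr \<beta>) * g (heis_norm x) \<partial>(lborel :: 'n::finite heis measure))
       = ennreal (omega_Q TYPE('n)) *
         (\<integral>\<^sup>+r. ennreal (r powr (\<beta> + hom_dim TYPE('n) - 1)) * (g r * indicator {0<..} r) \<partial>lborel)"
proof -
  have eq: "ennreal (r powr (real (hom_dim TYPE('n)) - 1)) * (ennreal (r powr \<beta>) * g r) * indicator {0<..} r
      = ennreal (r powr (\<beta> + hom_dim TYPE('n) - 1)) * (g r * indicator {0<..} r)" for r
  proof -
    have "r powr (real (hom_dim TYPE('n)) - 1) * r powr \<beta> = r powr (\<beta> + hom_dim TYPE('n) - 1)"
      by (subst powr_add[symmetric]) (rule arg_cong, simp)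
    then have "ennreal (r powr (real (hom_dim TYPE('n)) - 1)) * ennreal (r powr \<beta>) = ennreal (r powr (\<beta> + hom_dim TYPE('n) - 1))"
      by (simp add: ennreal_mult'[symmetric])
    then show ?thesis by (simp only: mult.assoc[symmetric])
  qed
  show ?thesis
    by (subst nn_integral_radial[of "\<lambda>r. ennreal (r powr \<beta>) * g r"]) (measurable, simp only: eq)
qed

lemma nn_integral_heis_powr_less:
  fixes t \<beta> :: real
  assumes t: "0 < t"
  shows "(\<integral>\<^sup>+x\<in>{x. heis_norm x < t}. ennreal (heis_norm x powr \<beta>) \<partial>(lborel :: 'n::finite heis measure))
       = (if 0 < \<beta> + hom_dim TYPE('n)
          then ennreal (omega_Q TYPE('n) * t powr (\<beta> + hom_dim TYPE('n)) / (\<beta> + hom_dim TYPE('n))) else \<infinity>)"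
proof -
  have "(\<integral>\<^sup>+x\<in>{x. heis_norm x < t}. ennreal (heis_norm x powr \<beta>) \<partial>(lborel :: 'n heis measure))
      = (\<integral>\<^sup>+x. ennreal (heis_norm x powr \<beta>) * indicator {..<t} (heis_norm x) \<partial>(lborel :: 'n heis measure))"
    by (intro nn_integral_cong) (auto split: split_indicator)
  also have "\<dots> = ennreal (omega_Q TYPE('n)) *
         (\<integral>\<^sup>+r. ennreal (r powr (\<beta> + hom_dim TYPE('n) - 1)) * (indicator {..<t} r * indicator {0<..} r) \<partial>lborel)"
    by (subst nn_integral_heis_powr) auto
  also have "(\<lambda>r. indicator {..<t} r * indicator {0<..} r) = (indicator {0<..<t} :: real \<Rightarrow> ennreal)"
    by (auto split: split_indicator)
  finally show ?thesis using t omega_Q_pos[where ?'n = 'n]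
    by (auto simp: nn_integral_powr_from_0 nn_integral_powr_from_0_infinite ennreal_mult'[symmetric] ennreal_mult_top)
qed

lemma nn_integral_heis_powr_ge:
  fixes t \<beta> :: real
  assumes t: "0 < t" and \<beta>: "\<beta> + hom_dim TYPE('n) < 0"
  shows "(\<integral>\<^sup>+x\<in>{x. t \<le> heis_norm x}. ennreal (heis_norm x powr \<beta>) \<partial>(lborel :: 'n::finite heis measure))
       = ennreal (omega_Q TYPE('n) * t powr (\<beta> + hom_dim TYPE('n)) / - (\<beta> + hom_dim TYPE('n)))"
proof -
  have "(\<integral>\<^sup>+x\<in>{x. t \<le> heis_norm x}. ennreal (heis_norm x powr \<beta>) \<partial>(lborel :: 'n heis measure))
      = (\<integral>\<^sup>+x. ennreal (heis_norm x powr \<beta>) * indicator {t..} (heis_norm x) \<partial>(lborel :: 'n heis measure))"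
    by (intro nn_integral_cong) (auto split: split_indicator)
  also have "\<dots> = ennreal (omega_Q TYPE('n)) *
         (\<integral>\<^sup>+r. ennreal (r powr (\<beta> + hom_dim TYPE('n) - 1)) * (indicator {t..} r * indicator {0<..} r) \<partial>lborel)"
    by (subst nn_integral_heis_powr) auto
  also have "(\<lambda>r. indicator {t..} r * indicator {0<..} r) = (indicator {t..} :: real \<Rightarrow> ennreal)"
    using t by (auto split: split_indicator)
  finally show ?thesis using t \<beta> omega_Q_pos[where ?'n = 'n]
    by (simp add: nn_integral_powr_to_inf ennreal_mult'[symmetric])
qed

lemma nn_integral_heis_powr_annulus:
  assumes "0 < s" "s \<le> t"
  shows "(\<integral>\<^sup>+x\<in>(heis_annulus s t).
            ennreal (heis_norm x powr - real (hom_dim TYPE('n))) \<partial>(lborel :: 'n::finite heis measure))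
       = ennreal (omega_Q TYPE('n) * ln (t / s))"
proof -
  have "(\<integral>\<^sup>+x\<in>(heis_annulus s t). ennreal (heis_norm x powr - real (hom_dim TYPE('n))) \<partial>(lborel :: 'n heis measure))
      = (\<integral>\<^sup>+x. ennreal (heis_norm x powr - real (hom_dim TYPE('n))) * indicator {s..t} (heis_norm x) \<partial>(lborel :: 'n heis measure))"
    by (intro nn_integral_cong) (auto split: split_indicator)
  also have "\<dots> = ennreal (omega_Q TYPE('n)) *
         (\<integral>\<^sup>+r. ennreal (r powr (- 1)) * (indicator {s..t} r * indicator {0<..} r) \<partial>lborel)"
    by (subst nn_integral_heis_powr) auto
  also have "(\<integral>\<^sup>+r. ennreal (r powr (- 1)) * (indicator {s..t} r * indicator {0<..} r) \<partial>lborel)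
     = (\<integral>\<^sup>+r. ennreal (1 / r) * indicator {s..t} r \<partial>lborel)"
    using assms by (intro nn_integral_cong) (auto simp: powr_minus_divide split: split_indicator)
  finally show ?thesis using assms omega_Q_pos[where ?'n = 'n]
    by (simp add: nn_integral_inverse_Icc ennreal_mult'[symmetric])
qed

section \<open>Extended powers and Hoelder's inequality\<close>

lemma epowr_0 [simp]: "epowr x 0 = 1"
  by (simp add: epowr_def)

lemma epowr_ennreal_pos: "0 < r \<Longrightarrow> epowr (ennreal r) s = ennreal (r powr s)"
  by (simp add: epowr_def)

lemma epowr_ennreal: "0 \<le> r \<Longrightarrow> 0 < s \<Longrightarrow> epowr (ennreal r) s = ennreal (r powr s)"
  by (cases "r = 0") (auto simp: epowr_def)

lemma epowr_top: "epowr top s = (if s = 0 then 1 else if 0 < s then top else 0)"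
  by (simp add: epowr_def infinity_ennreal_def)

lemma epowr_zero: "epowr 0 s = (if s = 0 then 1 else if 0 < s then 0 else top)"
  by (simp add: epowr_def infinity_ennreal_def)

lemma epowr_1 [simp]: "epowr x 1 = x"
  by (cases x) (auto simp: epowr_top epowr_ennreal)

lemma epowr_eq_0_iff: "0 < s \<Longrightarrow> epowr x s = 0 \<longleftrightarrow> x = 0"
  by (cases x) (auto simp: epowr_top epowr_ennreal)

lemma epowr_eq_top_iff: "0 < s \<Longrightarrow> epowr x s = top \<longleftrightarrow> x = top"
  by (cases x) (auto simp: epowr_top epowr_ennreal)

lemma epowr_mono: "0 \<le> s \<Longrightarrow> x \<le> y \<Longrightarrow> epowr x s \<le> epowr y s"
  by (cases "s = 0"; cases x; cases y) (auto simp: epowr_top epowr_ennreal top_unique intro!: ennreal_leI powr_mono2)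

lemma epowr_mult: "0 \<le> s \<Longrightarrow> epowr (x * y) s = epowr x s * epowr y s"
proof (cases "s = 0")
  case False
  assume "0 \<le> s"
  with False have s: "0 < s" by simp
  then show ?thesis
    by (cases x; cases y)
       (auto simp: epowr_top epowr_ennreal epowr_zero ennreal_mult_top ennreal_top_mult ennreal_mult[symmetric] powr_mult)
qed simp

lemma epowr_epowr: "0 \<le> a \<Longrightarrow> 0 \<le> b \<Longrightarrow> epowr (epowr x a) b = epowr x (a * b)"
proof (cases "a = 0 \<or> b = 0")
  case True
  then show ?thesis using epowr_ennreal_pos[of 1 b] by auto
next
  case False
  assume "0 \<le> a" "0 \<le> b"
  with False have "0 < a" "0 < b" by auto
  then show ?thesis by (cases x) (auto simp: epowr_top epowr_ennreal powr_powr)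
qed

lemma epowr_add: "0 \<le> a \<Longrightarrow> 0 \<le> b \<Longrightarrow> epowr x (a + b) = epowr x a * epowr x b"
proof (cases "a = 0 \<or> b = 0")
  case False
  assume "0 \<le> a" "0 \<le> b"
  with False have "0 < a" "0 < b" by auto
  then show ?thesis by (cases x) (auto simp: epowr_top epowr_ennreal powr_add ennreal_mult)
qed auto

lemma epowr_prod: "0 \<le> s \<Longrightarrow> epowr (\<Prod>i\<in>I. f i) s = (\<Prod>i\<in>I. epowr (f i) s)"
  using epowr_ennreal_pos[of 1 s] by (induction I rule: infinite_finite_induct) (auto simp: epowr_mult)

lemma borel_measurable_epowr [measurable]:
  "f \<in> borel_measurable M \<Longrightarrow> (\<lambda>x. epowr (f x) s) \<in> borel_measurable M"
proof -
  assume [measurable]: "f \<in> borel_measurable M"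
  have top: "{x \<in> space M. f x = \<infinity>} \<in> sets M" and zero: "{x \<in> space M. f x = 0} \<in> sets M"
    by measurable
  show ?thesis
    unfolding epowr_def by (intro measurable_If top zero) auto
qed

section \<open>Hoelder's inequality for finitely many factors\<close>

lemma weighted_AM_GM:
  fixes w x :: "'i \<Rightarrow> real"
  assumes "finite I" "\<And>i. i \<in> I \<Longrightarrow> 0 < w i" "sum w I = 1" "\<And>i. i \<in> I \<Longrightarrow> 0 \<le> x i"
  shows "(\<Prod>i\<in>I. x i powr w i) \<le> (\<Sum>i\<in>I. w i * x i)"
proof (cases "\<exists>i\<in>I. x i = 0")
  case True
  then have "(\<Prod>i\<in>I. x i powr w i) = 0" using assms(1) by (intro prod_zero) auto
  moreover have "0 \<le> (\<Sum>i\<in>I. w i * x i)"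
    by (intro sum_nonneg mult_nonneg_nonneg assms(2,4) less_imp_le)
  ultimately show ?thesis by simp
next
  case False
  then have pos: "0 < x i" if "i \<in> I" for i using assms(4)[OF that] that by force
  have nz: "x i \<noteq> 0" if "i \<in> I" for i using pos[OF that] by simp
  have "I \<noteq> {}" using assms by auto
  \<comment> \<open>Convexity of the exponential at the points \<open>ln (x i)\<close>; zero factors
    were split off before.\<close>
  then have "exp (\<Sum>i\<in>I. w i *\<^sub>R ln (x i)) \<le> (\<Sum>i\<in>I. w i * exp (ln (x i)))"
    using assms(1,3) by (intro convex_on_sum[OF _ _ exp_convex]) (auto intro: less_imp_le[OF assms(2)])
  also have "exp (\<Sum>i\<in>I. w i *\<^sub>R ln (x i)) = (\<Prod>i\<in>I. x i powr w i)"
    unfolding exp_sum[OF assms(1)] by (intro prod.cong) (auto simp: powr_def nz)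
  also have "(\<Sum>i\<in>I. w i * exp (ln (x i))) = (\<Sum>i\<in>I. w i * x i)"
    using pos by (intro sum.cong) auto
  finally show ?thesis .
qed

lemma weighted_AM_GM_ennreal:
  fixes w :: "'i \<Rightarrow> real" and x :: "'i \<Rightarrow> ennreal"
  assumes "finite I" "\<And>i. i \<in> I \<Longrightarrow> 0 < w i" "sum w I = 1"
  shows "(\<Prod>i\<in>I. epowr (x i) (w i)) \<le> (\<Sum>i\<in>I. ennreal (w i) * x i)"
proof (cases "\<exists>i\<in>I. x i = top")
  case True
  then obtain i where i: "i \<in> I" "x i = top" by blast
  have "top \<le> ennreal (w i) * x i" using assms(2)[OF i(1)] i by (simp add: ennreal_mult_top)
  also have "\<dots> \<le> (\<Sum>i\<in>I. ennreal (w i) * x i)" using i assms(1) by (intro member_le_sum) auto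
  finally show ?thesis by (simp add: top_unique)
next
  case False
  define y where "y i = enn2real (x i)" for i
  have x: "x i = ennreal (y i)" "0 \<le> y i" if "i \<in> I" for i
    using False that by (auto simp: y_def less_top)
  have "(\<Prod>i\<in>I. epowr (x i) (w i)) = ennreal (\<Prod>i\<in>I. y i powr w i)"
    using x assms by (subst prod_ennreal[symmetric]) (auto simp: epowr_ennreal intro!: prod.cong)
  also have "\<dots> \<le> ennreal (\<Sum>i\<in>I. w i * y i)"
    using assms x by (intro ennreal_leI weighted_AM_GM) auto
  also have "\<dots> = (\<Sum>i\<in>I. ennreal (w i) * x i)"
    using x assms by (subst sum_ennreal[symmetric]) (auto simp: ennreal_mult less_imp_le intro!: sum.cong)
  finally show ?thesis .
qed

text \<open>Dividing every factor by its integral normalises all integrals to 1, and integrating the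
  weighted AM-GM inequality then gives the sum of the weights, that is 1.\<close>

lemma Hoelder_nn_integral_prod:
  fixes w :: "'i \<Rightarrow> real" and g :: "'i \<Rightarrow> 'a \<Rightarrow> ennreal"
  assumes I: "finite I" "\<And>i. i \<in> I \<Longrightarrow> 0 < w i" "sum w I = 1"
    and [measurable]: "\<And>i. i \<in> I \<Longrightarrow> g i \<in> borel_measurable M"
  shows "(\<integral>\<^sup>+x. (\<Prod>i\<in>I. epowr (g i x) (w i)) \<partial>M) \<le> (\<Prod>i\<in>I. epowr (\<integral>\<^sup>+x. g i x \<partial>M) (w i))"
proof -
  define N where "N i = (\<integral>\<^sup>+x. g i x \<partial>M)" for i
  \<comment> \<open>The order matters: as 0 * \<infinity> = 0, an infinite integral makes the
    right-hand side infinite only after vanishing integrals have been excluded.\<close>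
  consider i where "i \<in> I" "N i = 0" | "\<And>i. i \<in> I \<Longrightarrow> N i \<noteq> 0" "\<exists>i\<in>I. N i = top"
    | "\<And>i. i \<in> I \<Longrightarrow> N i \<noteq> 0" "\<And>i. i \<in> I \<Longrightarrow> N i \<noteq> top" by blast
  then have "(\<integral>\<^sup>+x. (\<Prod>i\<in>I. epowr (g i x) (w i)) \<partial>M) \<le> (\<Prod>i\<in>I. epowr (N i) (w i))"
  proof cases
    case 1
    then have "AE x in M. g i x = 0" using nn_integral_0_iff_AE[of "g i" M] by (auto simp: N_def)
    then have "AE x in M. (\<Prod>i\<in>I. epowr (g i x) (w i)) = 0"
    proof eventually_elim
      case (elim x)
      then show ?case using 1(1) I by (intro prod_zero) (auto simp: epowr_eq_0_iff)
    qed
    then have "(\<integral>\<^sup>+x. (\<Prod>i\<in>I. epowr (g i x) (w i)) \<partial>M) = (\<integral>\<^sup>+x. 0 \<partial>M)"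
      by (intro nn_integral_cong_AE)
    then show ?thesis by simp
  next
    case 2
    then have "(\<Prod>i\<in>I. epowr (N i) (w i)) = top"
      using I by (auto simp: ennreal_prod_eq_top epowr_eq_0_iff epowr_eq_top_iff)
    then show ?thesis by simp
  next
    case 3
    define r where "r i = enn2real (N i)" for i
    have r: "N i = ennreal (r i)" "0 < r i" if "i \<in> I" for i
      using 3 that by (auto simp: r_def less_top enn2real_positive_iff zero_less_iff_neq_zero)
    have "(\<integral>\<^sup>+x. (\<Prod>i\<in>I. epowr (g i x) (w i)) \<partial>M)
        = (\<integral>\<^sup>+x. (\<Prod>i\<in>I. epowr (N i) (w i)) * (\<Prod>i\<in>I. epowr (ennreal (1 / r i) * g i x) (w i)) \<partial>M)"
    proof (intro nn_integral_cong)
      fix x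
      have "epowr (N i) (w i) * epowr (ennreal (1 / r i) * g i x) (w i) = epowr (g i x) (w i)" if "i \<in> I" for i
      proof -
        have "epowr (N i) (w i) * epowr (ennreal (1 / r i) * g i x) (w i)
            = epowr (ennreal (r i) * ennreal (1 / r i) * g i x) (w i)"
          using I(2)[OF that] r[OF that] by (simp add: epowr_mult less_imp_le mult.assoc)
        also have "ennreal (r i) * ennreal (1 / r i) = 1"
          using r[OF that] by (simp add: ennreal_mult'[symmetric])
        finally show ?thesis by simp
      qed
      then show "(\<Prod>i\<in>I. epowr (g i x) (w i)) = (\<Prod>i\<in>I. epowr (N i) (w i)) * (\<Prod>i\<in>I. epowr (ennreal (1 / r i) * g i x) (w i))"
        by (simp add: prod.distrib[symmetric])
    qed
    also have "\<dots> \<le> (\<integral>\<^sup>+x. (\<Prod>i\<in>I. epowr (N i) (w i)) * (\<Sum>i\<in>I. ennreal (w i) * (ennreal (1 / r i) * g i x)) \<partial>M)"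
      using I by (intro nn_integral_mono mult_left_mono weighted_AM_GM_ennreal) auto
    also have "\<dots> = (\<Prod>i\<in>I. epowr (N i) (w i)) * (\<Sum>i\<in>I. ennreal (w i) * (ennreal (1 / r i) * N i))"
      by (simp add: nn_integral_cmult nn_integral_sum N_def)
    also have "(\<Sum>i\<in>I. ennreal (w i) * (ennreal (1 / r i) * N i)) = (\<Sum>i\<in>I. ennreal (w i))"
    proof (intro sum.cong refl)
      fix i assume "i \<in> I"
      then have "ennreal (1 / r i) * N i = 1" using r[of i] by (simp add: ennreal_mult'[symmetric])
      then show "ennreal (w i) * (ennreal (1 / r i) * N i) = ennreal (w i)" by simp
    qed
    also have "\<dots> = 1" using I by (subst sum_ennreal) (auto simp: less_imp_le)
    finally show ?thesis by simp
  qed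
  then show ?thesis by (simp add: N_def)
qed

lemma Hoelder_nn_integral:
  assumes "0 < a" "0 < b" "a + b = 1"
    and [measurable]: "f \<in> borel_measurable M" "g \<in> borel_measurable M"
  shows "(\<integral>\<^sup>+x. epowr (f x) a * epowr (g x) b \<partial>M) \<le> epowr (\<integral>\<^sup>+x. f x \<partial>M) a * epowr (\<integral>\<^sup>+x. g x \<partial>M) b"
  using Hoelder_nn_integral_prod[of "UNIV :: bool set" "\<lambda>i. if i then a else b" "\<lambda>i. if i then f else g" M] assms
  by (simp add: UNIV_bool if_distrib mult.commute add.commute all_bool_eq split: if_splits)

section \<open>The layer-cake formula for the operator\<close>

interpretation heis_prod: product_sigma_finite "\<lambda>_ :: nat. lborel :: 'n::finite heis measure"
  by standard

text \<open>With R the largest of the norms and c = mQ, the kernel is \<open>R powr (- c)\<close>,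
  the integral of \<open>c * t powr (- c - 1)\<close> over t > R. The point is that the condition t
  > R factorises into one condition per variable, which decouples the m variables.\<close>

lemma HLP_kernel:
  fixes y :: "nat \<Rightarrow> 'n::finite heis"
  assumes r: "0 < r" and m: "1 \<le> m"
  shows "ennreal (1 / (Max (insert (r ^ hom_dim TYPE('n)) ((\<lambda>j. heis_norm (y j) ^ hom_dim TYPE('n)) ` {1..m}))) ^ m)
       = (\<integral>\<^sup>+t. ennreal (real m * hom_dim TYPE('n) * t powr (- (real m * hom_dim TYPE('n)) - 1)) * indicator {r<..} t *
            (\<Prod>j\<in>{1..m}. indicator {z. heis_norm z < t} (y j)) \<partial>lborel)"
proof -
  let ?Q = "hom_dim TYPE('n)"
  define R where "R = Max (insert r ((\<lambda>j. heis_norm (y j)) ` {1..m}))"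
  have R: "r \<le> R" "0 < R" unfolding R_def using r by (auto simp: Max_ge_iff less_max_iff_disj intro: less_le_trans[OF r])
  \<comment> \<open>The power commutes with the maximum because it is monotone; replacing s by
    \<open>max 0 s\<close> makes it monotone on all of the real line without changing it at the
    norms.\<close>
  have "Max (insert (r ^ ?Q) ((\<lambda>j. heis_norm (y j) ^ ?Q) ` {1..m}))
      = Max ((\<lambda>s. max 0 s ^ ?Q) ` insert r ((\<lambda>j. heis_norm (y j)) ` {1..m}))"
    using r by (auto simp: image_image max_def intro!: arg_cong[where f = Max])
  also have "\<dots> = max 0 R ^ ?Q"
    unfolding R_def by (intro mono_Max_commute[symmetric] monoI power_mono) auto
  finally have Max: "Max (insert (r ^ ?Q) ((\<lambda>j. heis_norm (y j) ^ ?Q) ` {1..m})) = R ^ ?Q"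
    using R by simp
  define c where "c = real m * real ?Q"
  have c: "0 < c" using m hom_dim_ge_4[where ?'n = 'n] by (simp add: c_def)
  have ind: "indicator {r<..} t * (\<Prod>j\<in>{1..m}. indicator {z. heis_norm z < t} (y j)) = (indicator {R<..} t :: ennreal)" for t
  proof (cases "R < t")
    case True
    then have "r < t" "\<And>j. j \<in> {1..m} \<Longrightarrow> heis_norm (y j) < t" by (auto simp: R_def)
    with True show ?thesis by simp
  next
    case False
    then have "\<not> r < t \<or> (\<exists>j\<in>{1..m}. \<not> heis_norm (y j) < t)" by (auto simp: R_def)
    then have "indicator {r<..} t = (0 :: ennreal) \<or> (\<Prod>j\<in>{1..m}. indicator {z. heis_norm z < t} (y j)) = (0 :: ennreal)"
    proof
      assume "\<exists>j\<in>{1..m}. \<not> heis_norm (y j) < t"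
      then have "(\<Prod>j\<in>{1..m}. indicator {z. heis_norm z < t} (y j)) = (0 :: ennreal)"
        by (intro prod_zero) (auto simp: indicator_def)
      then show ?thesis ..
    qed simp
    with False show ?thesis by auto
  qed
  have "(\<integral>\<^sup>+t. ennreal (c * t powr (- c - 1)) * indicator {r<..} t * (\<Prod>j\<in>{1..m}. indicator {z. heis_norm z < t} (y j)) \<partial>lborel)
      = (\<integral>\<^sup>+t. ennreal c * (ennreal (t powr (- c - 1)) * indicator {R..} t) \<partial>lborel)"
    unfolding mult.assoc ind using AE_lborel_singleton[of R]
    by (intro nn_integral_cong_AE, eventually_elim)
       (use c in \<open>auto simp: ennreal_mult mult.assoc split: split_indicator\<close>)
  also have "\<dots> = ennreal c * ennreal (R powr (- c) / c)"
    using c R by (subst nn_integral_cmult) (auto simp: nn_integral_powr_to_inf)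
  also have "\<dots> = ennreal (R powr (- c))" using c by (simp add: ennreal_mult'[symmetric])
  also have "R powr (- c) = 1 / (R ^ ?Q) ^ m"
    using R(2) powr_realpow[OF R(2), of "?Q * m"]
    by (simp add: c_def powr_minus_divide power_mult[symmetric] mult.commute)
  finally show ?thesis unfolding Max c_def by simp
qed

text \<open>After the kernel is written as an integral over t, Tonelli's theorem moves t outside,
  and for fixed t the m-fold integral is a product of integrals over centred balls of radius t. Both
  the value of the constant and the lower bounds for necessity are read off from this form.\<close>

lemma HLP_layer_cake:
  fixes f :: "nat \<Rightarrow> 'n::finite heis \<Rightarrow> real"
  assumes m: "1 \<le> m" and x: "x \<noteq> 0"
    and meas: "\<And>j. j \<in> {1..m} \<Longrightarrow> f j \<in> borel_measurable borel"
    and nonneg: "\<And>j y. j \<in> {1..m} \<Longrightarrow> 0 \<le> f j y"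
  shows "HLP m f x =
    (\<integral>\<^sup>+t. ennreal (real m * hom_dim TYPE('n) * t powr (- (real m * hom_dim TYPE('n)) - 1)) * indicator {heis_norm x<..} t *
       (\<Prod>j\<in>{1..m}. \<integral>\<^sup>+y\<in>{y. heis_norm y < t}. ennreal (f j y) \<partial>lborel) \<partial>lborel)"
proof -
  let ?Q = "hom_dim TYPE('n)" and ?P = "Pi\<^sub>M {1..m} (\<lambda>_. lborel :: 'n heis measure)"
  let ?K = "\<lambda>t. ennreal (real m * ?Q * t powr (- (real m * ?Q) - 1)) * indicator {heis_norm x<..} t"
  interpret P: sigma_finite_measure ?P by (rule heis_prod.sigma_finite) simp
  interpret PL: pair_sigma_finite ?P "lborel :: real measure" by standard
  have [measurable]: "(\<lambda>p. f j (fst p j)) \<in> borel_measurable (?P \<Otimes>\<^sub>M lborel)"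
      "(\<lambda>p. heis_norm (fst p j)) \<in> borel_measurable (?P \<Otimes>\<^sub>M lborel)" if "j \<in> {1..m}" for j
  proof -
    have *: "(\<lambda>p. fst p j) \<in> ?P \<Otimes>\<^sub>M lborel \<rightarrow>\<^sub>M borel"
      using that by (intro measurable_compose[OF measurable_fst]) (simp add: measurable_component_singleton[of j, simplified])
    show "(\<lambda>p. f j (fst p j)) \<in> borel_measurable (?P \<Otimes>\<^sub>M lborel)"
      by (rule measurable_compose[OF * meas[OF that]])
    show "(\<lambda>p. heis_norm (fst p j)) \<in> borel_measurable (?P \<Otimes>\<^sub>M lborel)"
      by (rule measurable_compose[OF * borel_measurable_heis_norm])
  qed
  have int: "ennreal ((\<Prod>j\<in>{1..m}. f j (y j)) / (Max (insert (heis_norm x ^ ?Q) ((\<lambda>j. heis_norm (y j) ^ ?Q) ` {1..m}))) ^ m)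
      = (\<integral>\<^sup>+t. ?K t * (\<Prod>j\<in>{1..m}. ennreal (f j (y j)) * indicator {z. heis_norm z < t} (y j)) \<partial>lborel)" for y
  proof -
    have "ennreal ((\<Prod>j\<in>{1..m}. f j (y j)) / (Max (insert (heis_norm x ^ ?Q) ((\<lambda>j. heis_norm (y j) ^ ?Q) ` {1..m}))) ^ m)
       = (\<Prod>j\<in>{1..m}. ennreal (f j (y j))) * ennreal (1 / (Max (insert (heis_norm x ^ ?Q) ((\<lambda>j. heis_norm (y j) ^ ?Q) ` {1..m}))) ^ m)"
      using nonneg by (subst prod_ennreal, blast, subst ennreal_mult'[symmetric]) (auto intro!: prod_nonneg nonneg)
    also have "\<dots> = (\<Prod>j\<in>{1..m}. ennreal (f j (y j))) * (\<integral>\<^sup>+t. ?K t * (\<Prod>j\<in>{1..m}. indicator {z. heis_norm z < t} (y j)) \<partial>lborel)"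
      using x m by (subst HLP_kernel) auto
    also have "\<dots> = (\<integral>\<^sup>+t. (\<Prod>j\<in>{1..m}. ennreal (f j (y j))) * (?K t * (\<Prod>j\<in>{1..m}. indicator {z. heis_norm z < t} (y j))) \<partial>lborel)"
    proof (intro nn_integral_cmult[symmetric])
      have "(\<lambda>t. indicator {z. heis_norm z < t} (y j)) = (\<lambda>t. indicator {heis_norm (y j)<..} t :: ennreal)" for j
        by (auto split: split_indicator)
      then show "(\<lambda>t. ?K t * (\<Prod>j\<in>{1..m}. indicator {z. heis_norm z < t} (y j))) \<in> borel_measurable lborel"
        by simp
    qed
    also have "\<dots> = (\<integral>\<^sup>+t. ?K t * (\<Prod>j\<in>{1..m}. ennreal (f j (y j)) * indicator {z. heis_norm z < t} (y j)) \<partial>lborel)"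
      by (simp add: prod.distrib ac_simps)
    finally show ?thesis .
  qed
  have "HLP m f x = (\<integral>\<^sup>+y. \<integral>\<^sup>+t. ?K t * (\<Prod>j\<in>{1..m}. ennreal (f j (y j)) * indicator {z. heis_norm z < t} (y j)) \<partial>lborel \<partial>?P)"
    unfolding HLP_def int ..
  also have "\<dots> = (\<integral>\<^sup>+t. \<integral>\<^sup>+y. ?K t * (\<Prod>j\<in>{1..m}. ennreal (f j (y j)) * indicator {z. heis_norm z < t} (y j)) \<partial>?P \<partial>lborel)"
  proof (intro PL.Fubini'[symmetric])
    have "(\<lambda>p. ?K (snd p) * (\<Prod>j\<in>{1..m}. ennreal (f j (fst p j)) * (if heis_norm (fst p j) < snd p then 1 else 0)))
        \<in> borel_measurable (?P \<Otimes>\<^sub>M lborel)"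
      by measurable
    moreover have "(\<lambda>p. ?K (snd p) * (\<Prod>j\<in>{1..m}. ennreal (f j (fst p j)) * (if heis_norm (fst p j) < snd p then 1 else 0)))
      = (\<lambda>(y, t). ?K t * (\<Prod>j\<in>{1..m}. ennreal (f j (y j)) * indicator {z. heis_norm z < t} (y j)))"
      by (auto simp: fun_eq_iff indicator_def of_bool_def)
    ultimately show "(\<lambda>(y, t). ?K t * (\<Prod>j\<in>{1..m}. ennreal (f j (y j)) * indicator {z. heis_norm z < t} (y j)))
      \<in> borel_measurable (?P \<Otimes>\<^sub>M lborel)" by simp
  qed
  also have "\<dots> = (\<integral>\<^sup>+t. ?K t * (\<Prod>j\<in>{1..m}. \<integral>\<^sup>+y\<in>{y. heis_norm y < t}. ennreal (f j y) \<partial>lborel) \<partial>lborel)"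
  proof (intro nn_integral_cong)
    fix t :: real
    have m1: "(\<lambda>y. ennreal (f j y) * indicator {z. heis_norm z < t} y) \<in> borel_measurable lborel" if "j \<in> {1..m}" for j
      using meas[OF that] by measurable
    have "(\<integral>\<^sup>+y. ?K t * (\<Prod>j\<in>{1..m}. ennreal (f j (y j)) * indicator {z. heis_norm z < t} (y j)) \<partial>?P)
       = ?K t * (\<integral>\<^sup>+y. (\<Prod>j\<in>{1..m}. ennreal (f j (y j)) * indicator {z. heis_norm z < t} (y j)) \<partial>?P)"
    proof (intro nn_integral_cmult borel_measurable_prod_ennreal)
      fix j assume j: "j \<in> {1..m}"
      show "(\<lambda>y. ennreal (f j (y j)) * indicator {z. heis_norm z < t} (y j)) \<in> borel_measurable ?P"
        using measurable_compose[OF measurable_component_singleton[OF j] m1[OF j]] .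
    qed
    also have "\<dots> = ?K t * (\<Prod>j\<in>{1..m}. \<integral>\<^sup>+y\<in>{y. heis_norm y < t}. ennreal (f j y) \<partial>lborel)"
      using heis_prod.product_nn_integral_prod[of "{1..m}" "\<lambda>j y. ennreal (f j y) * indicator {z. heis_norm z < t} y"] m1
      by simp
    finally show "(\<integral>\<^sup>+y. ?K t * (\<Prod>j\<in>{1..m}. ennreal (f j (y j)) * indicator {z. heis_norm z < t} (y j)) \<partial>?P)
       = ?K t * (\<Prod>j\<in>{1..m}. \<integral>\<^sup>+y\<in>{y. heis_norm y < t}. ennreal (f j y) \<partial>lborel)" .
  qed
  finally show ?thesis .
qed

text \<open>For |x| = 1 the kernel of the operator is the one in the definition of the constant, so
  this evaluation of the operator on powers is the evaluation of A.\<close>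

lemma HLP_heis_norm_powr:
  fixes b :: "nat \<Rightarrow> real" and x :: "'n::finite heis"
  assumes m: "1 \<le> m" and x: "heis_norm x = 1"
  shows "HLP m (\<lambda>j y. heis_norm y powr b j) x =
    (if (\<forall>j\<in>{1..m}. 0 < b j + hom_dim TYPE('n)) \<and> (\<Sum>j\<in>{1..m}. b j) < 0
     then ennreal (real m * hom_dim TYPE('n) * omega_Q TYPE('n) ^ m /
            (- (\<Sum>j\<in>{1..m}. b j) * (\<Prod>j\<in>{1..m}. b j + hom_dim TYPE('n))))
     else \<infinity>)"
proof -
  let ?Q = "real (hom_dim TYPE('n))"
  define c where "c = real m * ?Q"
  define B where "B = (\<Sum>j\<in>{1..m}. b j)"
  have c: "0 < c" using m hom_dim_ge_4[where ?'n = 'n] by (simp add: c_def)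
  have x0: "x \<noteq> 0" using x by auto
  have om: "0 < omega_Q TYPE('n)" by (rule omega_Q_pos)
  define I where "I t j = (if 0 < b j + ?Q then ennreal (omega_Q TYPE('n) * t powr (b j + ?Q) / (b j + ?Q)) else \<infinity>)" for t j
  have HLP: "HLP m (\<lambda>j y. heis_norm y powr b j) x
      = (\<integral>\<^sup>+t. ennreal (c * t powr (- c - 1)) * indicator {1<..} t * (\<Prod>j\<in>{1..m}. I t j) \<partial>lborel)"
    unfolding HLP_layer_cake[OF m x0, of "\<lambda>j y. heis_norm y powr b j", simplified] x c_def I_def
    by (intro nn_integral_cong) (auto simp: nn_integral_heis_powr_less split: split_indicator)
  show ?thesis
  proof (cases "\<forall>j\<in>{1..m}. 0 < b j + ?Q")
    case True
    define D where "D = c * (\<Prod>j\<in>{1..m}. omega_Q TYPE('n) / (b j + ?Q))"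
    have D: "0 < D" using True om c by (auto simp: D_def intro!: mult_pos_pos prod_pos)
    \<comment> \<open>The j-th ball integral is a multiple of \<open>t powr (b j + ?Q)\<close>. The
      product has exponent B + c, and c cancels against the kernel, so that only B decides about
      convergence at infinity.\<close>
    have I: "ennreal (c * t powr (- c - 1)) * (\<Prod>j\<in>{1..m}. I t j) = ennreal D * ennreal (t powr (B - 1))" if "1 < t" for t
    proof -
      have "(\<Prod>j\<in>{1..m}. I t j) = ennreal (\<Prod>j\<in>{1..m}. omega_Q TYPE('n) / (b j + ?Q) * t powr (b j + ?Q))"
      proof (subst prod_ennreal[symmetric])
        fix j assume "j \<in> {1..m}"
        then have "0 < b j + ?Q" using True by blast
        then show "0 \<le> omega_Q TYPE('n) / (b j + ?Q) * t powr (b j + ?Q)" using om by simp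
      qed (use True in \<open>auto simp: I_def intro!: prod.cong\<close>)
      also have "(\<Prod>j\<in>{1..m}. omega_Q TYPE('n) / (b j + ?Q) * t powr (b j + ?Q))
          = (\<Prod>j\<in>{1..m}. omega_Q TYPE('n) / (b j + ?Q)) * t powr (B + c)"
      proof -
        have "(\<Prod>j\<in>{1..m}. t powr (b j + ?Q)) = t powr (\<Sum>j\<in>{1..m}. b j + ?Q)"
          using that by (intro powr_sum[symmetric]) auto
        also have "(\<Sum>j\<in>{1..m}. b j + ?Q) = B + c" by (simp add: sum.distrib B_def c_def)
        finally show ?thesis by (simp only: prod.distrib)
      qed
      finally have *: "(\<Prod>j\<in>{1..m}. I t j) = ennreal ((\<Prod>j\<in>{1..m}. omega_Q TYPE('n) / (b j + ?Q)) * t powr (B + c))" .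
      have "c * t powr (- c - 1) * ((\<Prod>j\<in>{1..m}. omega_Q TYPE('n) / (b j + ?Q)) * t powr (B + c))
          = D * (t powr (- c - 1) * t powr (B + c))" by (simp add: D_def)
      also have "t powr (- c - 1) * t powr (B + c) = t powr (B - 1)"
        by (subst powr_add[symmetric]) (rule arg_cong, simp)
      finally have **: "c * t powr (- c - 1) * ((\<Prod>j\<in>{1..m}. omega_Q TYPE('n) / (b j + ?Q)) * t powr (B + c)) = D * t powr (B - 1)" .
      have "ennreal (c * t powr (- c - 1)) * (\<Prod>j\<in>{1..m}. I t j) = ennreal (D * t powr (B - 1))"
        unfolding * using c by (subst ennreal_mult'[symmetric]) (simp, simp only: **)
      then show ?thesis using D by (simp add: ennreal_mult')
    qed
    have "HLP m (\<lambda>j y. heis_norm y powr b j) x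
        = (\<integral>\<^sup>+t. ennreal D * (ennreal (t powr (B - 1)) * indicator {1..} t) \<partial>lborel)"
      unfolding HLP using AE_lborel_singleton[of 1]
    proof (intro nn_integral_cong_AE, eventually_elim)
      fix t :: real assume "t \<noteq> 1"
      then show "ennreal (c * t powr (- c - 1)) * indicator {1<..} t * (\<Prod>j\<in>{1..m}. I t j) = ennreal D * (ennreal (t powr (B - 1)) * indicator {1..} t)"
        using I[of t] by (auto split: split_indicator)
    qed
    also have "\<dots> = ennreal D * (\<integral>\<^sup>+t. ennreal (t powr (B - 1)) * indicator {1..} t \<partial>lborel)"
      by (intro nn_integral_cmult) auto
    also have "\<dots> = (if B < 0 then ennreal (D / - B) else \<infinity>)"
      using D nn_integral_powr_to_inf[of B 1] nn_integral_powr_to_inf_infinite[of B 1]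
      by (auto simp: ennreal_mult'[symmetric] ennreal_mult_top)
    also have "D / - B = real m * hom_dim TYPE('n) * omega_Q TYPE('n) ^ m / (- B * (\<Prod>j\<in>{1..m}. b j + hom_dim TYPE('n)))"
      by (simp add: D_def prod_dividef c_def)
    finally show ?thesis using True by (simp add: B_def)
  next
    case False
    have I: "(\<Prod>j\<in>{1..m}. I t j) = \<infinity>" if "1 < t" for t
    proof -
      have "I t j \<noteq> 0" if "j \<in> {1..m}" for j using om \<open>1 < t\<close> by (auto simp: I_def)
      moreover have "\<exists>j\<in>{1..m}. I t j = top" using False by (auto simp: I_def)
      ultimately show ?thesis by (auto simp: ennreal_prod_eq_top)
    qed
    \<comment> \<open>Some factor is infinite for every t and no factor vanishes, so the integrand
      is infinite on a set of positive measure; the interval from 1 to 2 is an arbitrary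
      choice.\<close>
    have "(\<integral>\<^sup>+t. top * indicator {1<..<2::real} t \<partial>lborel) \<le> HLP m (\<lambda>j y. heis_norm y powr b j) x"
      unfolding HLP
    proof (intro nn_integral_mono)
      fix t :: real
      show "top * indicator {1<..<2} t \<le> ennreal (c * t powr (- c - 1)) * indicator {1<..} t * (\<Prod>j\<in>{1..m}. I t j)"
        using c I[of t] by (auto simp: ennreal_mult_top split: split_indicator)
    qed
    then have "HLP m (\<lambda>j y. heis_norm y powr b j) x = top"
      by (simp add: nn_integral_cmult_indicator top_unique)
    then show ?thesis using False by auto
  qed
qed

lemma HLP_const_eq:
  fixes ls qs gs :: "nat \<Rightarrow> real" and q \<alpha> :: real
  assumes m: "1 \<le> m"
  defines "b j \<equiv> real (hom_dim TYPE('n::finite)) * ls j - gs j / q + \<alpha> * (ls j + 1 / qs j)"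
  shows "HLP_const TYPE('n) m q \<alpha> qs ls gs =
    (if (\<forall>j\<in>{1..m}. 0 < b j + hom_dim TYPE('n)) \<and> (\<Sum>j\<in>{1..m}. b j) < 0
     then ennreal (real m * hom_dim TYPE('n) * omega_Q TYPE('n) ^ m /
            (- (\<Sum>j\<in>{1..m}. b j) * (\<Prod>j\<in>{1..m}. b j + hom_dim TYPE('n))))
     else \<infinity>)"
proof -
  obtain x :: "'n heis" where x: "heis_norm x = 1" using heis_norm_exists[of 1] by auto
  have "HLP_const TYPE('n) m q \<alpha> qs ls gs = HLP m (\<lambda>j y. heis_norm y powr b j) x"
    by (simp add: HLP_const_def HLP_def x b_def)
  then show ?thesis using HLP_heis_norm_powr[OF m x] by simp
qed

section \<open>Power weights and test functions\<close>

lemma powr_le_max: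
  fixes r s t a :: real
  assumes "0 < s" "s \<le> r" "r \<le> t"
  shows "r powr a \<le> max (s powr a) (t powr a)"
  using assms powr_mono2[of a r t] powr_mono2'[of a s r] by (cases "0 \<le> a") auto

lemma powr_ge_min:
  fixes r s t a :: real
  assumes "0 < s" "s \<le> r" "r \<le> t"
  shows "min (s powr a) (t powr a) \<le> r powr a"
  using assms powr_mono2[of a s r] powr_mono2'[of a r t] by (cases "0 \<le> a") auto

lemma nn_integral_mono_set:
  assumes "A \<subseteq> B"
  shows "(\<integral>\<^sup>+x\<in>A. f x \<partial>M) \<le> (\<integral>\<^sup>+x\<in>B. f x \<partial>M)"
  using assms by (intro nn_integral_mono) (auto split: split_indicator)

lemma AE_heis_nonzero: "AE x in lborel. x \<noteq> (0 :: 'n::finite heis)"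
  by (rule AE_lborel_singleton)

text \<open>A power is bounded on [s, t] by its values at the ends. The radius
  \<open>\<bar>t\<bar> + s\<close> is positive and strictly exceeds all norms in S, whatever the
  sign of t.\<close>

lemma nn_integral_heis_powr_finite:
  fixes S :: "'n::finite heis set" and s t a :: real
  assumes S: "\<And>x. x \<in> S \<Longrightarrow> s \<le> heis_norm x \<and> heis_norm x \<le> t" and s: "0 < s"
  shows "power_mass S a
    \<le> ennreal (max (s powr a) (t powr a) * (\<bar>t\<bar> + s) ^ hom_dim TYPE('n) * unit_ball_vol TYPE('n))"
proof -
  have "power_mass S a
      \<le> (\<integral>\<^sup>+x. ennreal (max (s powr a) (t powr a)) * indicator (heis_ball 0 (\<bar>t\<bar> + s)) x \<partial>(lborel :: 'n heis measure))"
  proof (intro nn_integral_mono)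
    fix x :: "'n heis"
    show "ennreal (heis_norm x powr a) * indicator S x
        \<le> ennreal (max (s powr a) (t powr a)) * indicator (heis_ball 0 (\<bar>t\<bar> + s)) x"
      using S[of x] powr_le_max[of s "heis_norm x" t a] s
      by (cases "x \<in> S") (auto intro!: ennreal_leI simp: heis_ball_0)
  qed
  also have "\<dots> = ennreal (max (s powr a) (t powr a)) * ennreal ((\<bar>t\<bar> + s) ^ hom_dim TYPE('n) * unit_ball_vol TYPE('n))"
    using s by (subst nn_integral_cmult_indicator) (auto simp: emeasure_heis_ball add_nonneg_pos)
  also have "\<dots> = ennreal (max (s powr a) (t powr a) * (\<bar>t\<bar> + s) ^ hom_dim TYPE('n) * unit_ball_vol TYPE('n))"
    by (subst ennreal_mult'[symmetric]) (auto simp: le_max_iff_disj mult.assoc)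
  finally show ?thesis .
qed

lemma nn_integral_heis_ball_powr_pos:
  fixes a :: "'n::finite heis" and b :: real
  assumes R: "0 < R"
  shows "0 < power_mass (heis_ball a R) b"
proof (rule ccontr)
  assume "\<not> 0 < power_mass (heis_ball a R) b"
  then have "AE x in lborel. ennreal (heis_norm x powr b) * indicator (heis_ball a R) x = 0"
    by (subst nn_integral_0_iff_AE[symmetric]) auto
  then have "AE x in lborel. x \<notin> heis_ball a R"
    using AE_heis_nonzero
    by eventually_elim (auto split: split_indicator_asm simp: zero_prod_def)
  then have "emeasure lborel (heis_ball a R) = 0"
    using AE_iff_measurable[of "heis_ball a R" lborel "\<lambda>x. x \<notin> heis_ball a R"] by auto
  then show False using emeasure_heis_ball[OF R, of a] R unit_ball_vol_pos[where ?'n = 'n]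
    by (simp add: mult_le_0_iff ennreal_eq_0_iff not_le) (metis not_le zero_less_power)
qed

text \<open>Equality fails exactly when x is 0 or \<infinity> and s \<noteq> 0, where the product is
  0. This inequality lets balls of infinite mass pass through the norm estimates without a case
  distinction.\<close>

lemma epowr_minus_mult_le: "epowr x (- s) * epowr x s \<le> 1"
proof (cases x)
  case (real r)
  then show ?thesis
    by (cases "r = 0") (auto simp: epowr_zero epowr_ennreal_pos ennreal_mult'[symmetric] powr_add[symmetric])
qed (auto simp: epowr_top)

text \<open>The exponent on the left is the convex combination of \<alpha> and -Q with weights
  \<theta> and 1 - \<theta>. The second factor is dilation invariant and measures how many scales S
  meets.\<close>

lemma Hoelder_power_weights:
  fixes S :: "'n::finite heis set" and \<alpha> \<theta> :: real
  assumes [measurable]: "S \<in> sets borel" and \<theta>: "0 \<le> \<theta>" "\<theta> < 1"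
  shows "power_mass S (\<theta> * (hom_dim TYPE('n) + \<alpha>) - hom_dim TYPE('n))
    \<le> epowr (power_mass S \<alpha>) \<theta>
      * epowr (power_mass S (- real (hom_dim TYPE('n)))) (1 - \<theta>)"
proof (cases "\<theta> = 0")
  case False
  let ?Q = "real (hom_dim TYPE('n))"
  have "power_mass S (\<theta> * (?Q + \<alpha>) - ?Q)
     = (\<integral>\<^sup>+x. epowr (ennreal (heis_norm x powr \<alpha>) * indicator S x) \<theta> *
          epowr (ennreal (heis_norm x powr - ?Q) * indicator S x) (1 - \<theta>) \<partial>lborel)"
  proof (intro nn_integral_cong)
    fix x :: "'n heis"
    have "heis_norm x powr (\<theta> * (?Q + \<alpha>) - ?Q) = heis_norm x powr (\<alpha> * \<theta>) * heis_norm x powr (- ?Q * (1 - \<theta>))"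
      by (subst powr_add[symmetric]) (simp add: algebra_simps)
    then show "ennreal (heis_norm x powr (\<theta> * (?Q + \<alpha>) - ?Q)) * indicator S x
      = epowr (ennreal (heis_norm x powr \<alpha>) * indicator S x) \<theta> *
          epowr (ennreal (heis_norm x powr - ?Q) * indicator S x) (1 - \<theta>)"
      using \<theta> False by (auto simp: epowr_ennreal powr_powr ennreal_mult epowr_zero split: split_indicator)
  qed
  also have "\<dots> \<le> epowr (power_mass S \<alpha>) \<theta>
      * epowr (power_mass S (- ?Q)) (1 - \<theta>)"
    using \<theta> False by (intro Hoelder_nn_integral) auto
  finally show ?thesis .
qed simp

lemma AE_heis_norm_neq: "AE y in lborel. heis_norm (y :: 'n::finite heis) \<noteq> r"
proof (rule AE_I')
  have "indicator {y :: 'n heis. heis_norm y = r} = (\<lambda>y. indicator {r} (heis_norm y) :: ennreal)"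
    by (auto simp: fun_eq_iff split: split_indicator)
  moreover have "emeasure lborel {y :: 'n heis. heis_norm y = r} = (\<integral>\<^sup>+y. indicator {y :: 'n heis. heis_norm y = r} y \<partial>lborel)"
    by (intro nn_integral_indicator[symmetric]) simp
  ultimately have "emeasure lborel {y :: 'n heis. heis_norm y = r} = (\<integral>\<^sup>+y. indicator {r} (heis_norm y) \<partial>(lborel :: 'n heis measure))"
    by simp
  also have "\<dots> = 0"
  proof -
    have "AE x in lborel. ennreal (x powr (real (hom_dim TYPE('n)) - 1)) * indicator {r} x * indicator {0<..} x = 0"
      using AE_lborel_singleton[of r] by eventually_elim simp
    then have "(\<integral>\<^sup>+x. ennreal (x powr (real (hom_dim TYPE('n)) - 1)) * indicator {r} x * indicator {0<..} x \<partial>lborel) = 0"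
      by (subst nn_integral_0_iff_AE) auto
    then show ?thesis by (subst nn_integral_radial) auto
  qed
  finally show "{y :: 'n heis. heis_norm y = r} \<in> null_sets lborel" by (auto simp: null_sets_def)
qed auto

section \<open>Truncated powers as test functions\<close>

definition annulus_powr :: "real \<Rightarrow> real \<Rightarrow> real \<Rightarrow> 'n::finite heis \<Rightarrow> real" where
  "annulus_powr b s t y = heis_norm y powr b * indicator (heis_annulus s t) y"

lemma annulus_powr_nonneg [simp]: "0 \<le> annulus_powr b s t y"
  by (simp add: annulus_powr_def)

lemma borel_measurable_annulus_powr [measurable]: "annulus_powr b s t \<in> borel_measurable borel"
  unfolding annulus_powr_def by measurable

lemma annulus_powr_Lq_loc:
  assumes "0 < s"
  shows "(annulus_powr b s t :: 'n::finite heis \<Rightarrow> real) \<in> Lq_loc p"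
  unfolding Lq_loc_def
proof (safe intro!: borel_measurable_annulus_powr)
  fix K :: "'n heis set" assume K: "compact K"
  show "set_integrable lborel K (\<lambda>x. \<bar>annulus_powr b s t x\<bar> powr p)"
    unfolding set_integrable_def
  proof (rule integrableI_bounded_set_indicator)
    show "K \<in> sets lborel" using K by (simp add: borel_compact)
    show "emeasure lborel K < \<infinity>" using K compact_imp_bounded emeasure_bounded_finite by blast
    show "AE x in lborel. x \<in> K \<longrightarrow> norm (\<bar>annulus_powr b s t x\<bar> powr p) \<le> max (s powr (b * p)) (t powr (b * p))"
    proof (intro AE_I2 impI)
      fix x :: "'n heis"
      show "norm (\<bar>annulus_powr b s t x\<bar> powr p) \<le> max (s powr (b * p)) (t powr (b * p))"
        using powr_le_max[OF assms, of "heis_norm x" t "b * p"]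
        by (auto simp: annulus_powr_def powr_powr le_max_iff_disj split: split_indicator)
    qed
  qed measurable
qed

text \<open>The p-th power of the function times the weight has exponent
  \<open>\<theta> * (?Q + \<alpha>) - ?Q\<close>. By \<open>Hoelder_power_weights\<close> its
  integral over a ball of mass W is at most \<open>W^\<theta> * L^(1 - \<theta>)\<close>, where L is
  the mass of the annulus for the exponent -Q. The power of W is cancelled by the first factor of
  the norm, and \<open>(1 - \<theta>) / p = - l\<close>. Since l > -1 in the application, this grows
  more slowly than L.\<close>

lemma morrey_norm_annulus_powr:
  fixes \<alpha> g l p s t :: real
  assumes p: "1 < p" and l: "- 1 / p \<le> l" "l < 0" and st: "0 < s" "s < t"
  shows "morrey_norm p l (\<lambda>x :: 'n::finite heis. heis_norm x powr \<alpha>) (\<lambda>x. heis_norm x powr g)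
     (\<lambda>x. ennreal \<bar>annulus_powr (hom_dim TYPE('n) * l - g / p + \<alpha> * (l + 1 / p)) s t x\<bar>)
     \<le> ennreal ((omega_Q TYPE('n) * ln (t / s)) powr (- l))"
  unfolding morrey_norm_def
proof (intro SUP_least, clarify)
  fix a :: "'n heis" and R :: real
  let ?Q = "real (hom_dim TYPE('n))"
  let ?b = "?Q * l - g / p + \<alpha> * (l + 1 / p)"
  let ?B = "heis_ball a R" and ?T = "(heis_annulus s t :: 'n heis set)"
  define \<theta> where "\<theta> = p * l + 1"
  have \<theta>: "0 \<le> \<theta>" "\<theta> < 1" using p l by (auto simp: \<theta>_def field_simps mult_less_0_iff)
  define W where "W = power_mass ?B \<alpha>"
  define L where "L = omega_Q TYPE('n) * ln (t / s)"
  have L: "0 < L" using st omega_Q_pos[where ?'n = 'n] by (auto simp: L_def intro!: mult_pos_pos)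
  have e: "?b * p + g = \<theta> * (?Q + \<alpha>) - ?Q" using p by (simp add: \<theta>_def field_simps)
  have T [measurable]: "?T \<in> sets borel" by measurable
  have "(\<integral>\<^sup>+x\<in>?B. epowr (ennreal \<bar>annulus_powr ?b s t x\<bar>) p * ennreal (heis_norm x powr g) \<partial>lborel)
     = power_mass (?B \<inter> ?T) (\<theta> * (?Q + \<alpha>) - ?Q)"
  proof (intro nn_integral_cong)
    fix x :: "'n heis"
    have "heis_norm x powr (\<theta> * (?Q + \<alpha>) - ?Q) = heis_norm x powr (?b * p) * heis_norm x powr g"
      by (subst powr_add[symmetric]) (simp only: e)
    then show "epowr (ennreal \<bar>annulus_powr ?b s t x\<bar>) p * ennreal (heis_norm x powr g) * indicator ?B x
       = ennreal (heis_norm x powr (\<theta> * (?Q + \<alpha>) - ?Q)) * indicator (?B \<inter> ?T) x"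
      using p by (auto simp: annulus_powr_def epowr_ennreal epowr_zero powr_powr ennreal_mult split: split_indicator)
  qed
  also have "\<dots> \<le> epowr (power_mass (?B \<inter> ?T) \<alpha>) \<theta>
      * epowr (power_mass (?B \<inter> ?T) (- ?Q)) (1 - \<theta>)"
    using \<theta> by (intro Hoelder_power_weights) auto
  also have "\<dots> \<le> epowr W \<theta> * epowr (power_mass ?T (- ?Q)) (1 - \<theta>)"
    using \<theta> unfolding W_def by (intro mult_mono epowr_mono nn_integral_mono_set) auto
  also have "power_mass ?T (- ?Q) = ennreal L"
    using st by (simp add: nn_integral_heis_powr_annulus L_def)
  finally have le: "(\<integral>\<^sup>+x\<in>?B. epowr (ennreal \<bar>annulus_powr ?b s t x\<bar>) p * ennreal (heis_norm x powr g) \<partial>lborel)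
     \<le> epowr W \<theta> * epowr (ennreal L) (1 - \<theta>)" .
  have "epowr (\<integral>\<^sup>+x\<in>?B. epowr (ennreal \<bar>annulus_powr ?b s t x\<bar>) p * ennreal (heis_norm x powr g) \<partial>lborel) (1 / p)
     \<le> epowr (epowr W \<theta> * epowr (ennreal L) (1 - \<theta>)) (1 / p)"
    using p by (intro epowr_mono le) auto
  also have "\<dots> = epowr W (l + 1 / p) * epowr (ennreal L) (- l)"
    using p \<theta> by (simp add: epowr_mult epowr_epowr) (simp add: \<theta>_def field_simps)
  finally have "epowr W (- (l + 1 / p)) * epowr (\<integral>\<^sup>+x\<in>?B. epowr (ennreal \<bar>annulus_powr ?b s t x\<bar>) p * ennreal (heis_norm x powr g) \<partial>lborel) (1 / p)
     \<le> epowr W (- (l + 1 / p)) * (epowr W (l + 1 / p) * epowr (ennreal L) (- l))"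
    by (intro mult_left_mono) auto
  also have "\<dots> = (epowr W (- (l + 1 / p)) * epowr W (l + 1 / p)) * epowr (ennreal L) (- l)"
    by (simp only: mult.assoc)
  also have "\<dots> \<le> 1 * epowr (ennreal L) (- l)"
    by (intro mult_right_mono epowr_minus_mult_le) auto
  also have "\<dots> = ennreal (L powr (- l))" using L by (simp add: epowr_ennreal_pos)
  finally show "epowr (power_mass ?B \<alpha>) (- (l + 1 / p)) *
     epowr (\<integral>\<^sup>+x\<in>?B. epowr (ennreal \<bar>annulus_powr ?b s t x\<bar>) p * ennreal (heis_norm x powr g) \<partial>lborel) (1 / p)
     \<le> ennreal ((omega_Q TYPE('n) * ln (t / s)) powr (- l))"
    unfolding W_def L_def .
qed

text \<open>Only the shell from u to e * u is kept: its mass for the exponent -Q is exactly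
  \<open>omega_Q\<close>, as ln e = 1. On it \<open>|y|^(b + Q)\<close> is at least its smaller end
  value, which explains the minimum.\<close>

lemma nn_integral_annulus_powr_ge:
  fixes b s t u :: real
  assumes "0 < s" and "s \<le> u" and "exp 1 * u \<le> t" and r: "exp 1 * u \<le> r"
  shows "ennreal (omega_Q TYPE('n::finite) * min 1 (exp (b + hom_dim TYPE('n))) * u powr (b + hom_dim TYPE('n)))
     \<le> (\<integral>\<^sup>+y\<in>{y. heis_norm y < r}. ennreal (annulus_powr b s t y) \<partial>(lborel :: 'n heis measure))"
proof -
  let ?Q = "real (hom_dim TYPE('n))"
  let ?e = "exp 1 :: real"
  define c where "c = min (u powr (b + ?Q)) ((?e * u) powr (b + ?Q))"
  have u: "0 < u" using assms by simp
  have "(?e * u) powr (b + ?Q) = exp (b + ?Q) * u powr (b + ?Q)"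
    using u by (simp add: powr_mult exp_powr_real)
  then have c: "c = min 1 (exp (b + ?Q)) * u powr (b + ?Q)"
    using u by (simp add: c_def min_mult_distrib_right)
  have [measurable]: "(heis_annulus u (?e * u) :: 'n heis set) \<in> sets borel" by measurable
  have "ennreal (omega_Q TYPE('n) * min 1 (exp (b + ?Q)) * u powr (b + ?Q)) = ennreal c * ennreal (omega_Q TYPE('n) * ln (?e * u / u))"
    using u omega_Q_pos[where ?'n = 'n] by (subst ennreal_mult'[symmetric]) (auto simp: c)
  also have "\<dots> = (\<integral>\<^sup>+y. ennreal c * (ennreal (heis_norm y powr - ?Q) * indicator (heis_annulus u (?e * u)) y) \<partial>(lborel :: 'n heis measure))"
    using u by (subst nn_integral_heis_powr_annulus[symmetric]) (auto simp: nn_integral_cmult)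
  also have "\<dots> \<le> (\<integral>\<^sup>+y\<in>{y. heis_norm y < r}. ennreal (annulus_powr b s t y) \<partial>(lborel :: 'n heis measure))"
  proof (rule nn_integral_mono_AE)
    \<comment> \<open>The shell may touch the sphere of radius r, which the open region on the right
      omits; spheres are null sets.\<close>
    have "AE y in lborel. heis_norm (y :: 'n heis) \<noteq> ?e * u"
      by (rule AE_heis_norm_neq)
    then show "AE y in lborel. ennreal c * (ennreal (heis_norm y powr - ?Q) * indicator (heis_annulus u (?e * u)) y)
       \<le> ennreal (annulus_powr b s t y) * indicator {y :: 'n heis. heis_norm y < r} y"
    proof eventually_elim
      fix y :: "'n heis" assume y: "heis_norm y \<noteq> ?e * u"
      show "ennreal c * (ennreal (heis_norm y powr - ?Q) * indicator (heis_annulus u (?e * u)) y)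
       \<le> ennreal (annulus_powr b s t y) * indicator {y. heis_norm y < r} y"
      proof (cases "u \<le> heis_norm y \<and> heis_norm y \<le> ?e * u")
        case True
        have "c * heis_norm y powr - ?Q \<le> heis_norm y powr (b + ?Q) * heis_norm y powr - ?Q"
          unfolding c_def using True u by (intro mult_right_mono powr_ge_min) auto
        also have "\<dots> = heis_norm y powr b" by (subst powr_add[symmetric]) simp
        finally have "c * heis_norm y powr - ?Q \<le> annulus_powr b s t y"
          using True assms by (simp add: annulus_powr_def)
        moreover have "heis_norm y < r" using True y r by simp
        moreover have "0 \<le> c" using u by (simp add: c)
        ultimately show ?thesis using True by (simp add: ennreal_mult'[symmetric] ennreal_leI)
      qed simp
    qed
  qed
  finally show ?thesis .
qed

lemma powr_growth_contradiction:
  fixes a b s :: real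
  assumes "0 < a" "s < 1" "\<And>N. 2 \<le> N \<Longrightarrow> a * N \<le> b * N powr s"
  shows False
proof -
  \<comment> \<open>Chosen such that \<open>N powr (1 - s)\<close> is at least
    \<open>|b| / a + 1\<close>, that is, beyond the point where linear growth overtakes the
    power.\<close>
  define N where "N = max 2 ((\<bar>b\<bar> / a + 1) powr (1 / (1 - s)))"
  have N: "2 \<le> N" by (simp add: N_def)
  have "\<bar>b\<bar> / a + 1 = ((\<bar>b\<bar> / a + 1) powr (1 / (1 - s))) powr (1 - s)"
    using assms by (simp add: powr_powr add_nonneg_pos)
  also have "\<dots> \<le> N powr (1 - s)" using assms by (intro powr_mono2) (auto simp: N_def)
  finally have "a * (\<bar>b\<bar> / a + 1) \<le> a * N powr (1 - s)" using assms by simp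
  also have "\<dots> = a * N / N powr s" using N by (simp add: powr_diff)
  also have "\<dots> \<le> b * N powr s / N powr s" using assms(3)[OF N] by (intro divide_right_mono) auto
  also have "\<dots> = b" using N by simp
  finally have "\<bar>b\<bar> + a \<le> b" using assms by (simp add: distrib_left)
  then show False using assms by simp
qed

section \<open>Necessity\<close>

text \<open>The layers 3 \<le> t \<le> 4 suffice: they lie above |x| \<le> 1, and their balls
  contain the region |y| < 3, hence the shell 1 \<le> |y| \<le> e on which the test functions have
  mass.\<close>

lemma HLP_ge_const:
  fixes f :: "nat \<Rightarrow> 'n::finite heis \<Rightarrow> real"
  assumes m: "1 \<le> m" and x: "x \<noteq> 0" "heis_norm x \<le> 1"
    and f: "\<And>j. j \<in> {1..m} \<Longrightarrow> f j \<in> borel_measurable borel" "\<And>j y. j \<in> {1..m} \<Longrightarrow> 0 \<le> f j y"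
    and J: "\<And>j. j \<in> {1..m} \<Longrightarrow> 0 \<le> J j"
      "\<And>j. j \<in> {1..m} \<Longrightarrow> ennreal (J j) \<le> (\<integral>\<^sup>+y\<in>{y. heis_norm y < 3}. ennreal (f j y) \<partial>lborel)"
  shows "ennreal (real m * hom_dim TYPE('n) * 4 powr (- (real m * hom_dim TYPE('n)) - 1) * (\<Prod>j\<in>{1..m}. J j)) \<le> HLP m f x"
proof -
  define c where "c = real m * hom_dim TYPE('n)"
  have c: "0 \<le> c" by (simp add: c_def)
  have layer: "HLP m f x = (\<integral>\<^sup>+t. ennreal (c * t powr (- c - 1)) * indicator {heis_norm x<..} t *
       (\<Prod>j\<in>{1..m}. \<integral>\<^sup>+y\<in>{y. heis_norm y < t}. ennreal (f j y) \<partial>lborel) \<partial>lborel)"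
    unfolding c_def using f by (intro HLP_layer_cake m x(1)) auto
  have "ennreal (c * 4 powr (- c - 1) * (\<Prod>j\<in>{1..m}. J j))
      = (\<integral>\<^sup>+t. ennreal (c * 4 powr (- c - 1) * (\<Prod>j\<in>{1..m}. J j)) * indicator {3..4} t \<partial>(lborel :: real measure))"
    by (simp add: nn_integral_cmult_indicator)
  also have "\<dots> \<le> HLP m f x"
    unfolding layer
  proof (intro nn_integral_mono)
    fix t :: real
    show "ennreal (c * 4 powr (- c - 1) * (\<Prod>j\<in>{1..m}. J j)) * indicator {3..4} t
      \<le> ennreal (c * t powr (- c - 1)) * indicator {heis_norm x<..} t *
         (\<Prod>j\<in>{1..m}. \<integral>\<^sup>+y\<in>{y. heis_norm y < t}. ennreal (f j y) \<partial>lborel)"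
    proof (cases "t \<in> {3..4}")
      case True
      have "ennreal (c * 4 powr (- c - 1) * (\<Prod>j\<in>{1..m}. J j)) = ennreal (c * 4 powr (- c - 1)) * (\<Prod>j\<in>{1..m}. ennreal (J j))"
        using c J by (subst prod_ennreal) (auto simp: ennreal_mult')
      also have "\<dots> \<le> ennreal (c * t powr (- c - 1)) * (\<Prod>j\<in>{1..m}. \<integral>\<^sup>+y\<in>{y. heis_norm y < t}. ennreal (f j y) \<partial>lborel)"
      proof (intro mult_mono prod_mono_ennreal ennreal_leI mult_left_mono c)
        show "4 powr (- c - 1) \<le> t powr (- c - 1)" using True c by (intro powr_mono2') auto
        fix j assume j: "j \<in> {1..m}"
        have "(\<integral>\<^sup>+y\<in>{y. heis_norm y < 3}. ennreal (f j y) \<partial>lborel) \<le> (\<integral>\<^sup>+y\<in>{y. heis_norm y < t}. ennreal (f j y) \<partial>lborel)"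
          using True by (intro nn_integral_mono_set) auto
        with J(2)[OF j] show "ennreal (J j) \<le> (\<integral>\<^sup>+y\<in>{y. heis_norm y < t}. ennreal (f j y) \<partial>lborel)" by (rule order_trans)
      qed auto
      finally show ?thesis using True x by (simp split: split_indicator)
    qed simp
  qed
  finally show ?thesis unfolding c_def .
qed

text \<open>In the layer-cake formula the product of the ball integrals is at least a multiple of
  \<open>t powr (B + c)\<close>. Together with the kernel this leaves \<open>t powr (B - 1)\<close>,
  which is at least 1/t because B \<ge> 0 and t > 1; integration yields the logarithm. The lower
  limit e leaves room for one full shell between 1 and t.\<close>

lemma HLP_ge_log:
  fixes f :: "nat \<Rightarrow> 'n::finite heis \<Rightarrow> real" and b J :: "nat \<Rightarrow> real"
  assumes m: "1 \<le> m" and x: "x \<noteq> 0" "heis_norm x \<le> 1"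
    and f: "\<And>j. j \<in> {1..m} \<Longrightarrow> f j \<in> borel_measurable borel" "\<And>j y. j \<in> {1..m} \<Longrightarrow> 0 \<le> f j y"
    and J: "\<And>j. j \<in> {1..m} \<Longrightarrow> 0 \<le> J j"
      "\<And>j t. j \<in> {1..m} \<Longrightarrow> exp 1 \<le> t \<Longrightarrow> t \<le> T \<Longrightarrow>
          ennreal (J j * t powr (b j + hom_dim TYPE('n))) \<le> (\<integral>\<^sup>+y\<in>{y. heis_norm y < t}. ennreal (f j y) \<partial>lborel)"
    and B: "0 \<le> (\<Sum>j\<in>{1..m}. b j)" and T: "exp 1 \<le> T"
  shows "ennreal (real m * hom_dim TYPE('n) * (\<Prod>j\<in>{1..m}. J j) * ln (T / exp 1)) \<le> HLP m f x"
proof -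
  define c where "c = real m * hom_dim TYPE('n)"
  define D where "D = c * (\<Prod>j\<in>{1..m}. J j)"
  define B where "B = (\<Sum>j\<in>{1..m}. b j)"
  have c: "0 \<le> c" by (simp add: c_def)
  have layer: "HLP m f x = (\<integral>\<^sup>+t. ennreal (c * t powr (- c - 1)) * indicator {heis_norm x<..} t *
       (\<Prod>j\<in>{1..m}. \<integral>\<^sup>+y\<in>{y. heis_norm y < t}. ennreal (f j y) \<partial>lborel) \<partial>lborel)"
    unfolding c_def using f by (intro HLP_layer_cake m x(1)) auto
  have D: "0 \<le> D" using c J by (auto simp: D_def intro!: mult_nonneg_nonneg prod_nonneg)
  have "ennreal (D * ln (T / exp 1)) = ennreal D * (\<integral>\<^sup>+t. ennreal (1 / t) * indicator {exp 1..T} t \<partial>lborel)"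
    using T D by (subst nn_integral_inverse_Icc) (auto simp: ennreal_mult')
  also have "\<dots> = (\<integral>\<^sup>+t. ennreal D * (ennreal (1 / t) * indicator {exp 1..T} t) \<partial>lborel)"
    by (intro nn_integral_cmult[symmetric]) auto
  also have "\<dots> \<le> HLP m f x"
    unfolding layer
  proof (intro nn_integral_mono)
    fix t :: real
    show "ennreal D * (ennreal (1 / t) * indicator {exp 1..T} t)
      \<le> ennreal (c * t powr (- c - 1)) * indicator {heis_norm x<..} t *
         (\<Prod>j\<in>{1..m}. \<integral>\<^sup>+y\<in>{y. heis_norm y < t}. ennreal (f j y) \<partial>lborel)"
    proof (cases "t \<in> {exp 1..T}")
      case True
      have "1 < exp (1 :: real)" by simp
      then have t: "1 < t" "0 < t" using True by (simp_all only: atLeastAtMost_iff) linarith+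
      have "t powr (- 1) \<le> t powr (B - 1)" using t assms(8) by (intro powr_mono) (auto simp: B_def)
      then have "D * (1 / t) \<le> D * t powr (B - 1)"
        using t D by (intro mult_left_mono) (auto simp: powr_minus_divide)
      also have "t powr (B - 1) = t powr (- c - 1) * t powr (B + c)" by (subst powr_add[symmetric]) simp
      also have "B + c = (\<Sum>j\<in>{1..m}. b j + hom_dim TYPE('n))" by (simp add: B_def c_def sum.distrib)
      also have "t powr \<dots> = (\<Prod>j\<in>{1..m}. t powr (b j + hom_dim TYPE('n)))"
        using t by (intro powr_sum) auto
      also have "D * (t powr (- c - 1) * \<dots>) = c * t powr (- c - 1) * (\<Prod>j\<in>{1..m}. J j * t powr (b j + hom_dim TYPE('n)))"
        by (simp add: D_def prod.distrib)
      finally have "ennreal (D * (1 / t)) \<le> ennreal (c * t powr (- c - 1) * (\<Prod>j\<in>{1..m}. J j * t powr (b j + hom_dim TYPE('n))))"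
        by (rule ennreal_leI)
      also have "\<dots> = ennreal (c * t powr (- c - 1)) * (\<Prod>j\<in>{1..m}. ennreal (J j * t powr (b j + hom_dim TYPE('n))))"
        using c J by (subst prod_ennreal) (auto simp: ennreal_mult')
      also have "\<dots> \<le> ennreal (c * t powr (- c - 1)) * (\<Prod>j\<in>{1..m}. \<integral>\<^sup>+y\<in>{y. heis_norm y < t}. ennreal (f j y) \<partial>lborel)"
        using J(2) True by (intro mult_left_mono prod_mono_ennreal) auto
      finally have "ennreal D * ennreal (1 / t) \<le> ennreal (c * t powr (- c - 1)) *
          (\<Prod>j\<in>{1..m}. \<integral>\<^sup>+y\<in>{y. heis_norm y < t}. ennreal (f j y) \<partial>lborel)"
        using D by (subst ennreal_mult'[symmetric])
      then show ?thesis using True x t by (simp split: split_indicator)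
    qed simp
  qed
  finally show ?thesis unfolding c_def D_def .
qed

text \<open>A fixed ball of radius 1/4 about a point of norm 1/2 stays in 1/4 \<le> |x| \<le> 3/4,
  where both weights have positive finite mass for all exponents. A pointwise lower bound near the
  origin thus passes to the norm.\<close>

lemma morrey_norm_ge_test_ball:
  fixes q lam \<alpha> \<gamma> :: real
  assumes q: "1 \<le> q"
  obtains k where "0 < k"
    "\<And>c F. 0 \<le> c \<Longrightarrow> (\<And>x :: 'n::finite heis. x \<noteq> 0 \<Longrightarrow> heis_norm x \<le> 1 \<Longrightarrow> ennreal c \<le> F x) \<Longrightarrow>
      ennreal (k * c) \<le> morrey_norm q lam (\<lambda>x. heis_norm x powr \<alpha>) (\<lambda>x. heis_norm x powr \<gamma>) F"
proof -
  obtain x0 :: "'n heis" where x0: "heis_norm x0 = 1/2" using heis_norm_exists[of "1/2"] by auto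
  let ?B = "heis_ball x0 (1/4)"
  have B: "1/4 \<le> heis_norm x \<and> heis_norm x \<le> 3/4" if "x \<in> ?B" for x
    using heis_ball_norm[OF that] x0 by auto
  have "\<exists>w>0. (power_mass ?B b) = ennreal w" for b :: real
  proof -
    have "power_mass ?B b < \<infinity>"
      using nn_integral_heis_powr_finite[of ?B "1/4" "3/4" b] B by (auto intro: le_less_trans)
    moreover have "0 < power_mass ?B b"
      by (rule nn_integral_heis_ball_powr_pos) simp
    ultimately show ?thesis
      by (intro exI[of _ "enn2real (power_mass ?B b)"])
         (auto simp: enn2real_positive_iff less_top)
  qed
  then obtain w v where w: "0 < w" "power_mass ?B \<alpha> = ennreal w"
    and v: "0 < v" "power_mass ?B \<gamma> = ennreal v" by metis
  define k where "k = w powr (- (lam + 1/q)) * v powr (1/q)"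
  show ?thesis
  proof
    show "0 < k" using w v by (simp add: k_def)
    fix c F assume c: "0 \<le> c" and F: "\<And>x :: 'n heis. x \<noteq> 0 \<Longrightarrow> heis_norm x \<le> 1 \<Longrightarrow> ennreal c \<le> F x"
    have "epowr (ennreal c) q * ennreal v = (\<integral>\<^sup>+x. epowr (ennreal c) q * (ennreal (heis_norm x powr \<gamma>) * indicator ?B x) \<partial>lborel)"
      unfolding v(2)[symmetric] by (intro nn_integral_cmult[symmetric]) auto
    also have "\<dots> \<le> (\<integral>\<^sup>+x\<in>?B. epowr (F x) q * ennreal (heis_norm x powr \<gamma>) \<partial>lborel)"
    proof (intro nn_integral_mono)
      fix x :: "'n heis"
      show "epowr (ennreal c) q * (ennreal (heis_norm x powr \<gamma>) * indicator ?B x)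
         \<le> epowr (F x) q * ennreal (heis_norm x powr \<gamma>) * indicator ?B x"
      proof (cases "x \<in> ?B")
        case True
        then have "ennreal c \<le> F x" using B[OF True] by (intro F) auto
        then show ?thesis using q True by (auto intro!: mult_right_mono epowr_mono)
      qed simp
    qed
    finally have le: "epowr (ennreal c) q * ennreal v \<le> (\<integral>\<^sup>+x\<in>?B. epowr (F x) q * ennreal (heis_norm x powr \<gamma>) \<partial>lborel)" .
    have "epowr (epowr (ennreal c) q * ennreal v) (1/q) = ennreal c * ennreal (v powr (1/q))"
      using q v by (simp add: epowr_mult epowr_epowr epowr_ennreal_pos)
    then have "ennreal (k * c) = epowr (ennreal w) (- (lam + 1/q)) * epowr (epowr (ennreal c) q * ennreal v) (1/q)"
      using w c by (simp add: k_def epowr_ennreal_pos ennreal_mult' mult.assoc) (simp add: mult.commute)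
    also have "\<dots> \<le> epowr (ennreal w) (- (lam + 1/q)) * epowr (\<integral>\<^sup>+x\<in>?B. epowr (F x) q * ennreal (heis_norm x powr \<gamma>) \<partial>lborel) (1/q)"
      using q by (intro mult_left_mono epowr_mono le) auto
    also have "\<dots> \<le> morrey_norm q lam (\<lambda>x. heis_norm x powr \<alpha>) (\<lambda>x. heis_norm x powr \<gamma>) F"
      unfolding morrey_norm_def w(2)[symmetric] by (rule SUP_upper2[of "(x0, 1/4)"]) auto
    finally show "ennreal (k * c) \<le> morrey_norm q lam (\<lambda>x. heis_norm x powr \<alpha>) (\<lambda>x. heis_norm x powr \<gamma>) F" .
  qed
qed

lemma HLP_bounded_necessary:
  fixes m :: nat and q lam \<alpha> \<gamma> :: real and qs ls gs b :: "nat \<Rightarrow> real"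
  assumes m: "m \<ge> 1" and q: "1 \<le> q" and lam: "- 1 / q \<le> lam" "lam < 0"
    and qs: "\<And>j. j \<in> {1..m} \<Longrightarrow> 1 < qs j"
    and ls: "\<And>j. j \<in> {1..m} \<Longrightarrow> - 1 / qs j \<le> ls j" "\<And>j. j \<in> {1..m} \<Longrightarrow> ls j < 0"
    and lam_sum: "lam = (\<Sum>j\<in>{1..m}. ls j)"
    and b: "\<And>j. b j = hom_dim TYPE('n::finite) * ls j - gs j / q + \<alpha> * (ls j + 1 / qs j)"
    and B: "(\<Sum>j\<in>{1..m}. b j) = hom_dim TYPE('n) * lam - \<gamma> / q + \<alpha> * (lam + 1 / q)"
    and bdd: "HLP_bounded m qs ls (\<lambda>j (x :: 'n heis). heis_norm x powr \<alpha>)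
            (\<lambda>j x. heis_norm x powr (qs j * gs j / q)) q lam
            (\<lambda>x. heis_norm x powr \<alpha>) (\<lambda>x. heis_norm x powr \<gamma>)"
  shows "(\<forall>j\<in>{1..m}. 0 < b j + hom_dim TYPE('n)) \<and> (\<Sum>j\<in>{1..m}. b j) < 0"
proof -
  let ?Q = "real (hom_dim TYPE('n))"
  let ?om = "omega_Q TYPE('n)"
  let ?w1 = "\<lambda>x :: 'n heis. heis_norm x powr \<alpha>" and ?w2 = "\<lambda>x :: 'n heis. heis_norm x powr \<gamma>"
  have om: "0 < ?om" by (rule omega_Q_pos)
  have Q: "0 < ?Q" using hom_dim_ge_4[where ?'n = 'n] by simp
  have mQ: "0 < real m * ?Q" using m Q by simp
  obtain C where C: "0 \<le> C" and bd: "\<And>f. (\<forall>j\<in>{1..m}. f j \<in> morrey_space (qs j) (ls j) ?w1 (\<lambda>x. heis_norm x powr (qs j * gs j / q)) \<and> (\<forall>x. 0 \<le> f j x)) \<Longrightarrow>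
      morrey_norm q lam ?w1 ?w2 (HLP m f) \<le> ennreal C *
        (\<Prod>j\<in>{1..m}. morrey_norm (qs j) (ls j) ?w1 (\<lambda>x. heis_norm x powr (qs j * gs j / q)) (\<lambda>x. ennreal \<bar>f j x\<bar>))"
    using bdd unfolding HLP_bounded_def by blast
  have test: "morrey_norm q lam ?w1 ?w2 (HLP m (\<lambda>j. annulus_powr (b j) (s j) (t j)))
      \<le> ennreal (C * (\<Prod>j\<in>{1..m}. (?om * ln (t j / s j)) powr (- ls j)))"
    if st: "\<And>j. 0 < s j" "\<And>j. s j < t j" for s t :: "nat \<Rightarrow> real"
  proof -
    let ?N = "\<lambda>j. morrey_norm (qs j) (ls j) ?w1 (\<lambda>x. heis_norm x powr (qs j * gs j / q)) (\<lambda>x. ennreal \<bar>annulus_powr (b j) (s j) (t j) x\<bar>)"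
    have N: "?N j \<le> ennreal ((?om * ln (t j / s j)) powr (- ls j))" if j: "j \<in> {1..m}" for j
    proof -
      have "qs j * gs j / q / qs j = gs j / q" using qs[OF j] by simp
      then have "b j = ?Q * ls j - (qs j * gs j / q) / qs j + \<alpha> * (ls j + 1 / qs j)" by (simp only: b)
      then show ?thesis
        using morrey_norm_annulus_powr[OF qs[OF j] ls(1)[OF j] ls(2)[OF j] st(1)[of j] st(2)[of j], of \<alpha> "qs j * gs j / q", where ?'n = 'n]
        by (simp only:)
    qed
    have "morrey_norm q lam ?w1 ?w2 (HLP m (\<lambda>j. annulus_powr (b j) (s j) (t j))) \<le> ennreal C * (\<Prod>j\<in>{1..m}. ?N j)"
    proof (intro bd ballI conjI allI)
      fix j assume "j \<in> {1..m}"
      then have "?N j < \<infinity>" using N[of j] by (auto intro: le_less_trans)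
      then show "annulus_powr (b j) (s j) (t j) \<in> morrey_space (qs j) (ls j) ?w1 (\<lambda>x. heis_norm x powr (qs j * gs j / q))"
        using annulus_powr_Lq_loc[OF st(1)] by (simp add: morrey_space_def)
    qed simp
    also have "\<dots> \<le> ennreal C * (\<Prod>j\<in>{1..m}. ennreal ((?om * ln (t j / s j)) powr (- ls j)))"
      by (intro mult_left_mono prod_mono_ennreal N) auto
    also have "\<dots> = ennreal (C * (\<Prod>j\<in>{1..m}. (?om * ln (t j / s j)) powr (- ls j)))"
      using C by (subst prod_ennreal) (auto simp: ennreal_mult')
    finally show ?thesis .
  qed
  obtain k where k: "0 < k" and kF: "\<And>c F. 0 \<le> c \<Longrightarrow> (\<And>x :: 'n heis. x \<noteq> 0 \<Longrightarrow> heis_norm x \<le> 1 \<Longrightarrow> ennreal c \<le> F x) \<Longrightarrow>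
      ennreal (k * c) \<le> morrey_norm q lam ?w1 ?w2 F"
    using morrey_norm_ge_test_ball[OF q] by metis
  define c where "c j = ?om * min 1 (exp (b j + ?Q))" for j
  have c: "0 < c j" for j using om by (auto simp: c_def)
  have e3: "exp 1 \<le> (3 :: real)" by (rule exp_le)
  have unit: "ennreal (c j) \<le> (\<integral>\<^sup>+y\<in>{y. heis_norm y < 3}. ennreal (annulus_powr (b j) 1 (exp 1) y) \<partial>(lborel :: 'n heis measure))" for j
    using nn_integral_annulus_powr_ge[of 1 1 "exp 1" 3 "b j", where ?'n = 'n] e3 by (simp add: c_def)
  have pos: "0 < b i + ?Q" if i: "i \<in> {1..m}" for i
  proof (rule ccontr)
    assume "\<not> 0 < b i + ?Q"
    then have bi: "b i \<le> - ?Q" by simp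
    define P where "P = (\<Prod>j\<in>{1..m} - {i}. c j)"
    define R where "R = (\<Prod>j\<in>{1..m} - {i}. ?om powr (- ls j))"
    define d where "d = real m * ?Q * 4 powr (- (real m * ?Q) - 1)"
    have P: "0 < P" using c by (auto simp: P_def intro!: prod_pos)
    have d: "0 < d" using mQ by (simp add: d_def)
    show False
    proof (rule powr_growth_contradiction)
      show "0 < k * d * ?om * P" using k d om P by simp
      \<comment> \<open>The source norm of the stretched factor grows like
        \<open>N powr (- ls i)\<close>, and this exponent stays below 1 because \<open>qs i\<close>
        exceeds 1.\<close>
      have "- ls i \<le> 1 / qs i" using ls(1)[OF i] by simp
      also have "\<dots> < 1" using qs[OF i] by simp
      finally show "- ls i < 1" .
      fix N :: real assume N: "2 \<le> N"
      \<comment> \<open>Only the i-th factor is stretched, towards the origin. There b i + Q \<le> 0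
        makes \<open>|y|^(b i)\<close> at least \<open>|y|^(-Q)\<close>, so that its integral is at
        least \<open>omega_Q * N\<close>. The other factors stay on the shell from 1 to e and
        contribute constants.\<close>
      define s t where "s j = (if j = i then exp (- N) else 1)" and "t j = (if j = i then 1 else exp (1 :: real))" for j
      have st: "0 < s j" "s j < t j" for j using N by (auto simp: s_def t_def)
      define J where "J j = (if j = i then ?om * N else c j)" for j
      have J: "0 \<le> J j" for j using om N c[of j] by (auto simp: J_def)
      have Jle: "ennreal (J j) \<le> (\<integral>\<^sup>+y\<in>{y. heis_norm y < 3}. ennreal (annulus_powr (b j) (s j) (t j) y) \<partial>(lborel :: 'n heis measure))" for j
      proof (cases "j = i")
        case True
        have "ennreal (?om * N) = (\<integral>\<^sup>+y\<in>(heis_annulus (exp (- N)) 1). ennreal (heis_norm y powr - ?Q) \<partial>(lborel :: 'n heis measure))"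
          using N by (subst nn_integral_heis_powr_annulus) (auto simp: ln_div)
        also have "\<dots> \<le> (\<integral>\<^sup>+y\<in>{y. heis_norm y < 3}. ennreal (annulus_powr (b i) (exp (- N)) 1 y) \<partial>(lborel :: 'n heis measure))"
        proof (intro nn_integral_mono)
          fix y :: "'n heis"
          show "ennreal (heis_norm y powr - ?Q) * indicator (heis_annulus (exp (- N)) 1) y
            \<le> ennreal (annulus_powr (b i) (exp (- N)) 1 y) * indicator {y. heis_norm y < 3} y"
          proof (cases "exp (- N) \<le> heis_norm y \<and> heis_norm y \<le> 1")
            case True
            then have "0 < heis_norm y" using exp_gt_zero[of "- N"] by linarith
            then have "heis_norm y powr - ?Q \<le> heis_norm y powr b i"
              using True bi by (intro powr_mono') auto
            then show ?thesis using True by (simp add: annulus_powr_def ennreal_leI)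
          qed simp
        qed
        finally show ?thesis using True by (simp add: J_def s_def t_def)
      next
        case False
        then show ?thesis using unit[of j] by (simp add: J_def s_def t_def)
      qed
      have "ennreal (k * (d * (\<Prod>j\<in>{1..m}. J j))) \<le> morrey_norm q lam ?w1 ?w2 (HLP m (\<lambda>j. annulus_powr (b j) (s j) (t j)))"
      proof (rule kF)
        show "0 \<le> d * (\<Prod>j\<in>{1..m}. J j)" using d J by (intro mult_nonneg_nonneg prod_nonneg) auto
        fix x :: "'n heis" assume "x \<noteq> 0" "heis_norm x \<le> 1"
        then show "ennreal (d * (\<Prod>j\<in>{1..m}. J j)) \<le> HLP m (\<lambda>j. annulus_powr (b j) (s j) (t j)) x"
          unfolding d_def using J Jle by (intro HLP_ge_const[OF m]) auto
      qed
      also note test[OF st]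
      finally have "k * (d * (\<Prod>j\<in>{1..m}. J j)) \<le> C * (\<Prod>j\<in>{1..m}. (?om * ln (t j / s j)) powr (- ls j))"
        using C by (subst (asm) ennreal_le_iff) (auto intro!: mult_nonneg_nonneg prod_nonneg)
      moreover have "(\<Prod>j\<in>{1..m}. J j) = ?om * N * P"
        using i by (subst prod.remove[of _ i]) (auto simp: J_def P_def)
      moreover have "(\<Prod>j\<in>{1..m}. (?om * ln (t j / s j)) powr (- ls j)) = (?om * N) powr (- ls i) * R"
        using i by (subst prod.remove[of _ i]) (auto simp: s_def t_def R_def ln_div)
      ultimately show "k * d * ?om * P * N \<le> C * ?om powr (- ls i) * R * N powr (- ls i)"
        using om N by (simp add: powr_mult mult_ac)
    qed
  qed
  moreover have "(\<Sum>j\<in>{1..m}. b j) < 0"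
  proof (rule ccontr)
    assume "\<not> (\<Sum>j\<in>{1..m}. b j) < 0"
    then have B0: "0 \<le> (\<Sum>j\<in>{1..m}. b j)" by simp
    show False
    \<comment> \<open>Stretching all factors to infinity gives growth N against
      \<open>N powr (- lam)\<close>. This is a contradiction only for - lam < 1, which can fail when
      lam = -1/q and q = 1. For lam = -1/q the condition B \<ge> 0 says \<gamma> \<le> -Q, and a
      single bounded test tuple already has an image of infinite norm.\<close>
    proof (cases "lam = - 1 / q")
      case True
      have "\<gamma> / q \<le> - ?Q / q" using B0 unfolding B using True by simp
      then have \<gamma>: "\<gamma> \<le> - ?Q" using q by (subst (asm) divide_le_cancel) auto
      define d where "d = real m * ?Q * 4 powr (- (real m * ?Q) - 1) * (\<Prod>j\<in>{1..m}. c j)"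
      have d: "0 < d" using mQ c by (auto simp: d_def intro!: mult_pos_pos prod_pos)
      let ?F = "HLP m (\<lambda>j. annulus_powr (b j) 1 (exp 1)) :: 'n heis \<Rightarrow> ennreal"
      have F: "ennreal d \<le> ?F x" if "x \<noteq> 0" "heis_norm x \<le> 1" for x
        unfolding d_def using c unit that by (intro HLP_ge_const[OF m]) (auto simp: less_imp_le)
      have "ennreal (d powr q) * \<infinity> = ennreal (d powr q) * (\<integral>\<^sup>+x\<in>{x. heis_norm x < 1}. ennreal (heis_norm x powr \<gamma>) \<partial>(lborel :: 'n heis measure))"
        using \<gamma> by (subst nn_integral_heis_powr_less) auto
      also have "\<dots> = (\<integral>\<^sup>+x. ennreal (d powr q) * (ennreal (heis_norm x powr \<gamma>) * indicator {x. heis_norm x < 1} x) \<partial>(lborel :: 'n heis measure))"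
        by (intro nn_integral_cmult[symmetric]) measurable
      also have "\<dots> \<le> (\<integral>\<^sup>+x\<in>heis_ball 0 1. epowr (?F x) q * ennreal (heis_norm x powr \<gamma>) \<partial>lborel)"
      proof (intro nn_integral_mono)
        fix x :: "'n heis"
        show "ennreal (d powr q) * (ennreal (heis_norm x powr \<gamma>) * indicator {x. heis_norm x < 1} x)
           \<le> epowr (?F x) q * ennreal (heis_norm x powr \<gamma>) * indicator (heis_ball 0 1) x"
        proof (cases "x \<noteq> 0 \<and> heis_norm x < 1")
          case True
          then have "epowr (ennreal d) q \<le> epowr (?F x) q" using q F[of x] by (intro epowr_mono) auto
          then show ?thesis using True d by (auto simp: heis_ball_0 epowr_ennreal_pos intro!: mult_right_mono)
        qed (auto simp: heis_ball_0)
      qed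
      finally have "(\<integral>\<^sup>+x\<in>heis_ball 0 1. epowr (?F x) q * ennreal (heis_norm x powr \<gamma>) \<partial>lborel) = top"
        using d by (simp add: ennreal_mult_top top_unique)
      then have "top = epowr (\<integral>\<^sup>+x\<in>heis_ball 0 1. ennreal (?w1 x) \<partial>lborel) (- (lam + 1/q)) *
          epowr (\<integral>\<^sup>+x\<in>heis_ball 0 1. epowr (?F x) q * ennreal (?w2 x) \<partial>lborel) (1/q)"
        using True q by (simp add: epowr_top)
      also have "\<dots> \<le> morrey_norm q lam ?w1 ?w2 ?F"
        unfolding morrey_norm_def by (rule SUP_upper2[of "(0, 1)"]) auto
      also have "\<dots> \<le> ennreal (C * (\<Prod>j\<in>{1..m}. (?om * ln (exp 1 / 1)) powr (- ls j)))"
        using test[of "\<lambda>_. 1" "\<lambda>_. exp 1"] by simp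
      finally show False by (simp add: top_unique)
    next
      case False
      \<comment> \<open>A shell with outer radius t has inner radius t/e; the exponential accounts
        for the change from \<open>(t/e)\<close> to t in the power.\<close>
      define c' where "c' j = c j * exp (- (b j + ?Q))" for j
      have c': "0 < c' j" for j using c by (simp add: c'_def)
      define d where "d = real m * ?Q * (\<Prod>j\<in>{1..m}. c' j)"
      have d: "0 < d" using mQ c' by (auto simp: d_def intro!: mult_pos_pos prod_pos)
      show False
      proof (rule powr_growth_contradiction)
        show "0 < k * d / 2" using k d by simp
        have "- lam < 1 / q" using lam False by (simp add: less_le minus_le_iff)
        also have "\<dots> \<le> 1" using q by simp
        finally show "- lam < 1" .
        fix N :: real assume N: "2 \<le> N"
        let ?f = "\<lambda>j. annulus_powr (b j) 1 (exp N) :: 'n heis \<Rightarrow> real"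
        have "ennreal (k * (d * (N - 1))) \<le> morrey_norm q lam ?w1 ?w2 (HLP m ?f)"
        proof (rule kF)
          show "0 \<le> d * (N - 1)" using d N by simp
          fix x :: "'n heis" assume x: "x \<noteq> 0" "heis_norm x \<le> 1"
          have "ennreal (real m * ?Q * (\<Prod>j\<in>{1..m}. c' j) * ln (exp N / exp 1)) \<le> HLP m ?f x"
          proof (rule HLP_ge_log[OF m x _ _ _ _ B0])
            fix j t assume t: "exp 1 \<le> t" "t \<le> exp N"
            have "0 < t" using t(1) exp_gt_zero[of "1 :: real"] by linarith
            then have "(t / exp 1) powr (b j + ?Q) = exp (- (b j + ?Q)) * t powr (b j + ?Q)"
              by (simp add: powr_def ln_div mult_exp_exp algebra_simps)
            then have "c j * (t / exp 1) powr (b j + ?Q) = c' j * t powr (b j + ?Q)"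
              by (simp add: c'_def)
            then show "ennreal (c' j * t powr (b j + ?Q)) \<le> (\<integral>\<^sup>+y\<in>{y. heis_norm y < t}. ennreal (?f j y) \<partial>lborel)"
              using nn_integral_annulus_powr_ge[of 1 "t / exp 1" "exp N" t "b j", where ?'n = 'n] t by (simp add: c_def)
          qed (use c' N in \<open>auto simp: less_imp_le\<close>)
          then show "ennreal (d * (N - 1)) \<le> HLP m ?f x" by (simp add: d_def exp_diff[symmetric])
        qed
        also have "\<dots> \<le> ennreal (C * (\<Prod>j\<in>{1..m}. (?om * ln (exp N / 1)) powr (- ls j)))"
          using N by (intro test) auto
        also have "(\<Prod>j\<in>{1..m}. (?om * ln (exp N / 1)) powr (- ls j)) = (?om * N) powr (- lam)"
          using om N by (simp add: powr_sum[symmetric] lam_sum sum_negf)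
        finally have "k * (d * (N - 1)) \<le> C * (?om * N) powr (- lam)"
          using C by (subst (asm) ennreal_le_iff) auto
        \<comment> \<open>The logarithm starts at e and gives N - 1 only; N \<ge> 2 turns this into
          N/2.\<close>
        moreover have "k * d / 2 * N \<le> k * (d * (N - 1))" using k d N by (simp add: field_simps)
        ultimately show "k * d / 2 * N \<le> C * ?om powr (- lam) * N powr (- lam)"
          using om N by (simp add: powr_mult)
      qed
    qed
  qed
  ultimately show ?thesis by blast
qed

section \<open>The linear majorants\<close>

text \<open>For s = Q this is the kernel of the linear operator, \<open>1 / max a b powr Q\<close>.
  The power of a in front restores homogeneity -Q for every s, so a different decay in b can be
  assigned to each of the m linear operators.\<close>

definition polya_kernel :: "real \<Rightarrow> real \<Rightarrow> real \<Rightarrow> real \<Rightarrow> real" where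
  "polya_kernel Q s a b = a powr (s - Q) / max a b powr s"

lemma polya_kernel_nonneg [simp]: "0 \<le> polya_kernel Q s a b"
  by (simp add: polya_kernel_def)

lemma borel_measurable_polya_kernel [measurable]:
  "f \<in> borel_measurable M \<Longrightarrow> g \<in> borel_measurable M \<Longrightarrow> (\<lambda>x. polya_kernel Q s (f x) (g x)) \<in> borel_measurable M"
proof -
  assume [measurable]: "f \<in> borel_measurable M" "g \<in> borel_measurable M"
  show ?thesis unfolding polya_kernel_def by measurable
qed

lemma polya_kernel_pos: "0 < a \<Longrightarrow> 0 < polya_kernel Q s a b"
  using less_max_iff_disj[of 0 a b] by (simp add: polya_kernel_def)

lemma polya_kernel_scale:
  assumes "0 < c" "0 \<le> a" "0 \<le> b"
  shows "polya_kernel Q s (c * a) (c * b) = c powr (- Q) * polya_kernel Q s a b"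
proof -
  have "max (c * a) (c * b) = c * max a b" using assms by (simp add: max_mult_distrib_left)
  moreover have "c powr (s - Q) = c powr (- Q) * c powr s" by (subst powr_add[symmetric]) simp
  ultimately show ?thesis using assms by (simp add: polya_kernel_def powr_mult)
qed

text \<open>The denominator grows with a, so passing from a to the smaller a' can only help there;
  the power in the numerator changes at most by the factor belonging to one shell of ratio
  e.\<close>

lemma polya_kernel_quasi_mono:
  assumes "0 < a'" "a' \<le> a" "a \<le> exp 1 * a'" "0 \<le> s"
  shows "min 1 (exp (Q - s)) * polya_kernel Q s a b \<le> polya_kernel Q s a' b"
proof -
  have "min (a' powr (Q - s)) ((exp 1 * a') powr (Q - s)) \<le> a powr (Q - s)"
    using assms by (intro powr_ge_min) auto
  then have "a' powr (Q - s) * min 1 (exp (Q - s)) \<le> a powr (Q - s)"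
    using assms by (simp add: powr_mult exp_powr_real min_mult_distrib_left mult.commute)
  then have "a powr (s - Q) * (a' powr (Q - s) * min 1 (exp (Q - s))) \<le> a powr (s - Q) * a powr (Q - s)"
    by (intro mult_left_mono) auto
  also have "\<dots> = 1" using assms by (subst powr_add[symmetric]) auto
  finally have le: "a powr (s - Q) * (a' powr (Q - s) * min 1 (exp (Q - s))) \<le> 1" .
  have one: "a' powr (s - Q) * a' powr (Q - s) = 1" using assms by (subst powr_add[symmetric]) auto
  have "min 1 (exp (Q - s)) * a powr (s - Q) = min 1 (exp (Q - s)) * a powr (s - Q) * (a' powr (s - Q) * a' powr (Q - s))"
    unfolding one by simp
  also have "\<dots> = a' powr (s - Q) * (a powr (s - Q) * (a' powr (Q - s) * min 1 (exp (Q - s))))"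
    by (simp only: mult_ac)
  also have "\<dots> \<le> a' powr (s - Q) * 1" using le by (intro mult_left_mono) auto
  finally have *: "min 1 (exp (Q - s)) * a powr (s - Q) \<le> a' powr (s - Q)" by simp
  have "min 1 (exp (Q - s)) * a powr (s - Q) / max a b powr s \<le> a' powr (s - Q) / max a' b powr s"
    using assms by (intro frac_le * powr_mono2) (auto simp: less_max_iff_disj)
  then show ?thesis by (simp add: polya_kernel_def)
qed

definition polya_op :: "real \<Rightarrow> ('n::finite heis \<Rightarrow> real) \<Rightarrow> 'n heis \<Rightarrow> ennreal" where
  "polya_op s f x = (\<integral>\<^sup>+y. ennreal (f y * polya_kernel (hom_dim TYPE('n)) s (heis_norm x) (heis_norm y)) \<partial>lborel)"

abbreviation polya_mass :: "real \<Rightarrow> ('n::finite heis \<Rightarrow> real) \<Rightarrow> real \<Rightarrow> real \<Rightarrow> 'n heis set \<Rightarrow> ennreal" where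
  "polya_mass s f p g S \<equiv> \<integral>\<^sup>+x\<in>S. epowr (polya_op s f x) p * ennreal (heis_norm x powr g) \<partial>lborel"

lemma pair_measurable_heis_norm [measurable]:
  "(\<lambda>z. heis_norm (fst z)) \<in> borel_measurable ((lborel :: 'n::finite heis measure) \<Otimes>\<^sub>M M)"
  "(\<lambda>z. heis_norm (snd z)) \<in> borel_measurable (M \<Otimes>\<^sub>M (lborel :: 'n::finite heis measure))"
   by (rule measurable_compose[OF measurable_fst], simp)
      (rule measurable_compose[OF measurable_snd], simp)

lemma borel_measurable_polya_op [measurable]:
  assumes "f \<in> borel_measurable borel"
  shows "polya_op s (f :: 'n::finite heis \<Rightarrow> real) \<in> borel_measurable borel"
proof -
  have [measurable]: "(\<lambda>z. f (snd z)) \<in> borel_measurable ((lborel :: 'n heis measure) \<Otimes>\<^sub>M (lborel :: 'n heis measure))"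
    by (rule measurable_compose[OF measurable_snd]) (simp add: assms)
  have "(\<lambda>z. ennreal (f (snd z) * polya_kernel (hom_dim TYPE('n)) s (heis_norm (fst z)) (heis_norm (snd z))))
      \<in> borel_measurable ((lborel :: 'n heis measure) \<Otimes>\<^sub>M (lborel :: 'n heis measure))"
    by measurable
  then have "(\<lambda>x. \<integral>\<^sup>+y. ennreal (f y * polya_kernel (hom_dim TYPE('n)) s (heis_norm x) (heis_norm y)) \<partial>(lborel :: 'n heis measure))
      \<in> borel_measurable (lborel :: 'n heis measure)"
    by (intro lborel.borel_measurable_nn_integral) (simp add: split_beta')
  then show ?thesis by (simp add: polya_op_def[abs_def])
qed

lemma HLP_le_prod_polya_op:
  fixes f :: "nat \<Rightarrow> 'n::finite heis \<Rightarrow> real" and s :: "nat \<Rightarrow> real"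
  assumes m: "1 \<le> m" and x: "x \<noteq> 0"
    and f: "\<And>j. j \<in> {1..m} \<Longrightarrow> f j \<in> borel_measurable borel" "\<And>j y. j \<in> {1..m} \<Longrightarrow> 0 \<le> f j y"
    and s: "\<And>j. j \<in> {1..m} \<Longrightarrow> 0 \<le> s j" "(\<Sum>j\<in>{1..m}. s j) = real m * hom_dim TYPE('n)"
  shows "HLP m f x \<le> (\<Prod>j\<in>{1..m}. polya_op (s j) (f j) x)"
proof -
  let ?Q = "hom_dim TYPE('n)"
  define r where "r = heis_norm x"
  have r: "0 < r" using x by (simp add: r_def)
  have "HLP m f x \<le> (\<integral>\<^sup>+y. (\<Prod>j\<in>{1..m}. ennreal (f j (y j) * polya_kernel ?Q (s j) r (heis_norm (y j)))) \<partial>Pi\<^sub>M {1..m} (\<lambda>_. lborel))"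
    unfolding HLP_def r_def[symmetric]
  proof (intro nn_integral_mono)
    fix y :: "nat \<Rightarrow> 'n heis"
    define R where "R = Max (insert r ((\<lambda>j. heis_norm (y j)) ` {1..m}))"
    have R: "r \<le> R" "\<And>j. j \<in> {1..m} \<Longrightarrow> heis_norm (y j) \<le> R"
      unfolding R_def by (auto intro!: Max_ge simp del: Max_insert)
    then have R0: "0 < R" using r by linarith
    have "R \<in> insert r ((\<lambda>j. heis_norm (y j)) ` {1..m})" unfolding R_def by (intro Max_in) auto
    then have RM: "R ^ ?Q \<le> Max (insert (r ^ ?Q) ((\<lambda>j. heis_norm (y j) ^ ?Q) ` {1..m}))" (is "_ \<le> ?M")
      by (intro Max_ge) auto
    have "(\<Prod>j\<in>{1..m}. max r (heis_norm (y j)) powr s j) \<le> (\<Prod>j\<in>{1..m}. R powr s j)"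
      using R r s by (intro prod_mono conjI powr_mono2) (auto simp: le_max_iff_disj)
    also have "\<dots> = R powr (\<Sum>j\<in>{1..m}. s j)" using R0 by (intro powr_sum[symmetric]) auto
    also have "\<dots> = (R ^ ?Q) ^ m" unfolding s(2) using powr_realpow[OF R0, of "?Q * m"] by (simp add: power_mult[symmetric] mult.commute)
    also have "\<dots> \<le> ?M ^ m" using RM R0 by (intro power_mono) auto
    finally have le: "(\<Prod>j\<in>{1..m}. max r (heis_norm (y j)) powr s j) \<le> ?M ^ m" .
    have pos: "0 < (\<Prod>j\<in>{1..m}. max r (heis_norm (y j)) powr s j)"
      using r by (intro prod_pos) (auto simp: max_def)
    have "(\<Prod>j\<in>{1..m}. f j (y j)) / ?M ^ m \<le> (\<Prod>j\<in>{1..m}. f j (y j)) / (\<Prod>j\<in>{1..m}. max r (heis_norm (y j)) powr s j)"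
      using le pos f(2) by (intro divide_left_mono prod_nonneg mult_pos_pos) auto
    also have "\<dots> = (\<Prod>j\<in>{1..m}. f j (y j) / max r (heis_norm (y j)) powr s j)" by (simp add: prod_dividef)
    \<comment> \<open>The inserted powers of r have total exponent 0, since the s j add up to mQ;
      they turn each factor into a kernel of homogeneity -Q.\<close>
    also have "\<dots> = (\<Prod>j\<in>{1..m}. r powr (s j - ?Q)) * (\<Prod>j\<in>{1..m}. f j (y j) / max r (heis_norm (y j)) powr s j)"
    proof -
      have "(\<Prod>j\<in>{1..m}. r powr (s j - ?Q)) = r powr (\<Sum>j\<in>{1..m}. s j - ?Q)"
        using r by (intro powr_sum[symmetric]) auto
      also have "\<dots> = 1" using s(2) r by (simp add: sum_subtractf)
      finally show ?thesis by simp
    qed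
    also have "\<dots> = (\<Prod>j\<in>{1..m}. f j (y j) * polya_kernel ?Q (s j) r (heis_norm (y j)))"
      by (simp add: prod.distrib[symmetric] polya_kernel_def mult.commute)
    finally show "ennreal ((\<Prod>j\<in>{1..m}. f j (y j)) / ?M ^ m)
        \<le> (\<Prod>j\<in>{1..m}. ennreal (f j (y j) * polya_kernel ?Q (s j) r (heis_norm (y j))))"
      using f(2) by (subst prod_ennreal) (auto intro!: ennreal_leI)
  qed
  also have "\<dots> = (\<Prod>j\<in>{1..m}. polya_op (s j) (f j) x)"
    unfolding polya_op_def r_def
    by (rule heis_prod.product_nn_integral_prod[of "{1..m}" "\<lambda>j y. ennreal (f j y * polya_kernel ?Q (s j) (heis_norm x) (heis_norm y))"])
       (use f(1) in measurable)
  finally show ?thesis .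
qed

lemma polya_kernel_integral_finite:
  fixes b s :: real
  assumes "0 < b + hom_dim TYPE('n::finite)" "b + hom_dim TYPE('n) < s"
  obtains A where "0 \<le> A" "(\<integral>\<^sup>+y. ennreal (heis_norm y powr b / max 1 (heis_norm y) powr s) \<partial>(lborel :: 'n heis measure)) = ennreal A"
proof -
  let ?I = "\<integral>\<^sup>+y. ennreal (heis_norm y powr b / max 1 (heis_norm y) powr s) \<partial>(lborel :: 'n heis measure)"
  have [measurable]: "{y :: 'n heis. heis_norm y < 1} \<in> sets borel" "{y :: 'n heis. 1 \<le> heis_norm y} \<in> sets borel"
    by measurable
  have "?I = (\<integral>\<^sup>+y. ennreal (heis_norm y powr b) * indicator {y. heis_norm y < 1} y
      + ennreal (heis_norm y powr (b - s)) * indicator {y. 1 \<le> heis_norm y} y \<partial>(lborel :: 'n heis measure))"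
    by (intro nn_integral_cong) (auto simp: powr_diff max_def split: split_indicator)
  also have "\<dots> = (\<integral>\<^sup>+y\<in>{y. heis_norm y < 1}. ennreal (heis_norm y powr b) \<partial>(lborel :: 'n heis measure))
      + (\<integral>\<^sup>+y\<in>{y. 1 \<le> heis_norm y}. ennreal (heis_norm y powr (b - s)) \<partial>(lborel :: 'n heis measure))"
    by (intro nn_integral_add) measurable
  also have "\<dots> < top"
    using assms by (simp add: nn_integral_heis_powr_less nn_integral_heis_powr_ge)
  finally have "?I < top" .
  then have "?I = ennreal (enn2real ?I)" by simp
  then show ?thesis using that[of "enn2real ?I"] by simp
qed

text \<open>A Schur test with the power \<open>|y|^\<beta>\<close> as test function: f times the
  kernel k is split into \<open>(f^p |y|^(\<beta>(1 - p)) k)^(1/p)\<close> and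
  \<open>(|y|^\<beta> k)^(1 - 1/p)\<close>. By homogeneity the integral of
  \<open>|y|^\<beta> k\<close> is a multiple of \<open>|x|^\<beta>\<close>, finite under the two
  conditions on \<beta>.\<close>

lemma polya_op_powr_le:
  fixes p \<beta> s :: real
  assumes p: "1 < p" and \<beta>: "0 < \<beta> + hom_dim TYPE('n::finite)" "\<beta> + hom_dim TYPE('n) < s"
  obtains A where "0 \<le> A"
    "\<And>f x. f \<in> borel_measurable borel \<Longrightarrow> (\<And>y :: 'n heis. 0 \<le> f y) \<Longrightarrow> x \<noteq> 0 \<Longrightarrow>
      epowr (polya_op s f x) p \<le> ennreal (A * heis_norm x powr (\<beta> * (p - 1))) *
        (\<integral>\<^sup>+y. ennreal (f y powr p * heis_norm y powr (\<beta> * (1 - p)) * polya_kernel (hom_dim TYPE('n)) s (heis_norm x) (heis_norm y)) \<partial>lborel)"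
proof -
  let ?Q = "real (hom_dim TYPE('n))"
  obtain A where A: "0 \<le> A" "(\<integral>\<^sup>+y. ennreal (heis_norm y powr \<beta> / max 1 (heis_norm y) powr s) \<partial>(lborel :: 'n heis measure)) = ennreal A"
    using polya_kernel_integral_finite[OF \<beta>] .
  show ?thesis
  proof
    show "0 \<le> A powr (p - 1)" by simp
    fix f :: "'n heis \<Rightarrow> real" and x :: "'n heis"
    assume f [measurable]: "f \<in> borel_measurable borel" and f0: "\<And>y. 0 \<le> f y" and x: "x \<noteq> 0"
    let ?k = "\<lambda>y :: 'n heis. polya_kernel ?Q s (heis_norm x) (heis_norm y)"
    let ?F = "\<lambda>y :: 'n heis. ennreal (f y powr p * heis_norm y powr (\<beta> * (1 - p)) * ?k y)"
    let ?G = "\<lambda>y :: 'n heis. ennreal (heis_norm y powr \<beta> * ?k y)"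
    have r: "0 < heis_norm x" using x by simp
    have "polya_op s f x = (\<integral>\<^sup>+y. epowr (?F y) (1 / p) * epowr (?G y) (1 - 1 / p) \<partial>lborel)"
      unfolding polya_op_def using AE_heis_nonzero
    proof (intro nn_integral_cong_AE, eventually_elim)
      fix y :: "'n heis" assume y: "y \<noteq> 0"
      have k: "0 < ?k y" using r by (rule polya_kernel_pos)
      have n: "0 < heis_norm y" using y by simp
      have "(f y powr p * heis_norm y powr (\<beta> * (1 - p)) * ?k y) powr (1 / p) * (heis_norm y powr \<beta> * ?k y) powr (1 - 1 / p)
        = f y powr (p * (1 / p)) * (heis_norm y powr (\<beta> * (1 - p) * (1 / p)) * heis_norm y powr (\<beta> * (1 - 1 / p))) *
          (?k y powr (1 / p) * ?k y powr (1 - 1 / p))"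
        by (simp add: powr_mult powr_powr f0 mult_ac)
      also have "heis_norm y powr (\<beta> * (1 - p) * (1 / p)) * heis_norm y powr (\<beta> * (1 - 1 / p)) = heis_norm y powr 0"
        using p by (subst powr_add[symmetric]) (rule arg_cong, simp add: field_simps)
      also have "?k y powr (1 / p) * ?k y powr (1 - 1 / p) = ?k y powr 1"
        by (subst powr_add[symmetric]) simp
      finally show "ennreal (f y * ?k y) = epowr (?F y) (1 / p) * epowr (?G y) (1 - 1 / p)"
        using p n k f0 by (simp add: epowr_ennreal ennreal_mult'[symmetric])
    qed
    also have "\<dots> \<le> epowr (\<integral>\<^sup>+y. ?F y \<partial>lborel) (1 / p) * epowr (\<integral>\<^sup>+y. ?G y \<partial>lborel) (1 - 1 / p)"
      using p by (intro Hoelder_nn_integral) auto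
    finally have "epowr (polya_op s f x) p \<le> epowr (epowr (\<integral>\<^sup>+y. ?F y \<partial>lborel) (1 / p) * epowr (\<integral>\<^sup>+y. ?G y \<partial>lborel) (1 - 1 / p)) p"
      using p by (intro epowr_mono) auto
    also have "\<dots> = (\<integral>\<^sup>+y. ?F y \<partial>lborel) * epowr (\<integral>\<^sup>+y. ?G y \<partial>lborel) (p - 1)"
    proof -
      have "1 / p * p = 1" "(1 - 1 / p) * p = p - 1" using p by (auto simp: field_simps)
      then show ?thesis using p by (simp add: epowr_mult epowr_epowr)
    qed
    also have "(\<integral>\<^sup>+y. ?G y \<partial>lborel) = ennreal (heis_norm x powr \<beta>) * ennreal A"
    proof -
      have "(\<integral>\<^sup>+y. ?G y \<partial>lborel) = ennreal (heis_norm x ^ hom_dim TYPE('n)) * (\<integral>\<^sup>+y. ?G (heis_dil (heis_norm x) y) \<partial>lborel)"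
        using r by (intro nn_integral_heis_dil) auto
      also have "(\<lambda>y. ?G (heis_dil (heis_norm x) y))
          = (\<lambda>y. ennreal (heis_norm x powr (\<beta> - ?Q)) * ennreal (heis_norm y powr \<beta> / max 1 (heis_norm y) powr s))"
      proof
        fix y :: "'n heis"
        have "(heis_norm x * heis_norm y) powr \<beta> * polya_kernel ?Q s (heis_norm x * 1) (heis_norm x * heis_norm y)
          = (heis_norm x powr \<beta> * heis_norm x powr (- ?Q)) * (heis_norm y powr \<beta> / max 1 (heis_norm y) powr s)"
          using r by (subst polya_kernel_scale) (auto simp: powr_mult polya_kernel_def)
        also have "heis_norm x powr \<beta> * heis_norm x powr (- ?Q) = heis_norm x powr (\<beta> - ?Q)"
          by (subst powr_add[symmetric]) simp
        finally show "?G (heis_dil (heis_norm x) y) = ennreal (heis_norm x powr (\<beta> - ?Q)) * ennreal (heis_norm y powr \<beta> / max 1 (heis_norm y) powr s)"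
          by (simp add: heis_norm_dil ennreal_mult'[symmetric])
      qed
      also have "ennreal (heis_norm x ^ hom_dim TYPE('n)) * (\<integral>\<^sup>+y. ennreal (heis_norm x powr (\<beta> - ?Q)) * ennreal (heis_norm y powr \<beta> / max 1 (heis_norm y) powr s) \<partial>(lborel :: 'n heis measure))
         = ennreal (heis_norm x ^ hom_dim TYPE('n)) * (ennreal (heis_norm x powr (\<beta> - ?Q)) * ennreal A)"
        by (subst nn_integral_cmult) (auto simp: A)
      also have "\<dots> = ennreal (heis_norm x powr \<beta>) * ennreal A"
        using r by (simp add: mult.assoc[symmetric] ennreal_mult'[symmetric] powr_realpow[symmetric] powr_add[symmetric])
      finally show ?thesis .
    qed
    also have "epowr (ennreal (heis_norm x powr \<beta>) * ennreal A) (p - 1) = ennreal (A powr (p - 1) * heis_norm x powr (\<beta> * (p - 1)))"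
      using p A by (simp add: ennreal_mult'[symmetric] epowr_ennreal powr_mult powr_powr mult.commute)
    finally show "epowr (polya_op s f x) p \<le> ennreal (A powr (p - 1) * heis_norm x powr (\<beta> * (p - 1))) * (\<integral>\<^sup>+y. ?F y \<partial>lborel)"
      by (simp add: mult.commute)
  qed
qed

text \<open>Radial regions are compared with their dilates only, so neither polar coordinates nor a
  radial symmetrisation of \<open>f\<close> is needed: the ratio of the norms of the two arguments is
  integrated last.\<close>

lemma polya_op_radial_bound:
  fixes p g \<tau> \<beta> s :: real
  assumes p: "1 < p" and \<beta>: "0 < \<beta> + hom_dim TYPE('n::finite)" "\<beta> + hom_dim TYPE('n) < s"
    and e: "p * \<beta> + g = \<tau> - hom_dim TYPE('n)"
  obtains K where "0 \<le> K"
    "\<And>f I M. f \<in> borel_measurable borel \<Longrightarrow> (\<And>y :: 'n heis. 0 \<le> f y) \<Longrightarrow> I \<in> sets borel \<Longrightarrow>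
      (\<And>c. 0 < c \<Longrightarrow> (source_mass f p g {y. heis_norm y / c \<in> I}) \<le> M * ennreal (c powr \<tau>)) \<Longrightarrow>
      (polya_mass s f p g {x. heis_norm x \<in> I}) \<le> ennreal K * M"
proof -
  let ?Q = "real (hom_dim TYPE('n))"
  obtain A where A: "0 \<le> A" and A_le: "\<And>f x. f \<in> borel_measurable borel \<Longrightarrow> (\<And>y :: 'n heis. 0 \<le> f y) \<Longrightarrow> x \<noteq> 0 \<Longrightarrow>
      epowr (polya_op s f x) p \<le> ennreal (A * heis_norm x powr (\<beta> * (p - 1))) *
        (\<integral>\<^sup>+y. ennreal (f y powr p * heis_norm y powr (\<beta> * (1 - p)) * polya_kernel ?Q s (heis_norm x) (heis_norm y)) \<partial>lborel)"
  proof (rule polya_op_powr_le[OF p \<beta>])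
    fix A assume a1: "0 \<le> A" and a2: "\<And>f x. f \<in> borel_measurable borel \<Longrightarrow> (\<And>y :: 'n heis. 0 \<le> f y) \<Longrightarrow> x \<noteq> 0 \<Longrightarrow>
      epowr (polya_op s f x) p \<le> ennreal (A * heis_norm x powr (\<beta> * (p - 1))) *
        (\<integral>\<^sup>+y. ennreal (f y powr p * heis_norm y powr (\<beta> * (1 - p)) * polya_kernel ?Q s (heis_norm x) (heis_norm y)) \<partial>lborel)"
    show thesis by (rule that[OF a1]) (rule a2)
  qed
  \<comment> \<open>This exponent belongs to the last integral, over the ratio w: the numerator of
    the kernel gives s - Q, the weights give d - \<tau> = - \<beta> - Q. The two convergence
    conditions are those for \<beta> with the ends 0 and \<infinity> exchanged.\<close>
  have \<beta>': "0 < (s - 2 * ?Q - \<beta>) + hom_dim TYPE('n)" "(s - 2 * ?Q - \<beta>) + hom_dim TYPE('n) < s" using \<beta> by auto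
  obtain A' where A': "0 \<le> A'" "(\<integral>\<^sup>+y. ennreal (heis_norm y powr (s - 2 * ?Q - \<beta>) / max 1 (heis_norm y) powr s) \<partial>(lborel :: 'n heis measure)) = ennreal A'"
    using polya_kernel_integral_finite[OF \<beta>'] .
  define d where "d = \<beta> * (p - 1) + g"
  have d: "d + \<beta> * (1 - p) = g" "d - \<tau> = - \<beta> - ?Q" using e by (auto simp: d_def algebra_simps)
  show ?thesis
  proof
    show "0 \<le> A * A'" using A A' by simp
    fix f :: "'n heis \<Rightarrow> real" and I M
    assume f [measurable]: "f \<in> borel_measurable borel" and f0: "\<And>y. 0 \<le> f y" and I [measurable]: "I \<in> sets borel"
      and M: "\<And>c. 0 < c \<Longrightarrow> (source_mass f p g {y. heis_norm y / c \<in> I}) \<le> M * ennreal (c powr \<tau>)"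
    let ?H = "\<lambda>(x :: 'n heis) (y :: 'n heis). ennreal (heis_norm x powr d * (f y powr p * heis_norm y powr (\<beta> * (1 - p)) * polya_kernel ?Q s (heis_norm x) (heis_norm y))) * indicator I (heis_norm x)"
    let ?G = "\<lambda>(w :: 'n heis) (y :: 'n heis). ennreal (polya_kernel ?Q s (heis_norm w) 1 * heis_norm w powr d) *
        (ennreal (f y powr p * heis_norm y powr g) * indicator I (heis_norm y * heis_norm w))"
    have [measurable]: "(\<lambda>z. f (snd z)) \<in> borel_measurable ((lborel :: 'n heis measure) \<Otimes>\<^sub>M (lborel :: 'n heis measure))"
      by (rule measurable_compose[OF measurable_snd]) (simp add: f)
    have H: "case_prod ?H \<in> borel_measurable (lborel \<Otimes>\<^sub>M lborel)"
      unfolding split_beta' by measurable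
    have G: "case_prod ?G \<in> borel_measurable (lborel \<Otimes>\<^sub>M lborel)"
      unfolding split_beta' by measurable
    have "polya_mass s f p g {x. heis_norm x \<in> I}
        \<le> (\<integral>\<^sup>+x. ennreal A * (\<integral>\<^sup>+y. ?H x y \<partial>lborel) \<partial>lborel)"
    proof (rule nn_integral_mono_AE, rule AE_mp[OF AE_heis_nonzero], intro AE_I2 impI)
      fix x :: "'n heis" assume x: "x \<noteq> 0"
      let ?F = "\<lambda>y. ennreal (f y powr p * heis_norm y powr (\<beta> * (1 - p)) * polya_kernel ?Q s (heis_norm x) (heis_norm y))"
      have "epowr (polya_op s f x) p * ennreal (heis_norm x powr g) * indicator {x. heis_norm x \<in> I} x
         \<le> ennreal (A * heis_norm x powr (\<beta> * (p - 1))) * (\<integral>\<^sup>+y. ?F y \<partial>lborel) * ennreal (heis_norm x powr g) * indicator I (heis_norm x)"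
        using A_le[OF f f0 x] by (auto intro!: mult_right_mono split: split_indicator)
      also have "\<dots> = ennreal A * (ennreal (heis_norm x powr d) * indicator I (heis_norm x) * (\<integral>\<^sup>+y. ?F y \<partial>lborel))"
        using A by (simp add: d_def powr_add ennreal_mult mult_ac)
      also have "ennreal (heis_norm x powr d) * indicator I (heis_norm x) * (\<integral>\<^sup>+y. ?F y \<partial>lborel) = (\<integral>\<^sup>+y. ?H x y \<partial>lborel)"
        by (subst nn_integral_cmult[symmetric]) (auto intro!: nn_integral_cong simp: ennreal_mult mult_ac)
      finally show "epowr (polya_op s f x) p * ennreal (heis_norm x powr g) * indicator {x. heis_norm x \<in> I} x
         \<le> ennreal A * (\<integral>\<^sup>+y. ?H x y \<partial>lborel)" .
    qed
    also have "\<dots> = ennreal A * (\<integral>\<^sup>+x. \<integral>\<^sup>+y. ?H x y \<partial>lborel \<partial>lborel)"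
      using lborel.borel_measurable_nn_integral[OF H] by (intro nn_integral_cmult) simp
    also have "(\<integral>\<^sup>+x. \<integral>\<^sup>+y. ?H x y \<partial>lborel \<partial>lborel) = (\<integral>\<^sup>+y. \<integral>\<^sup>+x. ?H x y \<partial>lborel \<partial>lborel)"
      by (rule lborel_pair.Fubini'[OF H, symmetric])
    \<comment> \<open>For each fixed y the substitution \<open>x = heis_dil |y| w\<close> separates
      the variables in the kernel and the powers. Only the condition |y| |w| in I still couples
      them, and for fixed w it places y in the region I dilated by 1/|w|, where the hypothesis on f
      applies.\<close>
    also have "\<dots> = (\<integral>\<^sup>+y. \<integral>\<^sup>+w. ?G w y \<partial>lborel \<partial>lborel)"
    proof (rule nn_integral_cong_AE, rule AE_mp[OF AE_heis_nonzero], intro AE_I2 impI)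
      fix y :: "'n heis" assume y: "y \<noteq> 0"
      then have b: "0 < heis_norm y" by simp
      have "(\<integral>\<^sup>+x. ?H x y \<partial>lborel) = ennreal (heis_norm y ^ hom_dim TYPE('n)) * (\<integral>\<^sup>+w. ?H (heis_dil (heis_norm y) w) y \<partial>lborel)"
        using b by (intro nn_integral_heis_dil) auto
      also have "\<dots> = (\<integral>\<^sup>+w. ennreal (heis_norm y powr ?Q) * ?H (heis_dil (heis_norm y) w) y \<partial>lborel)"
        using b by (subst nn_integral_cmult) (auto simp: powr_realpow)
      also have "\<dots> = (\<integral>\<^sup>+w. ?G w y \<partial>lborel)"
      proof (intro nn_integral_cong)
        fix w :: "'n heis"
        have "heis_norm y powr ?Q * ((heis_norm y * heis_norm w) powr d * (f y powr p * heis_norm y powr (\<beta> * (1 - p)) * polya_kernel ?Q s (heis_norm y * heis_norm w) (heis_norm y * 1)))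
          = (heis_norm y powr ?Q * heis_norm y powr (- ?Q)) * (heis_norm y powr d * heis_norm y powr (\<beta> * (1 - p))) * f y powr p * (polya_kernel ?Q s (heis_norm w) 1 * heis_norm w powr d)"
          using b by (subst polya_kernel_scale) (auto simp: powr_mult mult_ac)
        also have "heis_norm y powr ?Q * heis_norm y powr (- ?Q) = 1" using b by (subst powr_add[symmetric]) simp
        also have "heis_norm y powr d * heis_norm y powr (\<beta> * (1 - p)) = heis_norm y powr g"
          by (subst powr_add[symmetric]) (simp only: d)
        finally have *: "heis_norm y powr ?Q * ((heis_norm y * heis_norm w) powr d * (f y powr p * heis_norm y powr (\<beta> * (1 - p)) * polya_kernel ?Q s (heis_norm y * heis_norm w) (heis_norm y * 1)))
          = (polya_kernel ?Q s (heis_norm w) 1 * heis_norm w powr d) * (f y powr p * heis_norm y powr g)"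
          by (simp add: mult_ac)
        have "ennreal (heis_norm y powr ?Q) * ?H (heis_dil (heis_norm y) w) y
            = ennreal (heis_norm y powr ?Q * ((heis_norm y * heis_norm w) powr d * (f y powr p * heis_norm y powr (\<beta> * (1 - p)) * polya_kernel ?Q s (heis_norm y * heis_norm w) (heis_norm y * 1)))) * indicator I (heis_norm y * heis_norm w)"
          by (simp add: heis_norm_dil ennreal_mult' mult.assoc)
        also have "\<dots> = ?G w y" unfolding * by (simp add: ennreal_mult' mult.assoc)
        finally show "ennreal (heis_norm y powr ?Q) * ?H (heis_dil (heis_norm y) w) y = ?G w y" .
      qed
      finally show "(\<integral>\<^sup>+x. ?H x y \<partial>lborel) = (\<integral>\<^sup>+w. ?G w y \<partial>lborel)" .
    qed
    also have "\<dots> = (\<integral>\<^sup>+w. \<integral>\<^sup>+y. ?G w y \<partial>lborel \<partial>lborel)"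
      by (rule lborel_pair.Fubini'[OF G])
    also have "\<dots> \<le> (\<integral>\<^sup>+w. M * ennreal (heis_norm w powr (s - 2 * ?Q - \<beta>) / max 1 (heis_norm w) powr s) \<partial>(lborel :: 'n heis measure))"
    proof (rule nn_integral_mono_AE, rule AE_mp[OF AE_heis_nonzero], intro AE_I2 impI)
      fix w :: "'n heis" assume w: "w \<noteq> 0"
      then have a: "0 < heis_norm w" by simp
      have "(\<integral>\<^sup>+y. ?G w y \<partial>lborel) = ennreal (polya_kernel ?Q s (heis_norm w) 1 * heis_norm w powr d) *
         (\<integral>\<^sup>+y. ennreal (f y powr p * heis_norm y powr g) * indicator I (heis_norm y * heis_norm w) \<partial>lborel)"
        by (intro nn_integral_cmult) measurable
      also have "(\<integral>\<^sup>+y. ennreal (f y powr p * heis_norm y powr g) * indicator I (heis_norm y * heis_norm w) \<partial>lborel)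
         = source_mass f p g {y. heis_norm y / (1 / heis_norm w) \<in> I}"
        by (intro nn_integral_cong) (auto split: split_indicator)
      also have "\<dots> \<le> M * ennreal ((1 / heis_norm w) powr \<tau>)" using a by (intro M) auto
      finally have "(\<integral>\<^sup>+y. ?G w y \<partial>lborel) \<le> ennreal (polya_kernel ?Q s (heis_norm w) 1 * heis_norm w powr d) * (M * ennreal ((1 / heis_norm w) powr \<tau>))"
        by (simp add: mult_left_mono)
      also have "\<dots> = M * ennreal (polya_kernel ?Q s (heis_norm w) 1 * heis_norm w powr d * (1 / heis_norm w) powr \<tau>)"
        by (simp add: ennreal_mult' mult_ac)
      also have "polya_kernel ?Q s (heis_norm w) 1 * heis_norm w powr d * (1 / heis_norm w) powr \<tau>
         = heis_norm w powr (s - 2 * ?Q - \<beta>) / max 1 (heis_norm w) powr s"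
      proof -
        have "heis_norm w powr (s - ?Q) * (heis_norm w powr d * (1 / heis_norm w) powr \<tau>)
            = heis_norm w powr (s - ?Q) * heis_norm w powr (d - \<tau>)"
          using a by (simp add: powr_diff powr_divide)
        also have "\<dots> = heis_norm w powr (s - 2 * ?Q - \<beta>)"
          by (subst powr_add[symmetric]) (simp add: d algebra_simps)
        finally show ?thesis by (simp add: polya_kernel_def max.commute mult.assoc)
      qed
      finally show "(\<integral>\<^sup>+y. ?G w y \<partial>lborel) \<le> M * ennreal (heis_norm w powr (s - 2 * ?Q - \<beta>) / max 1 (heis_norm w) powr s)" .
    qed
    also have "\<dots> = M * ennreal A'" by (subst nn_integral_cmult) (auto simp: A')
    finally have "polya_mass s f p g {x. heis_norm x \<in> I} \<le> ennreal A * (M * ennreal A')"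
      by (simp add: mult_left_mono)
    also have "\<dots> = ennreal (A * A') * M" using A A' by (simp add: ennreal_mult mult_ac)
    finally show "polya_mass s f p g {x. heis_norm x \<in> I} \<le> ennreal (A * A') * M" .
  qed
qed

section \<open>Geometry of Koranyi balls\<close>

lemma heis_dist_left_mult [simp]: "heis_dist (heis_mult p a) (heis_mult p b) = heis_dist a b"
proof -
  have "heis_mult (- heis_mult p b) (heis_mult p a) = heis_mult (- b) a"
    by (simp add: heis_inv_mult heis_mult_assoc)
  then show ?thesis by (simp add: heis_dist_eq)
qed

lemma heis_norm_le_mult: "heis_norm p - heis_norm x \<le> heis_norm (heis_mult p x)"
proof -
  have "heis_mult (heis_mult p x) (- x) = p"
    using heis_mult_inv(2)[of x] by (simp add: heis_mult_assoc heis_inv_def heis_mult_zero)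
  then show ?thesis using heis_norm_triangle[of "heis_mult p x" "- x"] by simp
qed

text \<open>Near a boundary point the unit ball contains a half-space-like region: with
  \<open>u = (\<zeta>, s)\<close> the function \<open>x \<mapsto> d(u,x)\<^sup>4\<close> has horizontal gradient \<open>- 4 b\<close> at the origin, where
  \<open>b = |\<zeta>|\<^sup>2 \<zeta> - s J \<zeta>\<close>, and vertical derivative \<open>- 2 s\<close>; both cannot be small at once.\<close>

lemma heis_unit_ball_region:
  fixes u :: "'n::finite heis" and e :: "real ^ ('n + 'n)" and z :: "real ^ ('n + 'n)" and t \<rho> :: real
  assumes u: "heis_norm u < 1" and \<rho>: "0 < \<rho>" "\<rho> \<le> 1"
    and e: "norm e = 1" "(norm (fst u))\<^sup>2 *\<^sub>R fst u \<bullet> e - snd u *\<^sub>R heis_J (fst u) \<bullet> e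
      = norm ((norm (fst u))\<^sup>2 *\<^sub>R fst u - snd u *\<^sub>R heis_J (fst u))"
    and z: "norm (z - (\<rho> / 100) *\<^sub>R e) < \<rho> / 200"
    and t: "\<rho>\<^sup>2 / 200 \<le> \<bar>t\<bar>" "\<bar>t\<bar> \<le> \<rho>\<^sup>2 / 100" "0 \<le> snd u * t"
  shows "heis_dist u (z, t) < 1" "heis_norm (z, t) < \<rho>"
proof -
  define \<zeta> s n where "\<zeta> = fst u" and "s = snd u" and "n = norm \<zeta>"
  define b where "b = n\<^sup>2 *\<^sub>R \<zeta> - s *\<^sub>R heis_J \<zeta>"
  define D where "D = n ^ 4 + s\<^sup>2"
  define m where "m = norm z"
  define w where "w = heis_J \<zeta> \<bullet> z"
  have n0: "0 \<le> n" "0 \<le> m" by (simp_all add: n_def m_def)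
  have D1: "D < 1" using u by (simp add: heis_norm_less_iff D_def n_def \<zeta>_def s_def)
  have "n ^ 4 < 1" using D1 by (simp add: D_def) (smt (verit) zero_le_power2)
  then have n1: "n < 1" using n0 by (metis not_less one_le_power)
  have m: "m \<le> 3 * \<rho> / 200"
  proof -
    have "m \<le> norm (z - (\<rho> / 100) *\<^sub>R e) + norm ((\<rho> / 100) *\<^sub>R e)" unfolding m_def
      by (metis diff_add_cancel norm_triangle_ineq)
    also have "norm ((\<rho> / 100) *\<^sub>R e) = \<rho> / 100" using e \<rho> by simp
    finally show ?thesis using z by simp
  qed
  have t2: "t\<^sup>2 \<le> \<rho> ^ 4 / 10000"
  proof -
    have "\<bar>t\<bar>\<^sup>2 \<le> (\<rho>\<^sup>2 / 100)\<^sup>2" using t by (intro power_mono) auto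
    then show ?thesis by (simp add: power_divide power_mult[symmetric])
  qed
  have m4: "m ^ 4 \<le> \<rho> ^ 4 / 1000000"
  proof -
    have "m ^ 4 \<le> (3 * \<rho> / 200) ^ 4" using m n0 by (intro power_mono) auto
    also have "\<dots> = \<rho> ^ 4 * (81 / 1600000000)" by (simp add: power_mult_distrib power_divide)
    also have "\<dots> \<le> \<rho> ^ 4 / 1000000" using \<rho> by simp
    finally show ?thesis .
  qed
  have x4: "norm (fst (z, t)) ^ 4 + (snd (z, t))\<^sup>2 \<le> \<rho> ^ 4 / 5000"
    using t2 m4 \<rho> by (simp add: m_def) (smt (verit) zero_le_power)
  have \<rho>4: "0 < \<rho> ^ 4" using \<rho> by simp
  show "heis_norm (z, t) < \<rho>"
    using x4 \<rho> \<rho>4 by (subst heis_norm_less_iff, simp) linarith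
  show "heis_dist u (z, t) < 1"
  \<comment> \<open>If u is well inside the unit ball, the triangle inequality with |u| < 3/4 and
    |x| < 1/4 is enough. Only for D \<ge> 1/4 is the first-order analysis required.\<close>
  proof (cases "D < 1 / 4")
    case True
    have "heis_norm u < 3 / 4"
      using True by (subst heis_norm_less_iff) (auto simp: D_def n_def \<zeta>_def s_def power_divide)
    moreover have "\<rho> ^ 4 \<le> 1" using \<rho> by (simp add: power_le_one)
    then have "heis_norm (z, t) < 1 / 4"
      using x4 by (subst heis_norm_less_iff) (auto simp: power_divide)
    ultimately show ?thesis
      using heis_dist_triangle[of u "(z, t)" 0] by simp
  next
    case False
    \<comment> \<open>The two terms of b are orthogonal, whence \<open>|b|^2 = n^2 * D\<close>; this
      is where D \<ge> 1/4 enters.\<close>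
    have nb: "n / 2 \<le> norm b"
    proof (rule power2_le_imp_le)
      have "(norm b)\<^sup>2 = n\<^sup>2 * D"
        unfolding power2_norm_eq_inner b_def
        by (simp add: inner_diff_left inner_diff_right D_def)
           (simp add: power2_norm_eq_inner[symmetric] n_def power2_eq_square power4_eq_xxxx algebra_simps)
      moreover have "n\<^sup>2 * (1 / 4) \<le> n\<^sup>2 * D" using False by (intro mult_left_mono) auto
      ultimately show "(n / 2)\<^sup>2 \<le> (norm b)\<^sup>2" by (simp add: power_divide)
    qed simp
    have be: "b \<bullet> e = norm b"
      using e(2) by (simp add: b_def n_def \<zeta>_def s_def inner_diff_left)
    have "b \<bullet> z = (\<rho> / 100) * (b \<bullet> e) + b \<bullet> (z - (\<rho> / 100) *\<^sub>R e)" by (simp add: inner_diff_right)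
    moreover have "\<bar>b \<bullet> (z - (\<rho> / 100) *\<^sub>R e)\<bar> \<le> norm b * (\<rho> / 200)"
      using Cauchy_Schwarz_ineq2[of b "z - (\<rho> / 100) *\<^sub>R e"] mult_left_mono[OF less_imp_le[OF z], of "norm b"] by simp
    ultimately have "\<rho> / 200 * norm b \<le> b \<bullet> z" unfolding be by (simp add: abs_le_iff field_simps)
    moreover have "\<rho> / 200 * (n / 2) \<le> \<rho> / 200 * norm b" using nb \<rho> by (intro mult_left_mono) auto
    ultimately have bz: "\<rho> * n / 400 \<le> b \<bullet> z" by simp
    have bz_eq: "b \<bullet> z = n\<^sup>2 * (\<zeta> \<bullet> z) - s * w" by (simp add: b_def inner_diff_left w_def)
    have \<zeta>z: "(\<zeta> \<bullet> z)\<^sup>2 \<le> n\<^sup>2 * m\<^sup>2" and ww: "w\<^sup>2 \<le> n\<^sup>2 * m\<^sup>2"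
      using inner_heis_J_Bessel[of \<zeta> z] by (auto simp: n_def m_def w_def intro: order_trans[rotated])
    have st: "\<bar>s\<bar> * (\<rho>\<^sup>2 / 200) \<le> s * t"
    proof -
      have "\<bar>s\<bar> * (\<rho>\<^sup>2 / 200) \<le> \<bar>s\<bar> * \<bar>t\<bar>" using t by (intro mult_left_mono) auto
      also have "\<dots> = s * t" using t(3) by (simp add: s_def abs_mult[symmetric])
      finally show ?thesis .
    qed
    define P S where "P = \<rho> * n" and "S = \<bar>s\<bar> * \<rho>\<^sup>2"
    have bz': "P / 400 \<le> b \<bullet> z" and st': "S / 200 \<le> s * t" using bz st by (simp_all add: P_def S_def)
    have N: "norm (fst (heis_mult (- u) (z, t))) ^ 4 + (snd (heis_mult (- u) (z, t)))\<^sup>2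
        = (n\<^sup>2 - 2 * (\<zeta> \<bullet> z) + m\<^sup>2)\<^sup>2 + (t - s - 2 * w)\<^sup>2"
    proof -
      have "norm (fst (heis_mult (- u) (z, t))) ^ 4 = ((norm (z - \<zeta>))\<^sup>2)\<^sup>2"
        by (simp add: heis_mult_eq \<zeta>_def power_mult[symmetric])
      also have "(norm (z - \<zeta>))\<^sup>2 = n\<^sup>2 - 2 * (\<zeta> \<bullet> z) + m\<^sup>2"
        by (simp add: power2_norm_eq_inner n_def m_def inner_diff_left inner_diff_right inner_commute)
      finally show ?thesis by (simp add: heis_mult_eq \<zeta>_def s_def w_def)
    qed
    \<comment> \<open>The Taylor expansion of the fourth power of the distance: the first-order
      terms in z and t are gains, and the remainder in parentheses is bounded below by means of the
      Bessel estimates for the two inner products.\<close>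
    have "(n\<^sup>2 - 2 * (\<zeta> \<bullet> z) + m\<^sup>2)\<^sup>2 + (t - s - 2 * w)\<^sup>2
       = D - 4 * (b \<bullet> z) - 2 * (s * t) + (2 * n\<^sup>2 * m\<^sup>2 + (m\<^sup>2 - 2 * (\<zeta> \<bullet> z))\<^sup>2 + (2 * w - t)\<^sup>2)"
      unfolding bz_eq D_def by (simp add: power2_eq_square power4_eq_xxxx algebra_simps)
    also have "(m\<^sup>2 - 2 * (\<zeta> \<bullet> z))\<^sup>2 \<le> 2 * m ^ 4 + 8 * (\<zeta> \<bullet> z)\<^sup>2"
      using zero_le_power2[of "m\<^sup>2 + 2 * (\<zeta> \<bullet> z)"] by (simp add: power2_eq_square power4_eq_xxxx algebra_simps)
    also have "(2 * w - t)\<^sup>2 \<le> 8 * w\<^sup>2 + 2 * t\<^sup>2"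
      using zero_le_power2[of "2 * w + t"] by (simp add: power2_eq_square algebra_simps)
    finally have "(n\<^sup>2 - 2 * (\<zeta> \<bullet> z) + m\<^sup>2)\<^sup>2 + (t - s - 2 * w)\<^sup>2
       \<le> D - P / 100 - S / 100 + (18 * (n\<^sup>2 * m\<^sup>2) + 2 * (\<rho> ^ 4 / 1000000) + 2 * (\<rho> ^ 4 / 10000))"
      using bz' st' \<zeta>z ww t2 m4 by simp
    moreover have "18 * (n\<^sup>2 * m\<^sup>2) \<le> P / 200"
    proof -
      have "m\<^sup>2 \<le> (3 * \<rho> / 200)\<^sup>2" using m n0 by (intro power_mono) auto
      also have "\<dots> = 9 / 40000 * (\<rho> * \<rho>)" by (simp add: power2_eq_square)
      also have "\<dots> \<le> 9 / 40000 * (\<rho> * 1)" using \<rho> by (intro mult_left_mono) auto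
      finally have "n\<^sup>2 * m\<^sup>2 \<le> n * (9 / 40000 * \<rho>)"
        using n0 n1 \<rho> by (intro mult_mono) (auto simp: power2_eq_square mult_left_le)
      also have "\<dots> = 9 / 40000 * (\<rho> * n)" by simp
      finally show ?thesis using mult_nonneg_nonneg[of \<rho> n] n0 \<rho> unfolding P_def by linarith
    qed
    \<comment> \<open>P and S are the horizontal and the vertical gain. Half of P/100 is spent on
      the term with \<open>n^2 * m^2\<close>. Because of D \<ge> 1/4 either n \<ge> 1/2 or |s| \<ge>
      1/4, so what remains of the two gains beats the terms of order
      \<open>\<rho> ^ 4\<close>.\<close>
    moreover have "\<rho> ^ 4 * (3 / 10000) < P / 200 + S / 100"
    proof -
      have r1: "\<rho> ^ 4 \<le> \<rho>" "\<rho> ^ 4 \<le> \<rho>\<^sup>2"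
        using \<rho> power_decreasing[of 1 4 \<rho>] power_decreasing[of 2 4 \<rho>] by auto
      show ?thesis
      proof (cases "1 / 2 \<le> n")
        case True
        then have "\<rho> * (1 / 2) \<le> \<rho> * n" using \<rho> by (intro mult_left_mono) auto
        moreover have "0 \<le> S" by (simp add: S_def)
        ultimately show ?thesis using r1 \<rho> unfolding P_def by linarith
      next
        case n2: False
        then have "n ^ 4 \<le> (1 / 2) ^ 4" using n0 by (intro power_mono) auto
        then have "(1 / 4)\<^sup>2 \<le> \<bar>s\<bar>\<^sup>2" using False by (simp add: D_def power_divide)
        then have "1 / 4 \<le> \<bar>s\<bar>" by (rule power2_le_imp_le) simp
        then have "1 / 4 * \<rho>\<^sup>2 \<le> S" unfolding S_def by (intro mult_right_mono) auto
        moreover have "0 \<le> P" using \<rho> n0 by (simp add: P_def)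
        moreover have "0 < \<rho>\<^sup>2" using \<rho> by simp
        ultimately show ?thesis using r1 by linarith
      qed
    qed
    ultimately have "norm (fst (heis_mult (- u) (z, t))) ^ 4 + (snd (heis_mult (- u) (z, t)))\<^sup>2 < 1"
      unfolding N using D1 \<rho>4 by linarith
    then show ?thesis unfolding heis_dist_eq' by (subst heis_norm_less_iff) auto
  qed
qed

text \<open>The region found above is a cylinder whose size is proportional to \<rho> in the 2n
  horizontal directions and to \<open>\<rho>^2\<close> vertically, so its volume is a multiple of
  \<open>\<rho>^Q\<close>. The constant does not depend on how u lies relative to the poles of the
  ball.\<close>

lemma heis_unit_ball_density:
  obtains c where "0 < c"
    "\<And>(u :: 'n::finite heis) \<rho>. heis_norm u < 1 \<Longrightarrow> 0 < \<rho> \<Longrightarrow> \<rho> \<le> 1 \<Longrightarrow>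
      ennreal (c * \<rho> ^ hom_dim TYPE('n)) \<le> emeasure lborel {x. heis_dist u x < 1 \<and> heis_norm x < \<rho>}"
proof -
  let ?D = "2 * CARD('n)"
  define V where "V = Ball_Volume.unit_ball_vol (real DIM(real ^ ('n + 'n)))"
  have V: "0 < V" unfolding V_def by (intro Ball_Volume.unit_ball_vol_pos) simp
  have dim: "DIM(real ^ ('n + 'n)) = ?D" by (simp add: card_UNIV_sum)
  have ball: "emeasure lborel (ball (v :: real ^ ('n + 'n)) r) = ennreal (V * r ^ ?D)" if "0 < r" for v r
    unfolding V_def dim[symmetric] using that by (intro emeasure_ball) simp
  define c where "c = V * (1 / 200) ^ ?D / 200"
  show ?thesis
  proof
    show "0 < c" using V by (simp add: c_def)
    fix u :: "'n heis" and \<rho> :: real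
    assume u: "heis_norm u < 1" and \<rho>: "0 < \<rho>" "\<rho> \<le> 1"
    let ?b = "(norm (fst u))\<^sup>2 *\<^sub>R fst u - snd u *\<^sub>R heis_J (fst u)"
    \<comment> \<open>The direction of the horizontal gradient. If the gradient vanishes, any unit
      vector will do, since the vertical direction then provides the gain.\<close>
    obtain e where e: "norm e = 1" "?b \<bullet> e = norm ?b"
    proof (cases "?b = 0")
      case True
      obtain e :: "real ^ ('n + 'n)" where "norm e = 1" using vector_choose_size[of 1] by auto
      then show ?thesis using that[of e] True by simp
    next
      case False
      then show ?thesis
        by (intro that[of "?b /\<^sub>R norm ?b"])
           (simp_all add: power2_norm_eq_inner[symmetric] power2_eq_square)
    qed
    define T where "T = (if 0 \<le> snd u then {\<rho>\<^sup>2 / 200..\<rho>\<^sup>2 / 100} else {- (\<rho>\<^sup>2 / 100)..- (\<rho>\<^sup>2 / 200)})"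
    define G where "G = ball ((\<rho> / 100) *\<^sub>R e) (\<rho> / 200) \<times> T"
    have sub: "G \<subseteq> {x. heis_dist u x < 1 \<and> heis_norm x < \<rho>}"
    proof safe
      fix z t assume "(z, t) \<in> G"
      then have z: "norm (z - (\<rho> / 100) *\<^sub>R e) < \<rho> / 200" and "t \<in> T"
        by (auto simp: G_def dist_norm norm_minus_commute)
      then have t: "\<rho>\<^sup>2 / 200 \<le> \<bar>t\<bar>" "\<bar>t\<bar> \<le> \<rho>\<^sup>2 / 100" "0 \<le> snd u * t"
        using zero_le_power2[of \<rho>] by (auto simp: T_def abs_if zero_le_mult_iff split: if_splits simp del: zero_le_power2)
      show "heis_dist u (z, t) < 1" "heis_norm (z, t) < \<rho>"
        using heis_unit_ball_region[OF u \<rho> e(1) _ z t] e(2) by (auto simp: inner_diff_left)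
    qed
    have em: "emeasure lborel G = ennreal (c * \<rho> ^ hom_dim TYPE('n))"
    proof -
      have "emeasure lborel T = ennreal (\<rho>\<^sup>2 / 200)" by (auto simp: T_def)
      then have "emeasure lborel G = ennreal (V * (\<rho> / 200) ^ ?D) * ennreal (\<rho>\<^sup>2 / 200)"
        unfolding G_def using \<rho> T_def
        by (subst lborel_prod[symmetric], subst lborel.emeasure_pair_measure_Times) (auto simp: ball)
      also have "\<dots> = ennreal (c * \<rho> ^ hom_dim TYPE('n))"
        using V \<rho> by (simp add: ennreal_mult'[symmetric] c_def hom_dim_def power_divide power_add power2_eq_square)
      finally show ?thesis .
    qed
    have meas: "{x. heis_dist u x < 1 \<and> heis_norm x < \<rho>} \<in> sets lborel"
    proof -
      have "{x. heis_dist u x < 1 \<and> heis_norm x < \<rho>} = heis_ball u 1 \<inter> heis_ball 0 \<rho>"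
        by (auto simp: heis_ball_iff heis_ball_0)
      then show ?thesis by simp
    qed
    show "ennreal (c * \<rho> ^ hom_dim TYPE('n)) \<le> emeasure lborel {x. heis_dist u x < 1 \<and> heis_norm x < \<rho>}"
      unfolding em[symmetric] by (rule emeasure_mono[OF sub meas])
  qed
qed

text \<open>Translating p to the origin and dilating by 1/R turns the ball into a unit ball that
  contains the origin, to which \<open>heis_unit_ball_density\<close> applies. Left multiplication
  by p and dilation change the volume by the factor \<open>R^Q\<close> only.\<close>

lemma heis_ball_density:
  obtains c where "0 < c"
    "\<And>(a :: 'n::finite heis) R p. p \<in> heis_ball a R \<Longrightarrow> p \<noteq> 0 \<Longrightarrow> heis_norm p \<le> 5 * R \<Longrightarrow>
      ennreal (c * heis_norm p ^ hom_dim TYPE('n))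
        \<le> emeasure lborel (heis_ball a R \<inter> (heis_annulus (heis_norm p / 2) (2 * heis_norm p)))"
proof (rule heis_unit_ball_density)
  fix c assume c: "0 < c" and den: "\<And>(u :: 'n::finite heis) \<rho>. heis_norm u < 1 \<Longrightarrow> 0 < \<rho> \<Longrightarrow> \<rho> \<le> 1 \<Longrightarrow>
      ennreal (c * \<rho> ^ hom_dim TYPE('n)) \<le> emeasure lborel {x. heis_dist u x < 1 \<and> heis_norm x < \<rho>}"
  show thesis
  proof
    show "0 < c / 10 ^ hom_dim TYPE('n)" using c by simp
    fix a p :: "'n heis" and R
    assume p: "p \<in> heis_ball a R" "p \<noteq> 0" "heis_norm p \<le> 5 * R"
    define r where "r = heis_norm p"
    have r: "0 < r" "r \<le> 5 * R" using p by (auto simp: r_def)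
    then have R: "0 < R" by simp
    \<comment> \<open>After scaling back, points of norm below \<rho> move p by at most a tenth of
      its norm, so the shell between |p|/2 and 2|p| is not left. The bound |p| \<le> 5 * R gives
      \<rho> \<le> 1/2.\<close>
    define \<rho> where "\<rho> = r / (10 * R)"
    have \<rho>: "0 < \<rho>" "\<rho> \<le> 1" using r R by (auto simp: \<rho>_def field_simps)
    define u where "u = heis_dil (1 / R) (heis_mult (- p) a)"
    have u: "heis_norm u < 1"
      using p(1) R by (simp add: u_def heis_norm_dil heis_ball_iff heis_dist_eq field_simps)
    let ?S = "heis_ball a R \<inter> (heis_annulus (r / 2) (2 * r))"
    have S [measurable]: "?S \<in> sets borel" by measurable
    have sub: "heis_mult p (heis_dil R x) \<in> ?S" if "heis_dist u x < 1" "heis_norm x < \<rho>" for x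
    proof -
      have "heis_mult p (heis_dil R u) = a" using R by (simp add: u_def)
      then have "heis_dist a (heis_mult p (heis_dil R x)) = heis_dist (heis_mult p (heis_dil R u)) (heis_mult p (heis_dil R x))"
        by simp
      also have "\<dots> = R * heis_dist u x" using R by (simp add: heis_dist_dil)
      also have "\<dots> < R" using that R by simp
      finally have 1: "heis_mult p (heis_dil R x) \<in> heis_ball a R" by (simp add: heis_ball_iff)
      have "heis_norm (heis_dil R x) \<le> r / 10"
        using that R by (simp add: heis_norm_dil \<rho>_def field_simps)
      then show ?thesis
        using 1 heis_norm_le_mult[of p "heis_dil R x"] heis_norm_triangle[of p "heis_dil R x"] r
        by (simp add: r_def)
    qed
    have "ennreal (c / 10 ^ hom_dim TYPE('n) * r ^ hom_dim TYPE('n)) = ennreal (R ^ hom_dim TYPE('n)) * ennreal (c * \<rho> ^ hom_dim TYPE('n))"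
      using R by (simp add: ennreal_mult'[symmetric] \<rho>_def power_divide power_mult_distrib)
    also have "\<dots> \<le> ennreal (R ^ hom_dim TYPE('n)) * emeasure lborel {x. heis_dist u x < 1 \<and> heis_norm x < \<rho>}"
      using den[OF u \<rho>] by (intro mult_left_mono) auto
    also have "\<dots> \<le> ennreal (R ^ hom_dim TYPE('n)) * (\<integral>\<^sup>+x. indicator ?S (heis_mult p (heis_dil R x)) \<partial>lborel)"
    proof (intro mult_left_mono)
      have "{x. heis_dist u x < 1 \<and> heis_norm x < \<rho>} = heis_ball u 1 \<inter> heis_ball 0 \<rho>"
        by (auto simp: heis_ball_iff heis_ball_0)
      then have "emeasure lborel {x. heis_dist u x < 1 \<and> heis_norm x < \<rho>} = (\<integral>\<^sup>+x. indicator {x. heis_dist u x < 1 \<and> heis_norm x < \<rho>} x \<partial>lborel)"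
        by (intro nn_integral_indicator[symmetric]) simp
      also have "\<dots> \<le> (\<integral>\<^sup>+x. indicator ?S (heis_mult p (heis_dil R x)) \<partial>lborel)"
        using sub by (intro nn_integral_mono) (simp add: indicator_def)
      finally show "emeasure lborel {x. heis_dist u x < 1 \<and> heis_norm x < \<rho>} \<le> (\<integral>\<^sup>+x. indicator ?S (heis_mult p (heis_dil R x)) \<partial>lborel)" .
    qed simp
    also have "\<dots> = (\<integral>\<^sup>+x. indicator ?S (heis_mult p x) \<partial>lborel)"
    proof (rule nn_integral_heis_dil[symmetric, OF _ R])
      show "(\<lambda>x. indicator ?S (heis_mult p x) :: ennreal) \<in> borel_measurable borel"
        by (rule measurable_compose[OF measurable_heis_mult]) simp
    qed
    also have "\<dots> = (\<integral>\<^sup>+x. indicator ?S x \<partial>lborel)" by (rule nn_integral_heis_mult) simp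
    also have "\<dots> = emeasure lborel ?S" by simp
    finally show "ennreal (c / 10 ^ hom_dim TYPE('n) * heis_norm p ^ hom_dim TYPE('n))
      \<le> emeasure lborel (heis_ball a R \<inter> (heis_annulus (heis_norm p / 2) (2 * heis_norm p)))"
      unfolding r_def .
  qed
qed

section \<open>Covering a punctured neighbourhood of the origin\<close>

lemma norm_axis_real: "norm (axis i x :: real ^ 'a::finite) = \<bar>x\<bar>"
  by (simp add: norm_eq_sqrt_inner inner_axis_axis)

text \<open>Unit balls with the origin on their boundary cover a punctured neighbourhood of the origin;
  shrinking them slightly keeps them polynomially far from it. The vertical centres take care of
  \<open>|t| \<ge> |z|\<^sup>4\<close>, the horizontal ones of the rest.\<close>

lemma heis_unit_balls_cover:
  obtains T :: "'n::finite heis set" and \<delta> \<eta> where "finite T" "0 < \<delta>" "0 < \<eta>" "\<eta> < 1"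
    "\<And>\<rho> x. 0 < \<rho> \<Longrightarrow> \<rho> \<le> heis_norm x \<Longrightarrow> heis_norm x \<le> \<delta> \<Longrightarrow> \<exists>a\<in>T. x \<in> heis_ball a (1 - \<eta> * \<rho> ^ 4)"
    "\<And>\<rho> a y. a \<in> T \<Longrightarrow> 0 < \<rho> \<Longrightarrow> \<rho> \<le> \<delta> \<Longrightarrow> y \<in> heis_ball a (1 - \<eta> * \<rho> ^ 4) \<Longrightarrow> \<eta> * \<rho> ^ 4 \<le> heis_norm y \<and> heis_norm y \<le> 2"
proof -
  define D where "D = real CARD('n + 'n)"
  have D: "2 \<le> D"
  proof -
    have "1 \<le> CARD('n)" by (simp add: Suc_le_eq)
    then show ?thesis by (simp add: D_def card_UNIV_sum)
  qed
  define T :: "'n heis set" where "T = {(0, 1), (0, - 1)} \<union> (\<Union>i\<in>UNIV. {(axis i 1, 0), (axis i (- 1), 0)})"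
  have T1: "heis_norm a = 1" if "a \<in> T" for a
    using that by (intro heis_norm_eqI) (auto simp: T_def norm_axis_real)
  \<comment> \<open>The factor D is the loss in estimating |z| by its largest coordinate. With this
    \<delta> the squares of |z| are at most y/11, where y is that coordinate in absolute value;
    \<eta> makes \<open>8 * \<eta> * \<rho> ^ 4\<close> smaller than the linear gain in both
    cases.\<close>
  define \<delta> where "\<delta> = 1 / (11 * D)"
  define \<eta> where "\<eta> = 1 / (32 * D)"
  have \<delta>: "0 < \<delta>" "\<delta> \<le> 1 / 22" using D by (auto simp: \<delta>_def field_simps)
  have \<eta>: "0 < \<eta>" "\<eta> < 1" using D by (auto simp: \<eta>_def field_simps)
  show ?thesis
  proof
    show "finite T" by (simp add: T_def)
    show "0 < \<delta>" "0 < \<eta>" "\<eta> < 1" by fact+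
    fix \<rho> a and y :: "'n heis"
    assume a: "a \<in> T" and y: "y \<in> heis_ball a (1 - \<eta> * \<rho> ^ 4)"
    have "0 \<le> \<eta> * \<rho> ^ 4" using \<eta> by simp
    with heis_ball_norm[OF y] T1[OF a] show "\<eta> * \<rho> ^ 4 \<le> heis_norm y \<and> heis_norm y \<le> 2" by linarith
  next
    fix \<rho> and x :: "'n heis"
    assume \<rho>: "0 < \<rho>" "\<rho> \<le> heis_norm x" and x: "heis_norm x \<le> \<delta>"
    define z t m where "z = fst x" and "t = snd x" and "m = norm z"
    have m0: "0 \<le> m" by (simp add: m_def)
    have x4: "heis_norm x ^ 4 = m ^ 4 + t\<^sup>2" by (simp add: heis_norm_pow4 m_def z_def t_def)
    have \<rho>4: "\<rho> ^ 4 \<le> m ^ 4 + t\<^sup>2" unfolding x4[symmetric] using \<rho> by (intro power_mono) auto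
    have m\<delta>: "m \<le> \<delta>" using norm_fst_le_heis_norm[of x] x by (simp add: m_def z_def)
    have "\<exists>a\<in>T. norm (fst (heis_mult (- a) x)) ^ 4 + (snd (heis_mult (- a) x))\<^sup>2 \<le> 1 - 8 * (\<eta> * \<rho> ^ 4)"
    proof (cases "m ^ 4 \<le> \<bar>t\<bar>")
      case True
      have t1: "\<bar>t\<bar> \<le> 1 / 2"
      proof (rule power2_le_imp_le)
        have "t\<^sup>2 \<le> heis_norm x ^ 4" unfolding x4 using m0 by simp
        also have "\<dots> \<le> (1 / 22) ^ 4" using x \<delta> by (intro power_mono) auto
        finally show "\<bar>t\<bar>\<^sup>2 \<le> (1 / 2)\<^sup>2" by (simp add: power_divide)
      qed simp
      have tt: "t\<^sup>2 \<le> \<bar>t\<bar> * (1 / 2)"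
        using mult_left_mono[OF t1, of "\<bar>t\<bar>"] by (simp add: power2_eq_square abs_mult[symmetric])
      define a :: "'n heis" where "a = (0, if 0 \<le> t then 1 else - 1)"
      have "a \<in> T" by (simp add: a_def T_def)
      moreover have "norm (fst (heis_mult (- a) x)) ^ 4 + (snd (heis_mult (- a) x))\<^sup>2 = m ^ 4 + (\<bar>t\<bar> - 1)\<^sup>2"
        by (simp add: heis_mult_eq a_def m_def z_def[symmetric] t_def[symmetric] power2_eq_square algebra_simps)
      moreover have "m ^ 4 + (\<bar>t\<bar> - 1)\<^sup>2 \<le> 1 - \<bar>t\<bar> / 2"
        using True tt by (simp add: power2_diff)
      moreover have "8 * (\<eta> * \<rho> ^ 4) \<le> \<bar>t\<bar> / 2"
      proof -
        have "\<rho> ^ 4 \<le> 2 * \<bar>t\<bar>" using \<rho>4 True tt by simp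
        moreover have "8 * \<eta> \<le> 1 / 4" using D by (simp add: \<eta>_def field_simps)
        ultimately have "8 * \<eta> * \<rho> ^ 4 \<le> 1 / 4 * (2 * \<bar>t\<bar>)"
          using \<rho> by (intro mult_mono) auto
        then show ?thesis by simp
      qed
      ultimately show ?thesis by (intro bexI[of _ a]) auto
    next
      case False
      \<comment> \<open>The horizontal centre is chosen along the largest coordinate of z, with its
        sign, so that the inner product with z is at least |z|/D.\<close>
      obtain i where i: "m \<le> D * \<bar>z $ i\<bar>"
      proof -
        have "Max (range (\<lambda>j. \<bar>z $ j\<bar>)) \<in> range (\<lambda>j. \<bar>z $ j\<bar>)" by (intro Max_in) auto
        then obtain i where "Max (range (\<lambda>j. \<bar>z $ j\<bar>)) = \<bar>z $ i\<bar>" by blast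
        moreover have "\<bar>z $ j\<bar> \<le> Max (range (\<lambda>j. \<bar>z $ j\<bar>))" for j by (intro Max_ge) auto
        ultimately have "\<bar>z $ j\<bar> \<le> \<bar>z $ i\<bar>" for j by simp
        then have "(\<Sum>j\<in>UNIV. \<bar>z $ j\<bar>) \<le> D * \<bar>z $ i\<bar>"
          unfolding D_def by (intro sum_bounded_above) auto
        then have "m \<le> D * \<bar>z $ i\<bar>" using norm_le_l1_cart[of z] unfolding m_def by linarith
        then show ?thesis by (rule that)
      qed
      define y where "y = \<bar>z $ i\<bar>"
      have y: "y \<le> m" "0 \<le> y" "m \<le> D * y" using i by (auto simp: y_def m_def component_le_norm_cart)
      define \<sigma> :: real where "\<sigma> = (if 0 \<le> z $ i then 1 else - 1)"
      have \<sigma>1: "\<bar>\<sigma>\<bar> = 1" by (simp add: \<sigma>_def)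
      define a :: "'n heis" where "a = (axis i \<sigma>, 0)"
      define W where "W = heis_J (axis i \<sigma>) \<bullet> z"
      have m1: "m \<le> 1 / 22" using m\<delta> \<delta> by simp
      have "m ^ 4 \<le> m ^ 1" using m0 m1 by (intro power_decreasing) auto
      then have tm: "\<bar>t\<bar> \<le> m" using False by simp
      have Wm: "\<bar>W\<bar> \<le> m"
        using Cauchy_Schwarz_ineq2[of "heis_J (axis i \<sigma>)" z] by (simp add: W_def m_def norm_axis_real \<sigma>1)
      have "a \<in> T" by (auto simp: a_def T_def \<sigma>_def)
      moreover have "norm (fst (heis_mult (- a) x)) ^ 4 + (snd (heis_mult (- a) x))\<^sup>2 = (1 - 2 * y + m\<^sup>2)\<^sup>2 + (t - 2 * W)\<^sup>2"
      proof -
        have "norm (fst (heis_mult (- a) x)) ^ 4 = ((norm (z - axis i \<sigma>))\<^sup>2)\<^sup>2"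
          by (simp add: heis_mult_eq a_def z_def power_mult[symmetric])
        also have "(norm (z - axis i \<sigma>))\<^sup>2 = 1 - 2 * y + m\<^sup>2"
          unfolding power2_norm_eq_inner m_def y_def
          by (simp add: inner_diff_left inner_diff_right inner_axis inner_axis' \<sigma>_def)
        finally show ?thesis by (simp add: heis_mult_eq a_def t_def W_def z_def)
      qed
      \<comment> \<open>Expanding yields the linear gain 4 * y against quadratic terms. Because |t|
        and |W| are at most m, these sum to at most \<open>17 * m^2\<close>, hence to at most 17 * y
        / 11.\<close>
      moreover have "(1 - 2 * y + m\<^sup>2)\<^sup>2 + (t - 2 * W)\<^sup>2 \<le> 1 - 2 * y"
      proof -
        have mm: "m\<^sup>2 \<le> 1" using m0 m1 by (simp add: power_le_one)
        have y2: "y\<^sup>2 \<le> m\<^sup>2" using y by (intro power_mono) auto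
        have t2: "t\<^sup>2 \<le> m\<^sup>2" "W\<^sup>2 \<le> m\<^sup>2" using power_mono[OF tm, of 2] power_mono[OF Wm, of 2] by auto
        have "m * m \<le> (D * y) * (1 / (11 * D))" using y m\<delta> m0 D by (intro mult_mono) (auto simp: \<delta>_def)
        also have "\<dots> = y / 11" using D by simp
        finally have m2: "m\<^sup>2 \<le> y / 11" by (simp add: power2_eq_square)
        have "m\<^sup>2 * m\<^sup>2 \<le> m\<^sup>2 * 1" using mm by (intro mult_left_mono) auto
        moreover have "0 \<le> y * m\<^sup>2" using y by simp
        moreover have "(1 - 2 * y + m\<^sup>2)\<^sup>2 = 1 - 4 * y + 4 * y\<^sup>2 + 2 * m\<^sup>2 - 4 * (y * m\<^sup>2) + m\<^sup>2 * m\<^sup>2"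
          by (simp add: power2_eq_square algebra_simps)
        moreover have "(t - 2 * W)\<^sup>2 \<le> 2 * t\<^sup>2 + 8 * W\<^sup>2"
          using zero_le_power2[of "t + 2 * W"] by (simp add: power2_eq_square algebra_simps)
        ultimately show ?thesis using y2 t2 m2 y by linarith
      qed
      moreover have "8 * (\<eta> * \<rho> ^ 4) \<le> 2 * y"
      proof -
        have "t\<^sup>2 \<le> m ^ 4"
        proof -
          have "t\<^sup>2 = \<bar>t\<bar> * \<bar>t\<bar>" by (simp add: power2_eq_square)
          also have "\<dots> \<le> m ^ 4 * 1" using False tm m1 by (intro mult_mono) auto
          finally show ?thesis by simp
        qed
        moreover have "m ^ 4 \<le> m * (1 / 22)"
        proof -
          have "m ^ 3 \<le> m ^ 1" using m0 m1 by (intro power_decreasing) auto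
          then have "m * m ^ 3 \<le> m * (1 / 22)" using m0 m1 by (intro mult_left_mono) auto
          then show ?thesis by (simp add: power_Suc[symmetric] del: power_Suc)
        qed
        ultimately have "\<rho> ^ 4 \<le> D * y" using \<rho>4 y m0 by linarith
        then have "8 * \<eta> * \<rho> ^ 4 \<le> 8 * \<eta> * (D * y)" using \<eta> by (intro mult_left_mono) auto
        also have "\<dots> \<le> 2 * y" using D y by (simp add: \<eta>_def)
        finally show ?thesis by simp
      qed
      ultimately show ?thesis by (intro bexI[of _ a]) auto
    qed
    then obtain a where a: "a \<in> T" "norm (fst (heis_mult (- a) x)) ^ 4 + (snd (heis_mult (- a) x))\<^sup>2 \<le> 1 - 8 * (\<eta> * \<rho> ^ 4)"
      by blast
    define h where "h = \<eta> * \<rho> ^ 4"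
    have h: "0 < h" "h \<le> 1"
    proof -
      show "0 < h" using \<eta> \<rho> by (simp add: h_def)
      have "\<rho> ^ 4 \<le> 1" using \<rho> x \<delta> by (intro power_le_one) auto
      then show "h \<le> 1" using \<eta> \<rho> mult_mono[of \<eta> 1 "\<rho> ^ 4" 1] by (simp add: h_def)
    qed
    \<comment> \<open>A surplus of 8 * h in the fourth power allows the radius to shrink by h, with
      strict inequality: \<open>(1 - h)^4\<close> is at least 1 - 4 * h.\<close>
    have "1 + real 4 * (- h) \<le> (1 + (- h)) ^ 4" using h by (intro Bernoulli_inequality) auto
    then have "norm (fst (heis_mult (- a) x)) ^ 4 + (snd (heis_mult (- a) x))\<^sup>2 < (1 - h) ^ 4"
      using a(2) h by (simp add: h_def)
    then have "x \<in> heis_ball a (1 - h)"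
      unfolding heis_ball_iff heis_dist_eq' using h by (subst heis_norm_less_iff) auto
    then show "\<exists>a\<in>T. x \<in> heis_ball a (1 - \<eta> * \<rho> ^ 4)" using a(1) by (auto simp: h_def)
  qed
qed

section \<open>Radial estimates for functions in the source spaces\<close>

text \<open>Solving the defining inequality of the norm for the integral requires the mass of the
  ball to be invertible. It is always positive; it must also be finite unless its exponent is 0,
  because otherwise the ball contributes 0 to the norm and gives no information.\<close>

lemma morrey_norm_ball_le:
  fixes f :: "'n::finite heis \<Rightarrow> real" and p l \<alpha> g N :: real
  assumes p: "1 < p" and l: "- 1 / p \<le> l" and N: "0 \<le> N" and f0: "\<And>x. 0 \<le> f x"
    and le: "source_norm p l \<alpha> g f \<le> ennreal N"
    and R: "0 < R"
    and W: "p * l + 1 = 0 \<or> power_mass (heis_ball a R) \<alpha> < \<infinity>"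
  shows "source_mass f p g (heis_ball a R)
    \<le> ennreal (N powr p) * epowr (power_mass (heis_ball a R) \<alpha>) (p * l + 1)"
proof -
  define V where "V = power_mass (heis_ball a R) \<alpha>"
  define I where "I = source_mass f p g (heis_ball a R)"
  define k where "k = l + 1 / p"
  have k: "0 \<le> k" "k * p = p * l + 1" using p l by (auto simp: k_def field_simps)
  have I: "(\<integral>\<^sup>+x\<in>heis_ball a R. epowr (ennreal \<bar>f x\<bar>) p * ennreal (heis_norm x powr g) \<partial>lborel) = I"
    unfolding I_def using p f0 by (intro nn_integral_cong) (simp add: epowr_ennreal ennreal_mult')
  have "epowr V (- k) * epowr I (1 / p) \<le> source_norm p l \<alpha> g f"
    unfolding morrey_norm_def by (rule SUP_upper2[of "(a, R)"]) (use R I in \<open>auto simp: V_def k_def\<close>)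
  also note le
  finally have le': "epowr V (- k) * epowr I (1 / p) \<le> ennreal N" .
  have one: "epowr V k * epowr V (- k) = 1"
  proof (cases "k = 0")
    case False
    then have "p * l + 1 \<noteq> 0" using k p by auto
    then have "V < top" using W by (simp add: V_def)
    moreover have "0 < V" unfolding V_def by (rule nn_integral_heis_ball_powr_pos[OF R])
    ultimately obtain v where "V = ennreal v" "0 < v"
      by (cases V) (auto simp: less_le)
    then show ?thesis by (simp add: epowr_ennreal_pos ennreal_mult'[symmetric] powr_add[symmetric])
  qed simp
  have "epowr I (1 / p) = epowr V k * epowr V (- k) * epowr I (1 / p)" by (simp add: one)
  also have "\<dots> \<le> epowr V k * ennreal N" unfolding mult.assoc by (intro mult_left_mono le') auto
  finally have "epowr (epowr I (1 / p)) p \<le> epowr (epowr V k * ennreal N) p" using p by (intro epowr_mono) auto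
  then have "I \<le> epowr V (p * l + 1) * ennreal (N powr p)"
    using p k N by (simp add: epowr_mult epowr_epowr epowr_ennreal)
  then show ?thesis by (simp add: I_def V_def mult.commute)
qed

text \<open>Dilating the finite family of covering balls by r'/\<delta> covers the annulus. Every
  ball stays away from the origin, so it has finite mass for each \<alpha>, bounded by that of the
  larger annulus on the right. The number of balls is independent of r and r'; only their distance
  from the origin shrinks with r/r'.\<close>

lemma morrey_norm_annulus_le:
  fixes p l :: real
  assumes p: "1 < p" and l: "- 1 / p \<le> l"
  obtains K \<delta> \<eta> where "0 \<le> K" "0 < \<delta>" "0 < \<eta>" "\<eta> < 1"
    "\<And>(f :: 'n::finite heis \<Rightarrow> real) \<alpha> g N r r'. f \<in> borel_measurable borel \<Longrightarrow> (\<And>x. 0 \<le> f x) \<Longrightarrow> 0 \<le> N \<Longrightarrow>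
      source_norm p l \<alpha> g f \<le> ennreal N \<Longrightarrow>
      0 < r \<Longrightarrow> r \<le> r' \<Longrightarrow>
      (source_mass f p g (heis_annulus r r'))
        \<le> ennreal (K * N powr p) * epowr (\<integral>\<^sup>+x\<in>(heis_annulus (r' * (\<eta> * (r / r') ^ 4)) (\<delta> * r') :: 'n heis set).
             ennreal (heis_norm x powr \<alpha>) \<partial>lborel) (p * l + 1)"
proof (rule heis_unit_balls_cover)
  fix T :: "'n heis set" and \<delta> \<eta>
  assume T: "finite T" and \<delta>: "0 < \<delta>" and \<eta>: "0 < \<eta>" "\<eta> < 1"
    and cover: "\<And>\<rho> x. 0 < \<rho> \<Longrightarrow> \<rho> \<le> heis_norm x \<Longrightarrow> heis_norm x \<le> \<delta> \<Longrightarrow> \<exists>a\<in>T. x \<in> heis_ball a (1 - \<eta> * \<rho> ^ 4)"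
    and away: "\<And>\<rho> a y. a \<in> T \<Longrightarrow> 0 < \<rho> \<Longrightarrow> \<rho> \<le> \<delta> \<Longrightarrow> y \<in> heis_ball a (1 - \<eta> * \<rho> ^ 4) \<Longrightarrow> \<eta> * \<rho> ^ 4 \<le> heis_norm y \<and> heis_norm y \<le> 2"
  have \<theta>: "0 \<le> p * l + 1" using p l by (simp add: field_simps)
  \<comment> \<open>The balls keep the distance \<open>s * \<eta> * \<rho> ^ 4\<close> from the
    origin; with s = r'/\<delta> and \<rho> = \<delta> * r/r' one power of \<delta> cancels. The
    minimum with 1/2 only ensures a value below 1.\<close>
  define \<eta>' where "\<eta>' = min (1 / 2) (\<eta> * \<delta> ^ 3)"
  show thesis
  proof (rule that[of "real (card T)" "2 / \<delta>" \<eta>'])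
    show "0 \<le> real (card T)" "0 < 2 / \<delta>" using \<delta> by simp_all
    show "0 < \<eta>'" "\<eta>' < 1" using \<eta> \<delta> by (auto simp: \<eta>'_def)
    fix f :: "'n heis \<Rightarrow> real" and \<alpha> g N r r' :: real
    assume f [measurable]: "f \<in> borel_measurable borel" and f0: "\<And>x. 0 \<le> f x" and N: "0 \<le> N"
      and le: "source_norm p l \<alpha> g f \<le> ennreal N"
      and r: "0 < r" "r \<le> r'"
    define s where "s = r' / \<delta>"
    define \<rho> where "\<rho> = r / s"
    have s: "0 < s" using r \<delta> by (simp add: s_def)
    have \<rho>: "0 < \<rho>" "\<rho> \<le> \<delta>" using r s \<delta> by (auto simp: \<rho>_def s_def field_simps)
    define R where "R = s * (1 - \<eta> * \<rho> ^ 4)"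
    let ?A = "(heis_annulus (r' * (\<eta>' * (r / r') ^ 4)) (2 / \<delta> * r') :: 'n heis set)"
    define W where "W = power_mass ?A \<alpha>"
    have lower: "0 < r' * (\<eta>' * (r / r') ^ 4)" using r \<open>0 < \<eta>'\<close> by simp
    have W: "W < top"
      using nn_integral_heis_powr_finite[of ?A, OF _ lower, of "2 / \<delta> * r'" \<alpha>] by (auto simp: W_def intro: le_less_trans)
    have dil: "y \<in> heis_ball (heis_dil s a) R \<longleftrightarrow> heis_dil (1 / s) y \<in> heis_ball a (1 - \<eta> * \<rho> ^ 4)" for a y :: "'n heis"
    proof -
      have "heis_dist (heis_dil s a) y = heis_dist (heis_dil s a) (heis_dil s (heis_dil (1 / s) y))" using s by simp
      also have "\<dots> = s * heis_dist a (heis_dil (1 / s) y)" using s by (simp add: heis_dist_dil del: heis_dil_dil)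
      finally show ?thesis using s by (simp add: heis_ball_iff R_def)
    qed
    have sub: "(heis_annulus r r') \<subseteq> (\<Union>a\<in>T. heis_ball (heis_dil s a) R)"
    proof
      fix x :: "'n heis" assume "x \<in> (heis_annulus r r')"
      then have "\<rho> \<le> heis_norm (heis_dil (1 / s) x)" "heis_norm (heis_dil (1 / s) x) \<le> \<delta>"
        using s \<delta> by (auto simp: heis_norm_dil \<rho>_def divide_right_mono) (simp add: s_def field_simps)
      then show "x \<in> (\<Union>a\<in>T. heis_ball (heis_dil s a) R)" using cover[OF \<rho>(1)] by (auto simp: dil)
    qed
    have sub': "heis_ball (heis_dil s a) R \<subseteq> ?A" if a: "a \<in> T" for a
    proof
      fix y assume "y \<in> heis_ball (heis_dil s a) R"
      then have "\<eta> * \<rho> ^ 4 \<le> heis_norm (heis_dil (1 / s) y) \<and> heis_norm (heis_dil (1 / s) y) \<le> 2"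
        by (intro away[OF a \<rho>]) (simp add: dil)
      then have "s * (\<eta> * \<rho> ^ 4) \<le> heis_norm y" "heis_norm y \<le> 2 * s"
        using s by (auto simp: heis_norm_dil field_simps)
      moreover have "r' * (\<eta>' * (r / r') ^ 4) \<le> s * (\<eta> * \<rho> ^ 4)"
      proof -
        have "\<rho> = \<delta> * (r / r')" using r \<delta> by (simp add: \<rho>_def s_def)
        then have "s * (\<eta> * \<rho> ^ 4) = r' / \<delta> * (\<eta> * (\<delta> ^ 4 * (r / r') ^ 4))" by (simp only: s_def power_mult_distrib)
        also have "\<dots> = r' * (\<eta> * \<delta> ^ 3 * (r / r') ^ 4)" using \<delta> by (simp add: power4_eq_xxxx power3_eq_cube)
        finally have eq: "s * (\<eta> * \<rho> ^ 4) = r' * (\<eta> * \<delta> ^ 3 * (r / r') ^ 4)" .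
        show ?thesis unfolding eq using r by (intro mult_left_mono mult_right_mono) (auto simp: \<eta>'_def)
      qed
      ultimately show "y \<in> ?A" by (simp add: s_def)
    qed
    \<comment> \<open>Some ball contains a point of norm r, so it is not empty and its radius must
      be positive.\<close>
    have R: "0 < R"
    proof -
      obtain x :: "'n heis" where "heis_norm x = r" using heis_norm_exists[of r] r by auto
      then have "x \<in> (\<Union>a\<in>T. heis_ball (heis_dil s a) R)" using r by (intro subsetD[OF sub]) simp
      then obtain a where "heis_norm (heis_mult (- x) (heis_dil s a)) < R" by (auto simp: heis_ball_iff heis_dist_eq)
      then show ?thesis by (rule le_less_trans[OF heis_norm_nonneg])
    qed
    have ball: "source_mass f p g (heis_ball (heis_dil s a) R)
        \<le> ennreal (N powr p) * epowr W (p * l + 1)" if a: "a \<in> T" for a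
    proof -
      let ?I = "power_mass (heis_ball (heis_dil s a) R) \<alpha>"
      have IW: "?I \<le> W" unfolding W_def by (rule nn_integral_mono_set[OF sub'[OF a]])
      then have "?I < \<infinity>" using W by (simp add: le_less_trans)
      then have "source_mass f p g (heis_ball (heis_dil s a) R)
        \<le> ennreal (N powr p) * epowr ?I (p * l + 1)"
        by (intro morrey_norm_ball_le[OF p l N f0 le R]) auto
      also have "\<dots> \<le> ennreal (N powr p) * epowr W (p * l + 1)"
        using \<theta> IW by (intro mult_left_mono epowr_mono) auto
      finally show ?thesis .
    qed
    have "source_mass f p g (heis_annulus r r')
       \<le> (\<integral>\<^sup>+x. (\<Sum>a\<in>T. ennreal (f x powr p * heis_norm x powr g) * indicator (heis_ball (heis_dil s a) R) x) \<partial>lborel)"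
    proof (intro nn_integral_mono)
      fix x :: "'n heis"
      show "ennreal (f x powr p * heis_norm x powr g) * indicator (heis_annulus r r') x
        \<le> (\<Sum>a\<in>T. ennreal (f x powr p * heis_norm x powr g) * indicator (heis_ball (heis_dil s a) R) x)"
      proof (cases "x \<in> (heis_annulus r r')")
        case True
        then obtain a where a: "a \<in> T" "x \<in> heis_ball (heis_dil s a) R" using sub by auto
        have "ennreal (f x powr p * heis_norm x powr g) * indicator (heis_ball (heis_dil s a) R) x
          \<le> (\<Sum>a\<in>T. ennreal (f x powr p * heis_norm x powr g) * indicator (heis_ball (heis_dil s a) R) x)"
          using a T by (intro member_le_sum) auto
        then show ?thesis using a True by simp
      qed simp
    qed
    also have "\<dots> = (\<Sum>a\<in>T. source_mass f p g (heis_ball (heis_dil s a) R))"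
      by (intro nn_integral_sum) measurable
    also have "\<dots> \<le> (\<Sum>a\<in>T. ennreal (N powr p) * epowr W (p * l + 1))" by (intro sum_mono ball)
    also have "\<dots> = ennreal (real (card T) * N powr p) * epowr W (p * l + 1)"
      by (simp add: ennreal_mult' ennreal_of_nat_eq_real_of_nat mult.assoc)
    finally show "source_mass f p g (heis_annulus r r')
       \<le> ennreal (real (card T) * N powr p) * epowr (power_mass ?A \<alpha>) (p * l + 1)"
      unfolding W_def .
  qed
qed

text \<open>For r' = e * r the annulus that contains the covering balls has radii proportional to r,
  so its mass is at most a constant times \<open>r^(Q + \<alpha>)\<close>, whatever the sign of the
  exponent.\<close>

lemma morrey_norm_shell_le:
  fixes p l \<alpha> g :: real
  assumes p: "1 < p" and l: "- 1 / p < l"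
  obtains K where "0 \<le> K"
    "\<And>(f :: 'n::finite heis \<Rightarrow> real) N r. f \<in> borel_measurable borel \<Longrightarrow> (\<And>x. 0 \<le> f x) \<Longrightarrow> 0 \<le> N \<Longrightarrow>
      source_norm p l \<alpha> g f \<le> ennreal N \<Longrightarrow> 0 < r \<Longrightarrow>
      (source_mass f p g (heis_annulus r (exp 1 * r)))
        \<le> ennreal (K * N powr p * r powr ((p * l + 1) * (hom_dim TYPE('n) + \<alpha>)))"
proof (rule morrey_norm_annulus_le[OF p less_imp_le[OF l]])
  fix K \<delta> \<eta> assume K: "0 \<le> K" and \<delta>: "0 < \<delta>" and \<eta>: "0 < \<eta>" "\<eta> < 1"
    and ann: "\<And>(f :: 'n::finite heis \<Rightarrow> real) \<alpha> g N r r'. f \<in> borel_measurable borel \<Longrightarrow> (\<And>x. 0 \<le> f x) \<Longrightarrow> 0 \<le> N \<Longrightarrow>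
      source_norm p l \<alpha> g f \<le> ennreal N \<Longrightarrow>
      0 < r \<Longrightarrow> r \<le> r' \<Longrightarrow>
      (source_mass f p g (heis_annulus r r'))
        \<le> ennreal (K * N powr p) * epowr (\<integral>\<^sup>+x\<in>(heis_annulus (r' * (\<eta> * (r / r') ^ 4)) (\<delta> * r') :: 'n heis set).
             ennreal (heis_norm x powr \<alpha>) \<partial>lborel) (p * l + 1)"
  let ?Q = "hom_dim TYPE('n)"
  define \<theta> where "\<theta> = p * l + 1"
  have \<theta>: "0 < \<theta>" using p l by (simp add: \<theta>_def field_simps)
  define c1 where "c1 = exp 1 * (\<eta> * (1 / exp 1) ^ 4)"
  define c2 where "c2 = \<delta> * exp (1 :: real)"
  have c: "0 < c1" "0 < c2" using \<eta> \<delta> by (auto simp: c1_def c2_def)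
  define D where "D = max (c1 powr \<alpha>) (c2 powr \<alpha>) * (c2 + c1) ^ ?Q * unit_ball_vol TYPE('n)"
  have D: "0 \<le> D" using c unit_ball_vol_nonneg[where ?'n = 'n] by (auto simp: D_def le_max_iff_disj)
  show thesis
  proof (rule that[of "K * D powr \<theta>"])
    show "0 \<le> K * D powr \<theta>" using K by simp
    fix f :: "'n heis \<Rightarrow> real" and N r :: real
    assume f: "f \<in> borel_measurable borel" "\<And>x. 0 \<le> f x" and N: "0 \<le> N"
      and le: "source_norm p l \<alpha> g f \<le> ennreal N"
      and r: "0 < r"
    let ?A = "(heis_annulus (exp 1 * r * (\<eta> * (r / (exp 1 * r)) ^ 4)) (\<delta> * (exp 1 * r)) :: 'n heis set)"
    have A: "?A = (heis_annulus (r * c1) (r * c2))"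
      using r by (auto simp: c1_def c2_def mult_ac power_divide)
    have "power_mass ?A \<alpha>
      \<le> ennreal (max ((r * c1) powr \<alpha>) ((r * c2) powr \<alpha>) * (\<bar>r * c2\<bar> + r * c1) ^ ?Q * unit_ball_vol TYPE('n))"
      unfolding A using r c by (intro nn_integral_heis_powr_finite) auto
    also have "max ((r * c1) powr \<alpha>) ((r * c2) powr \<alpha>) * (\<bar>r * c2\<bar> + r * c1) ^ ?Q * unit_ball_vol TYPE('n) = D * r powr (?Q + \<alpha>)"
    proof -
      have "max ((r * c1) powr \<alpha>) ((r * c2) powr \<alpha>) = r powr \<alpha> * max (c1 powr \<alpha>) (c2 powr \<alpha>)"
        using r c by (simp add: powr_mult max_mult_distrib_left)
      moreover have "(\<bar>r * c2\<bar> + r * c1) ^ ?Q = r powr ?Q * (c2 + c1) ^ ?Q"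
        using r c by (simp add: powr_realpow power_mult_distrib[symmetric] distrib_left)
      ultimately show ?thesis by (simp add: D_def powr_add mult_ac)
    qed
    finally have W: "power_mass ?A \<alpha> \<le> ennreal (D * r powr (?Q + \<alpha>))" .
    have "source_mass f p g (heis_annulus r (exp 1 * r))
      \<le> ennreal (K * N powr p) * epowr (power_mass ?A \<alpha>) \<theta>"
      unfolding \<theta>_def by (rule ann[OF f N le r]) (use r in simp)
    also have "\<dots> \<le> ennreal (K * N powr p) * epowr (ennreal (D * r powr (?Q + \<alpha>))) \<theta>"
      using \<theta> W by (intro mult_left_mono epowr_mono) auto
    also have "\<dots> = ennreal (K * D powr \<theta> * N powr p * r powr (\<theta> * (?Q + \<alpha>)))"
      using \<theta> D K r by (simp add: epowr_ennreal powr_mult powr_powr ennreal_mult'[symmetric] mult_ac)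
    finally show "source_mass f p g (heis_annulus r (exp 1 * r))
      \<le> ennreal (K * D powr \<theta> * N powr p * r powr ((p * l + 1) * (?Q + \<alpha>)))" unfolding \<theta>_def .
  qed
qed

text \<open>For \<alpha> = -Q the mass of the larger annulus is the logarithm of the ratio of its
  radii. The fourth power of r/r' in the inner radius therefore costs just a factor 4, and the bound
  is linear in 1 + ln (r'/r) before the power is taken. This is what the polynomial distance of the
  covering balls is for.\<close>

lemma morrey_norm_annulus_log_le:
  fixes p l g :: real
  assumes p: "1 < p" and l: "- 1 / p < l"
  obtains K where "0 \<le> K"
    "\<And>(f :: 'n::finite heis \<Rightarrow> real) N r r'. f \<in> borel_measurable borel \<Longrightarrow> (\<And>x. 0 \<le> f x) \<Longrightarrow> 0 \<le> N \<Longrightarrow>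
      source_norm p l (- real (hom_dim TYPE('n))) g f \<le> ennreal N \<Longrightarrow>
      0 < r \<Longrightarrow> r \<le> r' \<Longrightarrow>
      (source_mass f p g (heis_annulus r r'))
        \<le> ennreal (K * N powr p * (1 + ln (r' / r)) powr (p * l + 1))"
proof (rule morrey_norm_annulus_le[OF p less_imp_le[OF l]])
  fix K \<delta> \<eta> assume K: "0 \<le> K" and \<delta>: "0 < \<delta>" and \<eta>: "0 < \<eta>" "\<eta> < 1"
    and ann: "\<And>(f :: 'n::finite heis \<Rightarrow> real) \<alpha> g N r r'. f \<in> borel_measurable borel \<Longrightarrow> (\<And>x. 0 \<le> f x) \<Longrightarrow> 0 \<le> N \<Longrightarrow>
      source_norm p l \<alpha> g f \<le> ennreal N \<Longrightarrow>
      0 < r \<Longrightarrow> r \<le> r' \<Longrightarrow>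
      (source_mass f p g (heis_annulus r r'))
        \<le> ennreal (K * N powr p) * epowr (\<integral>\<^sup>+x\<in>(heis_annulus (r' * (\<eta> * (r / r') ^ 4)) (\<delta> * r') :: 'n heis set).
             ennreal (heis_norm x powr \<alpha>) \<partial>lborel) (p * l + 1)"
  let ?Q = "hom_dim TYPE('n)"
  define \<theta> where "\<theta> = p * l + 1"
  have \<theta>: "0 < \<theta>" using p l by (simp add: \<theta>_def field_simps)
  define D where "D = omega_Q TYPE('n) * (\<bar>ln (max 1 \<delta> / \<eta>)\<bar> + 4)"
  have om: "0 < omega_Q TYPE('n)" by (rule omega_Q_pos)
  have D: "0 \<le> D" using om by (simp add: D_def)
  show thesis
  proof (rule that[of "K * D powr \<theta>"])
    show "0 \<le> K * D powr \<theta>" using K by simp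
    fix f :: "'n heis \<Rightarrow> real" and N r r' :: real
    assume f: "f \<in> borel_measurable borel" "\<And>x. 0 \<le> f x" and N: "0 \<le> N"
      and le: "source_norm p l (- real (hom_dim TYPE('n))) g f \<le> ennreal N"
      and r: "0 < r" "r \<le> r'"
    \<comment> \<open>An outer radius of at least r' is above the inner one, as the logarithmic
      formula for the mass demands.\<close>
    let ?s = "r' * (\<eta> * (r / r') ^ 4)" and ?t = "max 1 \<delta> * r'"
    have rr: "0 < r / r'" "r / r' \<le> 1" "0 < r'" using r by auto
    have s: "0 < ?s" using rr \<eta> by (intro mult_pos_pos zero_less_power) auto
    have L: "0 \<le> ln (r' / r)" using r by simp
    have st: "?s \<le> ?t"
    proof -
      have "(r / r') ^ 4 \<le> 1" using rr by (intro power_le_one) auto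
      then have "\<eta> * (r / r') ^ 4 \<le> max 1 \<delta> * 1" using \<eta> rr by (intro mult_mono) auto
      then show ?thesis using rr(3) by (simp add: mult.commute)
    qed
    have "power_mass (heis_annulus ?s (\<delta> * r') :: 'n heis set) (- real ?Q)
       \<le> power_mass (heis_annulus ?s ?t :: 'n heis set) (- real ?Q)"
    proof (intro nn_integral_mono_set Collect_mono impI conjI)
      fix x :: "'n heis" assume "?s \<le> heis_norm x \<and> heis_norm x \<le> \<delta> * r'"
      moreover have "\<delta> * r' \<le> ?t" using rr(3) by (intro mult_right_mono) auto
      ultimately show "?s \<le> heis_norm x" "heis_norm x \<le> ?t" by auto
    qed
    also have "\<dots> = ennreal (omega_Q TYPE('n) * ln (?t / ?s))" by (rule nn_integral_heis_powr_annulus[OF s st])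
    also have "\<dots> \<le> ennreal (D * (1 + ln (r' / r)))"
    proof (intro ennreal_leI)
      have "?t / ?s = max 1 \<delta> / \<eta> * (r' / r) ^ 4" using rr \<eta> r by (simp add: field_simps)
      then have "ln (?t / ?s) = ln (max 1 \<delta> / \<eta> * (r' / r) ^ 4)" by (simp only:)
      also have "\<dots> = ln (max 1 \<delta> / \<eta>) + 4 * ln (r' / r)"
        using rr r \<eta> by (subst ln_mult) (auto simp: ln_realpow less_max_iff_disj)
      also have "\<dots> \<le> (\<bar>ln (max 1 \<delta> / \<eta>)\<bar> + 4) * (1 + ln (r' / r))"
      proof -
        define x y where "x = ln (max 1 \<delta> / \<eta>)" and "y = ln (r' / r)"
        have "0 \<le> \<bar>x\<bar> * y" using L by (simp add: y_def)
        moreover have "(\<bar>x\<bar> + 4) * (1 + y) = \<bar>x\<bar> + 4 + \<bar>x\<bar> * y + 4 * y" by (simp add: algebra_simps)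
        ultimately show ?thesis unfolding x_def[symmetric] y_def[symmetric] by linarith
      qed
      finally have "omega_Q TYPE('n) * ln (?t / ?s) \<le> omega_Q TYPE('n) * ((\<bar>ln (max 1 \<delta> / \<eta>)\<bar> + 4) * (1 + ln (r' / r)))"
        using om by (intro mult_left_mono) auto
      then show "omega_Q TYPE('n) * ln (?t / ?s) \<le> D * (1 + ln (r' / r))" by (simp only: D_def mult.assoc)
    qed
    finally have W: "power_mass (heis_annulus ?s (\<delta> * r') :: 'n heis set) (- real ?Q)
      \<le> ennreal (D * (1 + ln (r' / r)))" .
    have "source_mass f p g (heis_annulus r r')
      \<le> ennreal (K * N powr p) * epowr (power_mass (heis_annulus ?s (\<delta> * r') :: 'n heis set) (- real ?Q)) \<theta>"
      unfolding \<theta>_def by (rule ann[OF f N le r])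
    also have "\<dots> \<le> ennreal (K * N powr p) * epowr (ennreal (D * (1 + ln (r' / r)))) \<theta>"
      using \<theta> W by (intro mult_left_mono epowr_mono) auto
    also have "\<dots> = ennreal (K * D powr \<theta> * N powr p * (1 + ln (r' / r)) powr \<theta>)"
      using \<theta> D K L by (simp add: epowr_ennreal powr_mult ennreal_mult'[symmetric] mult_ac)
    finally show "source_mass f p g (heis_annulus r r')
      \<le> ennreal (K * D powr \<theta> * N powr p * (1 + ln (r' / r)) powr (p * l + 1))" unfolding \<theta>_def .
  qed
qed

section \<open>Weighted mass of balls\<close>

text \<open>On the shell of p the weight is comparable to \<open>|p|^\<alpha>\<close>, so the
  density of balls gives a mass of order \<open>|p|^(Q + \<alpha>)\<close> around every point of the
  ball, even if p is close to the boundary.\<close>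

lemma heis_ball_shell_mass:
  fixes \<alpha> :: real
  obtains c where "0 < c"
    "\<And>(a :: 'n::finite heis) R p. p \<in> heis_ball a R \<Longrightarrow> p \<noteq> 0 \<Longrightarrow> heis_norm p \<le> 5 * R \<Longrightarrow>
      ennreal (c * heis_norm p powr (hom_dim TYPE('n) + \<alpha>))
        \<le> power_mass (heis_ball a R \<inter> (heis_annulus (heis_norm p / 2) (2 * heis_norm p))) \<alpha>"
proof (rule heis_ball_density)
  fix c assume c: "0 < c" and den: "\<And>(a :: 'n::finite heis) R p. p \<in> heis_ball a R \<Longrightarrow> p \<noteq> 0 \<Longrightarrow> heis_norm p \<le> 5 * R \<Longrightarrow>
      ennreal (c * heis_norm p ^ hom_dim TYPE('n))
        \<le> emeasure lborel (heis_ball a R \<inter> (heis_annulus (heis_norm p / 2) (2 * heis_norm p)))"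
  let ?Q = "hom_dim TYPE('n)"
  define k where "k = min ((1 / 2) powr \<alpha>) (2 powr \<alpha>)"
  have k: "0 < k" by (simp add: k_def)
  show thesis
  proof (rule that[of "k * c"])
    show "0 < k * c" using k c by simp
    fix a p :: "'n heis" and R assume p: "p \<in> heis_ball a R" "p \<noteq> 0" "heis_norm p \<le> 5 * R"
    define r where "r = heis_norm p"
    have r: "0 < r" using p by (simp add: r_def)
    let ?S = "heis_ball a R \<inter> (heis_annulus (r / 2) (2 * r))"
    have [measurable]: "?S \<in> sets borel" by measurable
    have "ennreal (k * c * r powr (?Q + \<alpha>)) = ennreal (k * r powr \<alpha>) * ennreal (c * r ^ ?Q)"
      using k c r by (simp add: ennreal_mult'[symmetric] powr_add powr_realpow mult_ac)
    also have "\<dots> \<le> ennreal (k * r powr \<alpha>) * emeasure lborel ?S"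
      using den[OF p] by (intro mult_left_mono) (auto simp: r_def)
    also have "\<dots> = (\<integral>\<^sup>+x. ennreal (k * r powr \<alpha>) * indicator ?S x \<partial>lborel)"
      by (subst nn_integral_cmult_indicator) auto
    also have "\<dots> \<le> power_mass ?S \<alpha>"
    proof (intro nn_integral_mono)
      fix x :: "'n heis"
      show "ennreal (k * r powr \<alpha>) * indicator ?S x \<le> ennreal (heis_norm x powr \<alpha>) * indicator ?S x"
      proof (cases "x \<in> ?S")
        case True
        have "min ((r / 2) powr \<alpha>) ((2 * r) powr \<alpha>) \<le> heis_norm x powr \<alpha>"
          using True r by (intro powr_ge_min) auto
        moreover have "min ((r / 2) powr \<alpha>) ((2 * r) powr \<alpha>) = k * r powr \<alpha>"
        proof -
          have "(r / 2) powr \<alpha> = (1 / 2) powr \<alpha> * r powr \<alpha>" using r by (simp add: powr_divide)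
          moreover have "(2 * r) powr \<alpha> = 2 powr \<alpha> * r powr \<alpha>" using r by (simp add: powr_mult)
          ultimately show ?thesis by (simp add: k_def min_mult_distrib_right)
        qed
        ultimately show ?thesis using True by (simp add: ennreal_leI)
      qed simp
    qed
    finally show "ennreal (k * c * heis_norm p powr (?Q + \<alpha>))
        \<le> power_mass (heis_ball a R \<inter> (heis_annulus (heis_norm p / 2) (2 * heis_norm p))) \<alpha>"
      unfolding r_def .
  qed
qed

text \<open>The curve \<open>heis_mult a (heis_dil s (heis_mult (- a) p))\<close>, 0 \<le> s \<le>
  1, joins the centre to p, and its distance from the centre is s times that of p. Connectedness is
  wanted because it makes the norms of the points of a ball fill an interval.\<close>

lemma connected_heis_ball: "connected (heis_ball (a :: 'n::finite heis) R)"
proof (cases "0 < R")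
  case True
  define P where "P p = (\<lambda>s. heis_mult a (heis_dil s (heis_mult (- a) p))) ` {0..1}" for p
  have dist: "heis_dist a (heis_mult a (heis_dil s (heis_mult (- a) p))) = \<bar>s\<bar> * heis_dist a p" for s p
  proof -
    have "heis_dist a (heis_mult a (heis_dil s (heis_mult (- a) p))) = heis_dist (heis_mult a 0) (heis_mult a (heis_dil s (heis_mult (- a) p)))"
      by (simp add: heis_mult_zero)
    also have "\<dots> = \<bar>s\<bar> * heis_dist a p" 
      unfolding heis_dist_left_mult heis_dist_eq'[of a p] by (simp add: heis_norm_dil)
    finally show ?thesis .
  qed
  have a: "a \<in> P p" for p
    unfolding P_def by (rule image_eqI[of _ _ 0]) (simp_all add: heis_dil_def heis_mult_eq)
  have p: "p \<in> P p" for p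
    unfolding P_def by (rule image_eqI[of _ _ 1]) simp_all
  have sub: "P p \<subseteq> heis_ball a R" if p: "p \<in> heis_ball a R" for p
  proof
    fix x assume "x \<in> P p"
    then obtain s where s: "0 \<le> s" "s \<le> 1" "x = heis_mult a (heis_dil s (heis_mult (- a) p))" by (auto simp: P_def)
    have "heis_dist a x = s * heis_dist a p" using s by (simp add: dist)
    also have "\<dots> \<le> 1 * heis_dist a p" using s by (intro mult_right_mono) (auto simp: heis_dist_eq)
    also have "\<dots> < R" using p by (simp add: heis_ball_iff)
    finally show "x \<in> heis_ball a R" by (simp add: heis_ball_iff)
  qed
  have "heis_ball a R = \<Union> (P ` heis_ball a R)" using p sub by blast
  moreover have "connected (\<Union> (P ` heis_ball a R))"
  proof (rule connected_Union)
    fix S assume "S \<in> P ` heis_ball a R"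
    then show "connected S" unfolding P_def
      by (auto intro!: connected_continuous_image continuous_intros)
  next
    show "\<Inter> (P ` heis_ball a R) \<noteq> {}" using a by blast
  qed
  ultimately show ?thesis by simp
next
  case False
  then have "x \<notin> heis_ball a R" for x
    using heis_norm_nonneg[of "heis_mult (- x) a"] unfolding heis_ball_iff heis_dist_eq by linarith
  then have "heis_ball a R = {}" by blast
  then show ?thesis by simp
qed

text \<open>For the weight \<open>|x|^(-Q)\<close> every scale between |p| and |p'| contributes at
  least the same mass c. Shells about the radii \<open>|p| * 5^i\<close> are disjoint, since each
  spans a ratio of 4, so the mass is at least c times their number.\<close>

lemma heis_ball_log_width:
  obtains c where "0 < c"
    "\<And>(a :: 'n::finite heis) R w p p'. (\<And>x. x \<in> heis_ball a R \<Longrightarrow> heis_norm x \<le> 5 * R) \<Longrightarrow>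
      (power_mass (heis_ball a R) (- real (hom_dim TYPE('n)))) = ennreal w \<Longrightarrow> 0 \<le> w \<Longrightarrow>
      p \<in> heis_ball a R \<Longrightarrow> p' \<in> heis_ball a R \<Longrightarrow> p \<noteq> 0 \<Longrightarrow> heis_norm p \<le> heis_norm p' \<Longrightarrow> c \<le> w \<and> c * ln (heis_norm p' / heis_norm p) \<le> w"
proof (rule heis_ball_shell_mass[of "- real (hom_dim TYPE('n))"])
  fix c :: real
  assume c: "0 < c" and mass: "\<And>(a :: 'n::finite heis) R p. p \<in> heis_ball a R \<Longrightarrow> p \<noteq> 0 \<Longrightarrow> heis_norm p \<le> 5 * R \<Longrightarrow>
      ennreal (c * heis_norm p powr (hom_dim TYPE('n) + - real (hom_dim TYPE('n))))
        \<le> power_mass (heis_ball a R \<inter> (heis_annulus (heis_norm p / 2) (2 * heis_norm p))) (- real (hom_dim TYPE('n)))"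
  show thesis
  proof (rule that[of "c / ln 5"])
    have l5: "1 \<le> ln (5 :: real)" using exp_le by (subst ln_ge_iff) auto
    show "0 < c / ln 5" using c l5 by simp
    fix a p p' :: "'n heis" and R w :: real
    assume R: "\<And>x. x \<in> heis_ball a R \<Longrightarrow> heis_norm x \<le> 5 * R"
      and w: "power_mass (heis_ball a R) (- real (hom_dim TYPE('n))) = ennreal w" "0 \<le> w"
      and p: "p \<in> heis_ball a R" "p' \<in> heis_ball a R" "p \<noteq> 0" "heis_norm p \<le> heis_norm p'"
    define r where "r = heis_norm p"
    have r: "0 < r" using p by (simp add: r_def)
    have p'0: "0 < heis_norm p'" using r p(4) unfolding r_def by linarith
    define L where "L = ln (heis_norm p' / r)"
    have L: "0 \<le> L" using p r by (simp add: L_def r_def)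
    \<comment> \<open>The shells are counted from i = 0 to k. The additional one makes up for
      rounding down, and it alone yields the bound c \<le> w when p and p' have equal norms.\<close>
    define k where "k = nat \<lfloor>L / ln 5\<rfloor>"
    have k: "real k \<le> L / ln 5" "L / ln 5 < real k + 1" using L l5 by (auto simp: k_def)
    let ?S = "\<lambda>i :: nat. heis_ball a R \<inter> (heis_annulus (r * 5 ^ i / 2) (2 * (r * 5 ^ i)))"
    have shell: "ennreal c \<le> power_mass (?S i) (- real (hom_dim TYPE('n)))" if i: "i \<le> k" for i
    proof -
      have "r * 5 ^ i \<le> heis_norm p'"
      proof -
        have "real i * ln 5 \<le> L" using i k l5 by (simp add: field_simps) (smt (verit) mult_right_mono of_nat_mono)
        then have "ln (5 ^ i) \<le> ln (heis_norm p' / r)" by (simp add: ln_realpow L_def)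
        then have "5 ^ i \<le> heis_norm p' / r" using r p'0 by (subst (asm) ln_le_cancel_iff) auto
        then show ?thesis using r by (simp add: field_simps)
      qed
      moreover have "r * 1 \<le> r * 5 ^ i" using r by (intro mult_left_mono) auto
      \<comment> \<open>An intermediate value argument: the ball contains a point on each sphere of
        radius \<open>r * 5^i\<close> between those of p and p'.\<close>
      moreover have "connected (heis_norm ` heis_ball a R)"
        by (intro connected_continuous_image connected_heis_ball continuous_intros)
      ultimately have "r * 5 ^ i \<in> heis_norm ` heis_ball a R"
        using connectedD_interval[of "heis_norm ` heis_ball a R" "heis_norm p" "heis_norm p'" "r * 5 ^ i"] p by (auto simp: r_def)
      then obtain x where x: "x \<in> heis_ball a R" "heis_norm x = r * 5 ^ i" by auto
      then have "x \<noteq> 0" using r by auto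
      then show ?thesis using mass[OF x(1) _ R[OF x(1)]] x r by simp
    qed
    have "ennreal (real (Suc k) * c) = (\<Sum>i\<le>k. ennreal c)" using c by (simp add: ennreal_mult' ennreal_of_nat_eq_real_of_nat)
    also have "\<dots> \<le> (\<Sum>i\<le>k. power_mass (?S i) (- real (hom_dim TYPE('n))))"
      by (intro sum_mono shell) simp
    also have "\<dots> = (\<integral>\<^sup>+x. (\<Sum>i\<le>k. ennreal (heis_norm x powr - real (hom_dim TYPE('n))) * indicator (?S i) x) \<partial>lborel)"
      by (intro nn_integral_sum[symmetric]) measurable
    also have "\<dots> \<le> ennreal w" unfolding w(1)[symmetric]
    proof (intro nn_integral_mono)
      fix x :: "'n heis"
      have disj: "i = j" if "x \<in> ?S i" "x \<in> ?S j" for i j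
      proof -
        have *: "\<not> i < j" if "x \<in> ?S i" "x \<in> ?S j" for i j
        proof
          assume "i < j"
          then have "(5 :: real) ^ Suc i \<le> 5 ^ j" by (intro power_increasing) auto
          then have "r * (5 * 5 ^ i) \<le> r * 5 ^ j" using r by (intro mult_left_mono) auto
          then have "5 / 2 * (r * 5 ^ i) \<le> 2 * (r * 5 ^ i)" using that by auto
          moreover have "0 < r * 5 ^ i" using r by simp
          ultimately show False by simp
        qed
        show ?thesis using *[OF that] *[OF that(2,1)] by simp
      qed
      show "(\<Sum>i\<le>k. ennreal (heis_norm x powr - real (hom_dim TYPE('n))) * indicator (?S i) x)
         \<le> ennreal (heis_norm x powr - real (hom_dim TYPE('n))) * indicator (heis_ball a R) x"
      proof (cases "\<exists>i\<le>k. x \<in> ?S i")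
        case True
        then obtain i where i: "i \<le> k" "x \<in> ?S i" by blast
        have "(\<Sum>j\<le>k. ennreal (heis_norm x powr - real (hom_dim TYPE('n))) * indicator (?S j) x)
            = (\<Sum>j\<le>k. if j = i then ennreal (heis_norm x powr - real (hom_dim TYPE('n))) else 0)"
          using disj[OF i(2)] i by (intro sum.cong) (auto simp: indicator_def)
        then show ?thesis using i by simp
      next
        case False
        then have "(\<Sum>i\<le>k. ennreal (heis_norm x powr - real (hom_dim TYPE('n))) * indicator (?S i) x) = 0"
          by (intro sum.neutral) (auto simp: indicator_def)
        then show ?thesis by (simp only: zero_le)
      qed
    qed
    finally have le: "real (Suc k) * c \<le> w" using w(2) by (subst (asm) ennreal_le_iff) auto
    have "c / ln 5 \<le> c" using c l5 by (simp add: field_simps)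
    also have "\<dots> \<le> real (Suc k) * c" using c by (simp add: mult_le_cancel_right1)
    finally have 1: "c / ln 5 \<le> w" using le by simp
    have "c / ln 5 * L = c * (L / ln 5)" by simp
    also have "\<dots> \<le> c * real (Suc k)" using k c by (intro mult_left_mono) auto
    finally have 2: "c / ln 5 * L \<le> w" using le by (simp only: mult.commute)
    from 1 2 show "c / ln 5 \<le> w \<and> c / ln 5 * ln (heis_norm p' / heis_norm p) \<le> w"
      by (simp add: L_def r_def)
  qed
qed

section \<open>Sufficiency\<close>

lemma polya_op_quasi_mono:
  assumes s: "0 \<le> s" and f0: "\<And>y. 0 \<le> f y" and x: "0 < heis_norm x'" "heis_norm x' \<le> heis_norm x" "heis_norm x \<le> exp 1 * heis_norm x'"
    and [measurable]: "f \<in> borel_measurable borel"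
  shows "ennreal (min 1 (exp (real (hom_dim TYPE('n)) - s))) * polya_op s (f :: 'n::finite heis \<Rightarrow> real) x \<le> polya_op s f x'"
proof -
  let ?c = "min 1 (exp (real (hom_dim TYPE('n)) - s))"
  have "ennreal ?c * polya_op s f x = (\<integral>\<^sup>+y. ennreal ?c * ennreal (f y * polya_kernel (hom_dim TYPE('n)) s (heis_norm x) (heis_norm y)) \<partial>lborel)"
    unfolding polya_op_def by (intro nn_integral_cmult[symmetric]) measurable
  also have "\<dots> \<le> polya_op s f x'"
    unfolding polya_op_def
  proof (intro nn_integral_mono)
    fix y :: "'n heis"
    have "f y * (?c * polya_kernel (hom_dim TYPE('n)) s (heis_norm x) (heis_norm y)) \<le> f y * polya_kernel (hom_dim TYPE('n)) s (heis_norm x') (heis_norm y)"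
      by (intro mult_left_mono polya_kernel_quasi_mono x s f0)
    then show "ennreal ?c * ennreal (f y * polya_kernel (hom_dim TYPE('n)) s (heis_norm x) (heis_norm y))
       \<le> ennreal (f y * polya_kernel (hom_dim TYPE('n)) s (heis_norm x') (heis_norm y))"
      by (subst ennreal_mult'[symmetric]) (auto intro!: ennreal_leI simp: mult_ac)
  qed
  finally show ?thesis .
qed

lemma nn_integral_shell_ge:
  fixes g r :: real
  assumes r: "0 < r"
  shows "ennreal (omega_Q TYPE('n::finite) * min 1 (exp (g + hom_dim TYPE('n))) * r powr (g + hom_dim TYPE('n)))
    \<le> (\<integral>\<^sup>+x\<in>(heis_annulus r (exp 1 * r)). ennreal (heis_norm x powr g) \<partial>(lborel :: 'n heis measure))"
proof -
  have "ennreal (omega_Q TYPE('n) * min 1 (exp (g + hom_dim TYPE('n))) * r powr (g + hom_dim TYPE('n)))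
    \<le> (\<integral>\<^sup>+x\<in>{x. heis_norm x < exp 1 * r}. ennreal (annulus_powr g r (exp 1 * r) x) \<partial>(lborel :: 'n heis measure))"
    using r by (intro nn_integral_annulus_powr_ge) auto
  also have "\<dots> \<le> (\<integral>\<^sup>+x\<in>(heis_annulus r (exp 1 * r)). ennreal (heis_norm x powr g) \<partial>(lborel :: 'n heis measure))"
    by (intro nn_integral_mono) (auto simp: annulus_powr_def split: split_indicator)
  finally show ?thesis .
qed

text \<open>The radial bound on one shell controls the mean of the p-th power there, by
  \<open>morrey_norm_shell_le\<close> on dilated shells. Within a shell the operator is almost
  monotone in |x|, so the mean dominates a value at one point, and the mean estimate becomes
  pointwise.\<close>

lemma polya_op_pointwise:
  fixes p l \<alpha> g s b :: real
  assumes b_def: "b = real (hom_dim TYPE('n::finite)) * l - g / p + \<alpha> * (l + 1 / p)"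
    and p: "1 < p" and l: "- 1 / p < l" and s: "0 < b + hom_dim TYPE('n)" "b + hom_dim TYPE('n) < s"
  obtains C where "0 \<le> C"
    "\<And>(f :: 'n heis \<Rightarrow> real) N x. f \<in> borel_measurable borel \<Longrightarrow> (\<And>x. 0 \<le> f x) \<Longrightarrow> 0 \<le> N \<Longrightarrow>
      source_norm p l \<alpha> g f \<le> ennreal N \<Longrightarrow> x \<noteq> 0 \<Longrightarrow>
      epowr (polya_op s f x) p \<le> ennreal (C * N powr p * heis_norm x powr (p * b))"
proof -
  let ?Q = "real (hom_dim TYPE('n))"
  define \<tau> where "\<tau> = (p * l + 1) * (?Q + \<alpha>)"
  have e: "p * b + g = \<tau> - ?Q" using p by (simp add: b_def \<tau>_def field_simps)
  have s0: "0 \<le> s" using s by linarith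
  show thesis
  proof (rule polya_op_radial_bound[OF p s e], rule morrey_norm_shell_le[OF p l, of \<alpha> g, where ?'n = 'n])
    fix K K1 assume K: "0 \<le> K" and rad: "\<And>f I M. f \<in> borel_measurable borel \<Longrightarrow> (\<And>y :: 'n heis. 0 \<le> f y) \<Longrightarrow> I \<in> sets borel \<Longrightarrow>
      (\<And>c. 0 < c \<Longrightarrow> (source_mass f p g {y. heis_norm y / c \<in> I}) \<le> M * ennreal (c powr \<tau>)) \<Longrightarrow>
      (polya_mass s f p g {x. heis_norm x \<in> I}) \<le> ennreal K * M"
    assume K1: "0 \<le> K1" and shell: "\<And>(f :: 'n heis \<Rightarrow> real) N r. f \<in> borel_measurable borel \<Longrightarrow> (\<And>x. 0 \<le> f x) \<Longrightarrow> 0 \<le> N \<Longrightarrow>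
      source_norm p l \<alpha> g f \<le> ennreal N \<Longrightarrow> 0 < r \<Longrightarrow>
      (source_mass f p g (heis_annulus r (exp 1 * r)))
        \<le> ennreal (K1 * N powr p * r powr ((p * l + 1) * (?Q + \<alpha>)))"
    define k0 where "k0 = min 1 (exp (?Q - s))"
    have k0: "0 < k0" by (simp add: k0_def)
    define k1 where "k1 = omega_Q TYPE('n) * min 1 (exp (g + ?Q))"
    have k1: "0 < k1" using omega_Q_pos[where ?'n = 'n] by (simp add: k1_def)
    define C where "C = K * K1 * exp (- (p * b)) / (k0 powr p * k1)"
    show thesis
    proof (rule that[of C])
      show C: "0 \<le> C" using K K1 k0 k1 by (simp add: C_def)
      fix f :: "'n heis \<Rightarrow> real" and N :: real and x :: "'n heis"
      assume f: "f \<in> borel_measurable borel" and f0: "\<And>x. 0 \<le> f x" and N: "0 \<le> N"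
        and le: "source_norm p l \<alpha> g f \<le> ennreal N"
        and x: "x \<noteq> 0"
      \<comment> \<open>The point x is put on the outer sphere of the shell, since the
        quasi-monotonicity bounds the operator at inner points from below by its value further
        out.\<close>
      define r where "r = heis_norm x / exp 1"
      have r: "0 < r" "heis_norm x = exp 1 * r" using x by (simp_all add: r_def)
      let ?A = "(heis_annulus r (exp 1 * r) :: 'n heis set)"
      have A: "?A \<in> sets borel" by measurable
      have "(\<integral>\<^sup>+x\<in>{x. heis_norm x \<in> {r..exp 1 * r}}. epowr (polya_op s f x) p * ennreal (heis_norm x powr g) \<partial>lborel)
         \<le> ennreal K * ennreal (K1 * N powr p * r powr \<tau>)"
      proof (rule rad[OF f f0])
        fix c :: real assume c: "0 < c"
        have "{y :: 'n heis. heis_norm y / c \<in> {r..exp 1 * r}} = (heis_annulus (c * r) (exp 1 * (c * r)))"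
          using c by (auto simp: field_simps)
        then have "(\<integral>\<^sup>+y\<in>{y. heis_norm y / c \<in> {r..exp 1 * r}}. ennreal (f y powr p * heis_norm y powr g) \<partial>lborel)
          \<le> ennreal (K1 * N powr p * (c * r) powr \<tau>)"
          using shell[OF f f0 N le, of "c * r"] c r by (simp add: \<tau>_def)
        also have "\<dots> = ennreal (K1 * N powr p * r powr \<tau>) * ennreal (c powr \<tau>)"
          using c r K1 by (simp add: powr_mult ennreal_mult'[symmetric] mult_ac)
        finally show "(\<integral>\<^sup>+y\<in>{y. heis_norm y / c \<in> {r..exp 1 * r}}. ennreal (f y powr p * heis_norm y powr g) \<partial>lborel)
          \<le> ennreal (K1 * N powr p * r powr \<tau>) * ennreal (c powr \<tau>)" .
      qed simp
      then have up: "polya_mass s f p g ?A \<le> ennreal (K * (K1 * N powr p * r powr \<tau>))"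
        using K by (simp add: ennreal_mult')
      have "epowr (ennreal k0 * polya_op s f x) p * ennreal (k1 * r powr (g + ?Q))
         \<le> epowr (ennreal k0 * polya_op s f x) p * (power_mass ?A g)"
        unfolding k1_def by (intro mult_left_mono nn_integral_shell_ge r(1)) simp
      also have "\<dots> = (\<integral>\<^sup>+x'. epowr (ennreal k0 * polya_op s f x) p * (ennreal (heis_norm x' powr g) * indicator ?A x') \<partial>lborel)"
        using A by (intro nn_integral_cmult[symmetric]) measurable
      also have "\<dots> \<le> polya_mass s f p g ?A"
      proof (intro nn_integral_mono)
        fix x' :: "'n heis"
        show "epowr (ennreal k0 * polya_op s f x) p * (ennreal (heis_norm x' powr g) * indicator ?A x')
          \<le> epowr (polya_op s f x') p * ennreal (heis_norm x' powr g) * indicator ?A x'"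
        proof (cases "x' \<in> ?A")
          case True
          have "ennreal k0 * polya_op s f x \<le> polya_op s f x'"
            unfolding k0_def using True r by (intro polya_op_quasi_mono[OF s0 f0 _ _ _ f]) auto
          then show ?thesis using True p by (auto intro!: mult_right_mono epowr_mono)
        qed simp
      qed
      also note up
      finally have main: "epowr (ennreal k0 * polya_op s f x) p * ennreal (k1 * r powr (g + ?Q)) \<le> ennreal (K * (K1 * N powr p * r powr \<tau>))" .
      have "epowr (polya_op s f x) p = ennreal (1 / (k0 powr p * (k1 * r powr (g + ?Q)))) * (epowr (ennreal k0 * polya_op s f x) p * ennreal (k1 * r powr (g + ?Q)))"
      proof -
        have "ennreal (1 / (k0 powr p * (k1 * r powr (g + ?Q)))) * (epowr (ennreal k0 * polya_op s f x) p * ennreal (k1 * r powr (g + ?Q)))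
          = (ennreal (1 / (k0 powr p * (k1 * r powr (g + ?Q)))) * ennreal (k0 powr p * (k1 * r powr (g + ?Q)))) * epowr (polya_op s f x) p"
          using p k0 k1 by (simp add: epowr_mult epowr_ennreal_pos ennreal_mult' mult_ac)
        also have "ennreal (1 / (k0 powr p * (k1 * r powr (g + ?Q)))) * ennreal (k0 powr p * (k1 * r powr (g + ?Q))) = 1"
          using k0 k1 r by (subst ennreal_mult'[symmetric]) auto
        finally show ?thesis by simp
      qed
      also have "\<dots> \<le> ennreal (1 / (k0 powr p * (k1 * r powr (g + ?Q)))) * ennreal (K * (K1 * N powr p * r powr \<tau>))"
        by (intro mult_left_mono main) simp
      also have "\<dots> = ennreal (1 / (k0 powr p * (k1 * r powr (g + ?Q))) * (K * (K1 * N powr p * r powr \<tau>)))"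
        using k0 k1 by (intro ennreal_mult'[symmetric]) simp
      also have "1 / (k0 powr p * (k1 * r powr (g + ?Q))) * (K * (K1 * N powr p * r powr \<tau>)) = C * N powr p * heis_norm x powr (p * b)"
      proof -
        have "\<tau> = (g + ?Q) + p * b" using e by simp
        then have "r powr \<tau> = r powr (g + ?Q) * r powr (p * b)" by (simp only: powr_add)
        moreover have "heis_norm x powr (p * b) = exp (p * b) * r powr (p * b)"
          using r by (simp add: powr_mult exp_powr_real)
        moreover have "0 < r powr (g + ?Q)" using r by simp
        ultimately show ?thesis using k0 k1 by (simp add: C_def field_simps exp_minus)
      qed
      finally show "epowr (polya_op s f x) p \<le> ennreal (C * N powr p * heis_norm x powr (p * b))" .
    qed
  qed
qed

text \<open>The p-th power of the Morrey inequality for one linear operator, on those balls only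
  that satisfy P, which permits different arguments for balls near the origin and far from it. Balls
  of infinite mass are left out unless the exponent of the mass is 0; otherwise their factor in the
  target norm is 0.\<close>

definition polya_op_bounded_on ::
  "real \<Rightarrow> real \<Rightarrow> real \<Rightarrow> real \<Rightarrow> real \<Rightarrow> ('n::finite heis \<Rightarrow> real \<Rightarrow> bool) \<Rightarrow> bool"
where
  "polya_op_bounded_on p l \<alpha> g s P \<longleftrightarrow>
     (\<exists>C\<ge>0. \<forall>(f :: 'n heis \<Rightarrow> real) N a R. f \<in> borel_measurable borel \<longrightarrow> (\<forall>x. 0 \<le> f x) \<longrightarrow> 0 \<le> N \<longrightarrow>
       source_norm p l \<alpha> g f \<le> ennreal N \<longrightarrow>
       0 < R \<longrightarrow> P a R \<longrightarrow>
       (p * l + 1 = 0 \<or> power_mass (heis_ball a R) \<alpha> < \<infinity>) \<longrightarrow>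
       (polya_mass s f p g (heis_ball a R))
         \<le> ennreal (C * N powr p) * epowr (power_mass (heis_ball a R) \<alpha>) (p * l + 1))"

lemma polya_op_bounded_onI:
  fixes P :: "'n::finite heis \<Rightarrow> real \<Rightarrow> bool"
  assumes "0 \<le> C"
    "\<And>f N a R. f \<in> borel_measurable borel \<Longrightarrow> (\<And>x. 0 \<le> f x) \<Longrightarrow> 0 \<le> N \<Longrightarrow>
       morrey_norm p l (\<lambda>x :: 'n heis. heis_norm x powr \<alpha>) (\<lambda>x. heis_norm x powr g) (\<lambda>x. ennreal \<bar>f x\<bar>) \<le> ennreal N \<Longrightarrow>
       0 < R \<Longrightarrow> P a R \<Longrightarrow>
       p * l + 1 = 0 \<or> power_mass (heis_ball a R) \<alpha> < \<infinity> \<Longrightarrow>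
       (polya_mass s f p g (heis_ball a R))
         \<le> ennreal (C * N powr p) * epowr (power_mass (heis_ball a R) \<alpha>) (p * l + 1)"
  shows "polya_op_bounded_on p l \<alpha> g s P"
  unfolding polya_op_bounded_on_def using assms(1) by (intro exI[of _ C] conjI allI impI assms(2)) auto

lemma polya_op_bounded_onD:
  assumes "polya_op_bounded_on p l \<alpha> g s P"
  obtains C where "0 \<le> C"
    "\<And>(f :: 'n::finite heis \<Rightarrow> real) N a R. f \<in> borel_measurable borel \<Longrightarrow> (\<And>x. 0 \<le> f x) \<Longrightarrow> 0 \<le> N \<Longrightarrow>
       source_norm p l \<alpha> g f \<le> ennreal N \<Longrightarrow>
       0 < R \<Longrightarrow> P a R \<Longrightarrow>
       p * l + 1 = 0 \<or> power_mass (heis_ball a R) \<alpha> < \<infinity> \<Longrightarrow>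
       (polya_mass s f p g (heis_ball a R))
         \<le> ennreal (C * N powr p) * epowr (power_mass (heis_ball a R) \<alpha>) (p * l + 1)"
proof -
  obtain C where C: "0 \<le> C" and bd: "\<forall>(f :: 'n heis \<Rightarrow> real) N a R. f \<in> borel_measurable borel \<longrightarrow> (\<forall>x. 0 \<le> f x) \<longrightarrow> 0 \<le> N \<longrightarrow>
       source_norm p l \<alpha> g f \<le> ennreal N \<longrightarrow>
       0 < R \<longrightarrow> P a R \<longrightarrow>
       (p * l + 1 = 0 \<or> power_mass (heis_ball a R) \<alpha> < \<infinity>) \<longrightarrow>
       (polya_mass s f p g (heis_ball a R))
         \<le> ennreal (C * N powr p) * epowr (power_mass (heis_ball a R) \<alpha>) (p * l + 1)"
    using assms unfolding polya_op_bounded_on_def by (elim exE conjE)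
  show thesis
    by (rule that[OF C]) (rule bd[rule_format]; assumption)
qed

lemma polya_op_bounded_on_disj:
  assumes "polya_op_bounded_on p l \<alpha> g s P" "polya_op_bounded_on p l \<alpha> g s P'"
  shows "polya_op_bounded_on p l \<alpha> g s (\<lambda>(a :: 'n::finite heis) R. P a R \<or> P' a R)"
proof (rule polya_op_bounded_onD[OF assms(1)], rule polya_op_bounded_onD[OF assms(2)])
  fix C C'
  assume C: "0 \<le> C" "0 \<le> C'" and 1: "\<And>(f :: 'n::finite heis \<Rightarrow> real) N a R. f \<in> borel_measurable borel \<Longrightarrow> (\<And>x. 0 \<le> f x) \<Longrightarrow> 0 \<le> N \<Longrightarrow>
       source_norm p l \<alpha> g f \<le> ennreal N \<Longrightarrow>
       0 < R \<Longrightarrow> P a R \<Longrightarrow>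
       p * l + 1 = 0 \<or> power_mass (heis_ball a R) \<alpha> < \<infinity> \<Longrightarrow>
       (polya_mass s f p g (heis_ball a R))
         \<le> ennreal (C * N powr p) * epowr (power_mass (heis_ball a R) \<alpha>) (p * l + 1)"
    and 2: "\<And>(f :: 'n::finite heis \<Rightarrow> real) N a R. f \<in> borel_measurable borel \<Longrightarrow> (\<And>x. 0 \<le> f x) \<Longrightarrow> 0 \<le> N \<Longrightarrow>
       source_norm p l \<alpha> g f \<le> ennreal N \<Longrightarrow>
       0 < R \<Longrightarrow> P' a R \<Longrightarrow>
       p * l + 1 = 0 \<or> power_mass (heis_ball a R) \<alpha> < \<infinity> \<Longrightarrow>
       (polya_mass s f p g (heis_ball a R))
         \<le> ennreal (C' * N powr p) * epowr (power_mass (heis_ball a R) \<alpha>) (p * l + 1)"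
  show ?thesis
  proof (rule polya_op_bounded_onI[of "max C C'"])
    show "0 \<le> max C C'" using C by simp
    fix f :: "'n heis \<Rightarrow> real" and N a R
    assume f: "f \<in> borel_measurable borel" "\<And>x. 0 \<le> f x" "0 \<le> N"
       "source_norm p l \<alpha> g f \<le> ennreal N" "0 < R"
      and PP: "P a R \<or> P' a R" and W: "p * l + 1 = 0 \<or> power_mass (heis_ball a R) \<alpha> < \<infinity>"
    have le: "ennreal (D * N powr p) * epowr (power_mass (heis_ball a R) \<alpha>) (p * l + 1)
       \<le> ennreal (max C C' * N powr p) * epowr (power_mass (heis_ball a R) \<alpha>) (p * l + 1)"
      if "D \<le> max C C'" for D
      using that by (intro mult_right_mono ennreal_leI) auto
    from PP show "polya_mass s f p g (heis_ball a R)
       \<le> ennreal (max C C' * N powr p) * epowr (power_mass (heis_ball a R) \<alpha>) (p * l + 1)"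
    proof
      assume "P a R"
      from 1[OF f this W] show ?thesis by (rule order_trans) (rule le, simp)
    next
      assume "P' a R"
      from 2[OF f this W] show ?thesis by (rule order_trans) (rule le, simp)
    qed
  qed
qed

text \<open>For l = -1/p the space is a weighted Lebesgue space: the mass factor is 1, and
  exhausting the group by centred balls bounds the integral over the whole group. The radial bound
  is applied with I the entire line and \<tau> = 0, where dilates change nothing.\<close>

lemma polya_op_bounded_Lebesgue:
  fixes p l \<alpha> g s b :: real
  assumes b: "b = real (hom_dim TYPE('n::finite)) * l - g / p + \<alpha> * (l + 1 / p)"
    and p: "1 < p" and l: "l = - 1 / p" and s: "0 < b + hom_dim TYPE('n)" "b + hom_dim TYPE('n) < s"
  shows "polya_op_bounded_on p l \<alpha> g s (\<lambda>(a :: 'n heis) R. True)"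
proof -
  let ?Q = "real (hom_dim TYPE('n))"
  have \<theta>: "p * l + 1 = 0" using p l by simp
  have "p * b + g = (p * l) * ?Q + \<alpha> * (p * l + 1)" using p by (simp add: b field_simps)
  moreover have "p * l = - 1" using p l by simp
  ultimately have e: "p * b + g = 0 - ?Q" by simp
  show ?thesis
  proof (rule polya_op_radial_bound[OF p s e])
    fix K assume K: "0 \<le> K" and rad: "\<And>f I M. f \<in> borel_measurable borel \<Longrightarrow> (\<And>y :: 'n heis. 0 \<le> f y) \<Longrightarrow> I \<in> sets borel \<Longrightarrow>
      (\<And>c. 0 < c \<Longrightarrow> (source_mass f p g {y. heis_norm y / c \<in> I}) \<le> M * ennreal (c powr 0)) \<Longrightarrow>
      (polya_mass s f p g {x. heis_norm x \<in> I}) \<le> ennreal K * M"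
    show ?thesis
    proof (rule polya_op_bounded_onI[OF K])
      fix f :: "'n heis \<Rightarrow> real" and N a R
      assume f [measurable]: "f \<in> borel_measurable borel" and f0: "\<And>x. 0 \<le> f x" and N: "0 \<le> N"
        and le: "source_norm p l \<alpha> g f \<le> ennreal N"
      let ?F = "\<lambda>y :: 'n heis. ennreal (f y powr p * heis_norm y powr g)"
      have "(\<integral>\<^sup>+y. ?F y \<partial>lborel) = (\<integral>\<^sup>+y. (SUP n. ?F y * indicator (heis_ball 0 (real (Suc n))) y) \<partial>lborel)"
      proof (intro nn_integral_cong antisym)
        fix y :: "'n heis"
        obtain n where "heis_norm y < real n" using reals_Archimedean2 by blast
        then have "y \<in> heis_ball 0 (real (Suc n))" by (simp add: heis_ball_0)
        then show "?F y \<le> (SUP n. ?F y * indicator (heis_ball 0 (real (Suc n))) y)"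
          by (intro SUP_upper2[of n]) auto
        show "(SUP n. ?F y * indicator (heis_ball 0 (real (Suc n))) y) \<le> ?F y"
          by (intro SUP_least) (simp add: indicator_def)
      qed
      also have "\<dots> = (SUP n. \<integral>\<^sup>+y\<in>heis_ball 0 (real (Suc n)). ?F y \<partial>lborel)"
      proof (rule nn_integral_monotone_convergence_SUP)
        show "incseq (\<lambda>n y. ?F y * indicator (heis_ball 0 (real (Suc n))) y)"
          by (auto simp: incseq_def le_fun_def heis_ball_0 split: split_indicator)
      qed measurable
      also have "\<dots> \<le> ennreal (N powr p)"
      proof (rule SUP_least)
        fix n
        show "(\<integral>\<^sup>+y\<in>heis_ball 0 (real (Suc n)). ?F y \<partial>lborel) \<le> ennreal (N powr p)"
          using morrey_norm_ball_le[OF p _ N f0 le, of "real (Suc n)" 0] l \<theta> by simp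
      qed
      finally have all: "(\<integral>\<^sup>+y. ?F y \<partial>lborel) \<le> ennreal (N powr p)" .
      have "polya_mass s f p g (heis_ball a R)
        \<le> polya_mass s f p g {x. heis_norm x \<in> UNIV}"
        by (intro nn_integral_mono_set) auto
      also have "\<dots> \<le> ennreal K * ennreal (N powr p)"
        using all by (intro rad f f0) auto
      finally show "polya_mass s f p g (heis_ball a R)
        \<le> ennreal (K * N powr p) * epowr (power_mass (heis_ball a R) \<alpha>) (p * l + 1)"
        unfolding \<theta> using K by (simp add: ennreal_mult')
    qed
  qed
qed

text \<open>Once the pointwise bound \<open>|x|^b\<close> is available, the function has disappeared
  and what remains on each ball is a comparison of power weights, the hypothesis on D.\<close>

lemma polya_op_bounded_onI_powr:
  fixes P :: "'n::finite heis \<Rightarrow> real \<Rightarrow> bool" and p l \<alpha> g s b D :: real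
  assumes b: "b = real (hom_dim TYPE('n::finite)) * l - g / p + \<alpha> * (l + 1 / p)"
    and p: "1 < p" and l: "- 1 / p < l" and s: "0 < b + hom_dim TYPE('n)" "b + hom_dim TYPE('n) < s"
    and D: "0 \<le> D" "\<And>a R. 0 < R \<Longrightarrow> P a R \<Longrightarrow> (power_mass (heis_ball a R) \<alpha>) < \<infinity> \<Longrightarrow>
      (power_mass (heis_ball a R) ((p * l + 1) * (hom_dim TYPE('n) + \<alpha>) - hom_dim TYPE('n)))
        \<le> ennreal D * epowr (power_mass (heis_ball a R) \<alpha>) (p * l + 1)"
  shows "polya_op_bounded_on p l \<alpha> g s P"
proof (rule polya_op_pointwise[OF b p l s])
  let ?Q = "real (hom_dim TYPE('n))"
  fix C assume C: "0 \<le> C" and pw: "\<And>(f :: 'n heis \<Rightarrow> real) N x. f \<in> borel_measurable borel \<Longrightarrow> (\<And>x. 0 \<le> f x) \<Longrightarrow> 0 \<le> N \<Longrightarrow>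
      source_norm p l \<alpha> g f \<le> ennreal N \<Longrightarrow> x \<noteq> 0 \<Longrightarrow>
      epowr (polya_op s f x) p \<le> ennreal (C * N powr p * heis_norm x powr (p * b))"
  have e: "p * b + g = (p * l + 1) * (?Q + \<alpha>) - ?Q" using p by (simp add: b field_simps)
  have \<theta>: "p * l + 1 \<noteq> 0" using p l by (simp add: field_simps)
  show ?thesis
  proof (rule polya_op_bounded_onI[of "C * D"])
    show "0 \<le> C * D" using C D by simp
    fix f :: "'n heis \<Rightarrow> real" and N a R
    assume f: "f \<in> borel_measurable borel" "\<And>x. 0 \<le> f x" "0 \<le> N"
       "source_norm p l \<alpha> g f \<le> ennreal N"
      and R: "0 < R" "P a R"
      and "p * l + 1 = 0 \<or> power_mass (heis_ball a R) \<alpha> < \<infinity>"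
    then have W: "power_mass (heis_ball a R) \<alpha> < \<infinity>" using \<theta> by simp
    have "polya_mass s f p g (heis_ball a R)
       \<le> (\<integral>\<^sup>+x. ennreal (C * N powr p) * (ennreal (heis_norm x powr ((p * l + 1) * (?Q + \<alpha>) - ?Q)) * indicator (heis_ball a R) x) \<partial>lborel)"
    proof (rule nn_integral_mono_AE, rule AE_mp[OF AE_heis_nonzero], intro AE_I2 impI)
      fix x :: "'n heis" assume x: "x \<noteq> 0"
      have "epowr (polya_op s f x) p * ennreal (heis_norm x powr g) \<le> ennreal (C * N powr p * heis_norm x powr (p * b)) * ennreal (heis_norm x powr g)"
        by (intro mult_right_mono pw f x) auto
      also have "\<dots> = ennreal (C * N powr p) * ennreal (heis_norm x powr (p * b + g))"
        using C by (simp add: ennreal_mult'[symmetric] powr_add mult.assoc)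
      finally show "epowr (polya_op s f x) p * ennreal (heis_norm x powr g) * indicator (heis_ball a R) x
        \<le> ennreal (C * N powr p) * (ennreal (heis_norm x powr ((p * l + 1) * (?Q + \<alpha>) - ?Q)) * indicator (heis_ball a R) x)"
        unfolding e by (auto split: split_indicator)
    qed
    also have "\<dots> = ennreal (C * N powr p) * (power_mass (heis_ball a R) ((p * l + 1) * (?Q + \<alpha>) - ?Q))"
      by (intro nn_integral_cmult) measurable
    also have "\<dots> \<le> ennreal (C * N powr p) * (ennreal D * epowr (power_mass (heis_ball a R) \<alpha>) (p * l + 1))"
      by (intro mult_left_mono D(2) R W) simp
    also have "\<dots> = ennreal (C * D * N powr p) * epowr (power_mass (heis_ball a R) \<alpha>) (p * l + 1)"
      using C D by (simp add: mult.assoc[symmetric] ennreal_mult'[symmetric]) (simp add: mult_ac)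
    finally show "polya_mass s f p g (heis_ball a R)
      \<le> ennreal (C * D * N powr p) * epowr (power_mass (heis_ball a R) \<alpha>) (p * l + 1)" .
  qed
qed

text \<open>Such a ball lies in |x| \<ge> R, so its mass for the exponent -Q is at most the volume
  of the unit ball. The interpolation \<open>Hoelder_power_weights\<close> then gives the comparison
  of weights directly, for every \<alpha>.\<close>

lemma polya_op_bounded_small_balls:
  fixes p l \<alpha> g s b :: real
  assumes b: "b = real (hom_dim TYPE('n::finite)) * l - g / p + \<alpha> * (l + 1 / p)"
    and p: "1 < p" and l: "- 1 / p < l" "l < 0" and s: "0 < b + hom_dim TYPE('n)" "b + hom_dim TYPE('n) < s"
  shows "polya_op_bounded_on p l \<alpha> g s (\<lambda>(a :: 'n heis) R. 4 * R \<le> heis_norm a)"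
proof (rule polya_op_bounded_onI_powr[OF b p l(1) s])
  let ?Q = "real (hom_dim TYPE('n))" and ?V = "unit_ball_vol TYPE('n)"
  have V: "0 < ?V" by (rule unit_ball_vol_pos)
  define \<theta> where "\<theta> = p * l + 1"
  have \<theta>: "0 \<le> \<theta>" "\<theta> < 1" using p l by (auto simp: \<theta>_def field_simps mult_less_0_iff)
  show "0 \<le> ?V powr (1 - \<theta>)" by simp
  fix a :: "'n heis" and R :: real
  assume R: "0 < R" "4 * R \<le> heis_norm a"
  have "power_mass (heis_ball a R) (- ?Q) \<le> (\<integral>\<^sup>+x. ennreal (R powr - ?Q) * indicator (heis_ball a R) x \<partial>lborel)"
  proof (intro nn_integral_mono)
    fix x :: "'n heis"
    show "ennreal (heis_norm x powr - ?Q) * indicator (heis_ball a R) x \<le> ennreal (R powr - ?Q) * indicator (heis_ball a R) x"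
    proof (cases "x \<in> heis_ball a R")
      case True
      then have "R \<le> heis_norm x" using heis_ball_norm(2)[OF True] R by linarith
      then show ?thesis using True R by (auto intro!: ennreal_leI powr_mono2')
    qed simp
  qed
  also have "\<dots> = ennreal (R powr - ?Q) * ennreal (R ^ hom_dim TYPE('n) * ?V)"
    using R by (simp add: nn_integral_cmult_indicator emeasure_heis_ball)
  also have "\<dots> = ennreal ?V"
    using R by (simp add: ennreal_mult'[symmetric] powr_minus powr_realpow mult.assoc[symmetric])
  finally have \<nu>: "power_mass (heis_ball a R) (- ?Q) \<le> ennreal ?V" .
  have "power_mass (heis_ball a R) (\<theta> * (?Q + \<alpha>) - ?Q)
    \<le> epowr (power_mass (heis_ball a R) \<alpha>) \<theta>
      * epowr (power_mass (heis_ball a R) (- ?Q)) (1 - \<theta>)"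
    using \<theta> by (intro Hoelder_power_weights) auto
  also have "\<dots> \<le> epowr (power_mass (heis_ball a R) \<alpha>) \<theta> * epowr (ennreal ?V) (1 - \<theta>)"
    using \<theta> \<nu> by (intro mult_left_mono epowr_mono) auto
  also have "\<dots> = ennreal (?V powr (1 - \<theta>)) * epowr (power_mass (heis_ball a R) \<alpha>) \<theta>"
    using V by (simp add: epowr_ennreal_pos mult.commute)
  finally show "power_mass (heis_ball a R) ((p * l + 1) * (?Q + \<alpha>) - ?Q)
    \<le> ennreal (?V powr (1 - \<theta>)) * epowr (power_mass (heis_ball a R) \<alpha>) (p * l + 1)"
    unfolding \<theta>_def .
qed

lemma heis_ball_finite_mass:
  fixes \<alpha> :: real and a :: "'n::finite heis"
  assumes R: "0 < R" and W: "power_mass (heis_ball a R) \<alpha> < \<infinity>"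
  obtains w where "0 < w" "power_mass (heis_ball a R) \<alpha> = ennreal w"
proof -
  let ?W = "power_mass (heis_ball a R) \<alpha>"
  have "?W = ennreal (enn2real ?W)" using W by simp
  moreover have "0 < enn2real ?W"
    using W nn_integral_heis_ball_powr_pos[OF R, where a = a and b = \<alpha>] by (simp add: enn2real_positive_iff)
  ultimately show ?thesis using that by blast
qed

text \<open>Finiteness of the mass confines the ball to \<open>|x| \<le> \<rho>\<close> or to \<open>|x| \<ge> \<rho>\<close>,
  according to the sign of \<open>Q + \<alpha>\<close>, where \<open>\<rho>\<^sup>Q\<^sup>+\<^sup>\<alpha>\<close> is comparable to the mass.\<close>

lemma polya_op_bounded_large_balls:
  fixes p l \<alpha> g s b :: real
  assumes b: "b = real (hom_dim TYPE('n::finite)) * l - g / p + \<alpha> * (l + 1 / p)"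
    and p: "1 < p" and l: "- 1 / p < l" and s: "0 < b + hom_dim TYPE('n)" "b + hom_dim TYPE('n) < s"
    and \<alpha>: "\<alpha> \<noteq> - real (hom_dim TYPE('n))"
  shows "polya_op_bounded_on p l \<alpha> g s (\<lambda>(a :: 'n heis) R. heis_norm a < 4 * R)"
proof (rule heis_ball_shell_mass[of \<alpha>, where ?'n = 'n])
  let ?Q = "real (hom_dim TYPE('n))"
  fix c assume c: "0 < c" and mass: "\<And>(a :: 'n heis) R p. p \<in> heis_ball a R \<Longrightarrow> p \<noteq> 0 \<Longrightarrow> heis_norm p \<le> 5 * R \<Longrightarrow>
      ennreal (c * heis_norm p powr (?Q + \<alpha>))
        \<le> power_mass (heis_ball a R \<inter> (heis_annulus (heis_norm p / 2) (2 * heis_norm p))) \<alpha>"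
  define \<theta> where "\<theta> = p * l + 1"
  have \<theta>: "0 < \<theta>" using p l by (simp add: \<theta>_def field_simps)
  define \<tau> where "\<tau> = \<theta> * (?Q + \<alpha>)"
  have om: "0 < omega_Q TYPE('n)" by (rule omega_Q_pos)
  have Q\<alpha>: "?Q + \<alpha> \<noteq> 0" using \<alpha> by linarith
  \<comment> \<open>The maximum serves both signs of \<tau>. The power of 2 comes from enlarging |x|
    \<le> \<rho> to the open region |x| < 2 * \<rho> when Q + \<alpha> > 0.\<close>
  define D where "D = omega_Q TYPE('n) * max 1 (2 powr \<tau>) / \<bar>\<tau>\<bar> * (1 / c) powr \<theta>"
  show ?thesis
  proof (rule polya_op_bounded_onI_powr[OF b p l s])
    show "0 \<le> D" using om by (simp add: D_def le_max_iff_disj)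
    fix a :: "'n heis" and R :: real
    assume R: "0 < R" "heis_norm a < 4 * R" and Wfin: "power_mass (heis_ball a R) \<alpha> < \<infinity>"
    obtain w where w: "0 < w" "power_mass (heis_ball a R) \<alpha> = ennreal w"
      using heis_ball_finite_mass[OF R(1) Wfin] .
    define \<rho> where "\<rho> = (w / c) powr (1 / (?Q + \<alpha>))"
    have \<rho>: "0 < \<rho>" "\<rho> powr \<tau> = (w / c) powr \<theta>"
      using w c Q\<alpha> by (simp_all add: \<rho>_def \<tau>_def powr_powr)
    have x: "heis_norm x powr (?Q + \<alpha>) \<le> w / c" if "x \<in> heis_ball a R" "x \<noteq> 0" for x
    proof -
      have "heis_norm x \<le> 5 * R" using heis_ball_norm(1)[OF that(1)] R by linarith
      from mass[OF that this]
      have "ennreal (c * heis_norm x powr (?Q + \<alpha>)) \<le> power_mass (heis_ball a R) \<alpha>"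
        by (rule order_trans) (intro nn_integral_mono_set, auto)
      then have "c * heis_norm x powr (?Q + \<alpha>) \<le> w" unfolding w(2) using w(1) by (subst (asm) ennreal_le_iff) auto
      then show ?thesis using c by (simp add: field_simps)
    qed
    have inv: "heis_norm x = (heis_norm x powr (?Q + \<alpha>)) powr (1 / (?Q + \<alpha>))" for x :: "'n heis"
      using Q\<alpha> by (simp add: powr_powr)
    have "power_mass (heis_ball a R) (\<tau> - ?Q) \<le> ennreal (omega_Q TYPE('n) * max 1 (2 powr \<tau>) / \<bar>\<tau>\<bar> * (w / c) powr \<theta>)"
    proof (cases "0 < ?Q + \<alpha>")
      case True
      then have \<tau>: "0 < \<tau>" using \<theta> by (simp add: \<tau>_def)
      have "power_mass (heis_ball a R) (\<tau> - ?Q)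
        \<le> power_mass {x :: 'n heis. heis_norm x < 2 * \<rho>} (\<tau> - ?Q)"
      proof (intro nn_integral_mono_set subsetI)
        fix x assume xB: "x \<in> heis_ball a R"
        show "x \<in> {x. heis_norm x < 2 * \<rho>}"
        proof (cases "x = 0")
          case False
          have "heis_norm x \<le> \<rho>" unfolding \<rho>_def
            by (subst inv, rule powr_mono2) (use True x[OF xB False] in auto)
          then show ?thesis using \<rho> by simp
        qed (use \<rho> in simp)
      qed
      also have "\<dots> = ennreal (omega_Q TYPE('n) * (2 * \<rho>) powr \<tau> / \<tau>)"
        using \<tau> \<rho> by (subst nn_integral_heis_powr_less) auto
      also have "\<dots> \<le> ennreal (omega_Q TYPE('n) * max 1 (2 powr \<tau>) / \<bar>\<tau>\<bar> * (w / c) powr \<theta>)"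
      proof (intro ennreal_leI)
        have "omega_Q TYPE('n) * (2 * \<rho>) powr \<tau> / \<tau> = omega_Q TYPE('n) / \<tau> * (w / c) powr \<theta> * 2 powr \<tau>"
          using \<rho> by (simp add: powr_mult)
        also have "\<dots> \<le> omega_Q TYPE('n) / \<tau> * (w / c) powr \<theta> * max 1 (2 powr \<tau>)"
          using om \<tau> by (intro mult_left_mono) auto
        finally show "omega_Q TYPE('n) * (2 * \<rho>) powr \<tau> / \<tau> \<le> omega_Q TYPE('n) * max 1 (2 powr \<tau>) / \<bar>\<tau>\<bar> * (w / c) powr \<theta>"
          using \<tau> by (simp add: mult_ac)
      qed
      finally show ?thesis .
    next
      case False
      then have \<tau>: "\<tau> < 0" using \<theta> Q\<alpha> by (simp add: \<tau>_def mult_less_0_iff)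
      have "power_mass (heis_ball a R) (\<tau> - ?Q)
        \<le> power_mass {x :: 'n heis. \<rho> \<le> heis_norm x} (\<tau> - ?Q)"
      proof (rule nn_integral_mono_AE, rule AE_mp[OF AE_heis_nonzero], intro AE_I2 impI)
        fix x :: "'n heis" assume x0: "x \<noteq> 0"
        have "\<rho> \<le> heis_norm x" if xB: "x \<in> heis_ball a R"
          unfolding \<rho>_def by (subst inv, rule powr_mono2') (use False x[OF xB x0] x0 in auto)
        then show "ennreal (heis_norm x powr (\<tau> - ?Q)) * indicator (heis_ball a R) x
          \<le> ennreal (heis_norm x powr (\<tau> - ?Q)) * indicator {x. \<rho> \<le> heis_norm x} x"
          by (auto split: split_indicator)
      qed
      also have "\<dots> = ennreal (omega_Q TYPE('n) * \<rho> powr \<tau> / - \<tau>)"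
        using \<tau> \<rho> by (subst nn_integral_heis_powr_ge) auto
      also have "\<dots> \<le> ennreal (omega_Q TYPE('n) * max 1 (2 powr \<tau>) / \<bar>\<tau>\<bar> * (w / c) powr \<theta>)"
      proof (intro ennreal_leI)
        have "omega_Q TYPE('n) * \<rho> powr \<tau> / - \<tau> = omega_Q TYPE('n) / - \<tau> * (w / c) powr \<theta> * 1"
          using \<rho> by simp
        also have "\<dots> \<le> omega_Q TYPE('n) / - \<tau> * (w / c) powr \<theta> * max 1 (2 powr \<tau>)"
          using om \<tau> by (intro mult_left_mono mult_nonneg_nonneg divide_nonneg_nonneg) auto
        finally show "omega_Q TYPE('n) * \<rho> powr \<tau> / - \<tau> \<le> omega_Q TYPE('n) * max 1 (2 powr \<tau>) / \<bar>\<tau>\<bar> * (w / c) powr \<theta>"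
          using \<tau> by (simp add: mult_ac)
      qed
      finally show ?thesis .
    qed
    also have "omega_Q TYPE('n) * max 1 (2 powr \<tau>) / \<bar>\<tau>\<bar> * (w / c) powr \<theta> = D * w powr \<theta>"
      using w c by (simp add: D_def powr_divide)
    also have "ennreal (D * w powr \<theta>) = ennreal D * epowr (ennreal w) \<theta>"
      using w by (simp add: epowr_ennreal_pos ennreal_mult'')
    finally show "power_mass (heis_ball a R) ((p * l + 1) * (?Q + \<alpha>) - ?Q)
        \<le> ennreal D * epowr (power_mass (heis_ball a R) \<alpha>) (p * l + 1)"
      unfolding w(2) \<tau>_def \<theta>_def .
  qed
qed

text \<open>For \<open>\<alpha> = - Q\<close> the pointwise bound is too weak, because the mass of a ball grows only
  like the logarithm of the ratio of the largest and the smallest norm in it. Here the radial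
  bound is applied to the whole annulus spanned by the ball.\<close>

lemma polya_op_bounded_large_balls_critical:
  fixes p l g s b :: real
  assumes b: "b = real (hom_dim TYPE('n::finite)) * l - g / p + - real (hom_dim TYPE('n)) * (l + 1 / p)"
    and p: "1 < p" and l: "- 1 / p < l" and s: "0 < b + hom_dim TYPE('n)" "b + hom_dim TYPE('n) < s"
  shows "polya_op_bounded_on p l (- real (hom_dim TYPE('n))) g s (\<lambda>(a :: 'n heis) R. heis_norm a < 4 * R)"
proof -
  let ?Q = "real (hom_dim TYPE('n))"
  define \<theta> where "\<theta> = p * l + 1"
  have \<theta>: "0 < \<theta>" using p l by (simp add: \<theta>_def field_simps)
  have e: "p * b + g = 0 - ?Q" using p by (simp add: b field_simps)
  show ?thesis
  proof (rule polya_op_radial_bound[OF p s e], rule morrey_norm_annulus_log_le[OF p l, of g, where ?'n = 'n], rule heis_ball_log_width[where ?'n = 'n])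
    fix K K2 c :: real
    assume K: "0 \<le> K" and rad: "\<And>f I M. f \<in> borel_measurable borel \<Longrightarrow> (\<And>y :: 'n heis. 0 \<le> f y) \<Longrightarrow> I \<in> sets borel \<Longrightarrow>
      (\<And>c. 0 < c \<Longrightarrow> (source_mass f p g {y. heis_norm y / c \<in> I}) \<le> M * ennreal (c powr 0)) \<Longrightarrow>
      (polya_mass s f p g {x. heis_norm x \<in> I}) \<le> ennreal K * M"
    assume K2: "0 \<le> K2" and ann: "\<And>(f :: 'n heis \<Rightarrow> real) N r r'. f \<in> borel_measurable borel \<Longrightarrow> (\<And>x. 0 \<le> f x) \<Longrightarrow> 0 \<le> N \<Longrightarrow>
      source_norm p l (- ?Q) g f \<le> ennreal N \<Longrightarrow>
      0 < r \<Longrightarrow> r \<le> r' \<Longrightarrow>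
      (source_mass f p g (heis_annulus r r'))
        \<le> ennreal (K2 * N powr p * (1 + ln (r' / r)) powr (p * l + 1))"
    assume c: "0 < c" and width: "\<And>(a :: 'n heis) R w p p'. (\<And>x. x \<in> heis_ball a R \<Longrightarrow> heis_norm x \<le> 5 * R) \<Longrightarrow>
      (power_mass (heis_ball a R) (- ?Q)) = ennreal w \<Longrightarrow> 0 \<le> w \<Longrightarrow>
      p \<in> heis_ball a R \<Longrightarrow> p' \<in> heis_ball a R \<Longrightarrow> p \<noteq> 0 \<Longrightarrow> heis_norm p \<le> heis_norm p' \<Longrightarrow> c \<le> w \<and> c * ln (heis_norm p' / heis_norm p) \<le> w"
    show ?thesis
    proof (rule polya_op_bounded_onI[of "K * (K2 * (3 / c) powr \<theta>)"])
      show "0 \<le> K * (K2 * (3 / c) powr \<theta>)" using K K2 by simp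
      fix f :: "'n heis \<Rightarrow> real" and N R :: real and a :: "'n heis"
      assume f: "f \<in> borel_measurable borel" and f0: "\<And>x. 0 \<le> f x" and N: "0 \<le> N"
        and le: "source_norm p l (- ?Q) g f \<le> ennreal N"
        and R: "0 < R" "heis_norm a < 4 * R"
        and "p * l + 1 = 0 \<or> power_mass (heis_ball a R) (- ?Q) < \<infinity>"
      then have Wfin: "power_mass (heis_ball a R) (- ?Q) < \<infinity>" using \<theta> by (simp add: \<theta>_def)
      obtain w where w: "0 < w" "power_mass (heis_ball a R) (- ?Q) = ennreal w"
        using heis_ball_finite_mass[OF R(1) Wfin] .
      have R5: "heis_norm x \<le> 5 * R" if "x \<in> heis_ball a R" for x using heis_ball_norm(1)[OF that] R by linarith
      have wd: "c \<le> w \<and> c * ln (heis_norm p' / heis_norm p) \<le> w"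
        if "p \<in> heis_ball a R" "p' \<in> heis_ball a R" "p \<noteq> 0" "heis_norm p \<le> heis_norm p'" for p p'
        by (rule width[OF R5 w(2) less_imp_le[OF w(1)] that])
      have "\<not> heis_ball a R \<subseteq> {0}"
      proof
        assume "heis_ball a R \<subseteq> {0}"
        then have "emeasure lborel (heis_ball a R) \<le> emeasure lborel {0 :: 'n heis}" by (intro emeasure_mono) auto
        moreover have "0 < R ^ hom_dim TYPE('n) * unit_ball_vol TYPE('n)"
          using R unit_ball_vol_pos[where ?'n = 'n] by simp
        ultimately show False using emeasure_heis_ball[OF R(1), of a] by (simp add: ennreal_eq_0_iff)
      qed
      then obtain p0 where p0: "p0 \<in> heis_ball a R" "p0 \<noteq> 0" by blast
      define r where "r = heis_norm p0"
      have r: "0 < r" using p0 by (simp add: r_def)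
      have cw: "c \<le> w" using wd[OF p0(1) p0(1) p0(2)] by simp
      define L where "L = w / c"
      have L: "1 \<le> L" using cw c by (simp add: L_def)
      \<comment> \<open>By the logarithmic width every norm in the ball differs from r by a factor
        of at most \<open>exp L\<close>, upwards or downwards. The annulus over I thus contains the
        ball up to the origin, and any dilate of it has the same logarithmic width 2 * L.\<close>
      define I where "I = {r * exp (- L)..r * exp L}"
      have in_I: "heis_norm x \<in> I" if x: "x \<in> heis_ball a R" "x \<noteq> 0" for x
      proof -
        have n: "0 < heis_norm x" using x by simp
        have "\<bar>ln (heis_norm x) - ln r\<bar> \<le> L"
        proof (cases "heis_norm x \<le> r")
          case True
          then have "ln (r / heis_norm x) \<le> L" using wd[OF x(1) p0(1) x(2)] c by (simp add: r_def L_def field_simps)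
          moreover have "ln (heis_norm x) \<le> ln r" using True n r by simp
          ultimately show ?thesis using n r by (simp add: ln_div)
        next
          case False
          then have "ln (heis_norm x / r) \<le> L" using wd[OF p0(1) x(1) p0(2)] c by (simp add: r_def L_def field_simps)
          moreover have "ln r \<le> ln (heis_norm x)" using False n r by simp
          ultimately show ?thesis using n r by (simp add: ln_div)
        qed
        then have "exp (ln r - L) \<le> exp (ln (heis_norm x))" "exp (ln (heis_norm x)) \<le> exp (ln r + L)" by auto
        then show ?thesis using n r by (simp add: I_def exp_add exp_diff exp_minus field_simps)
      qed
      have "polya_mass s f p g (heis_ball a R)
        \<le> polya_mass s f p g {x. heis_norm x \<in> I}"
      proof (rule nn_integral_mono_AE, rule AE_mp[OF AE_heis_nonzero], intro AE_I2 impI)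
        fix x :: "'n heis" assume "x \<noteq> 0"
        then show "epowr (polya_op s f x) p * ennreal (heis_norm x powr g) * indicator (heis_ball a R) x
          \<le> epowr (polya_op s f x) p * ennreal (heis_norm x powr g) * indicator {x. heis_norm x \<in> I} x"
          using in_I[of x] by (auto split: split_indicator)
      qed
      also have "\<dots> \<le> ennreal K * ennreal (K2 * N powr p * (1 + 2 * L) powr \<theta>)"
      proof (rule rad[OF f f0])
        show "I \<in> sets borel" by (simp add: I_def)
        fix d :: real assume d: "0 < d"
        have "{y :: 'n heis. heis_norm y / d \<in> I} = (heis_annulus (d * (r * exp (- L))) (d * (r * exp L)))"
          using d by (auto simp: I_def field_simps)
        then have "source_mass f p g {y. heis_norm y / d \<in> I}
          \<le> ennreal (K2 * N powr p * (1 + ln (d * (r * exp L) / (d * (r * exp (- L))))) powr (p * l + 1))"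
          using d r L by (simp only:) (intro ann[OF f f0 N le], auto)
        also have "ln (d * (r * exp L) / (d * (r * exp (- L)))) = 2 * L"
        proof -
          have "d * (r * exp L) / (d * (r * exp (- L))) = exp (2 * L)"
            using d r by (simp add: exp_minus field_simps mult_exp_exp)
          then show ?thesis by simp
        qed
        finally show "source_mass f p g {y. heis_norm y / d \<in> I}
          \<le> ennreal (K2 * N powr p * (1 + 2 * L) powr \<theta>) * ennreal (d powr 0)"
          using d by (simp add: \<theta>_def)
      qed
      \<comment> \<open>Absorbing the 1 is possible since L \<ge> 1, which holds because a ball
        always has mass at least c. The result is proportional to \<open>w powr \<theta>\<close>, as
        required.\<close>
      also have "\<dots> \<le> ennreal K * ennreal (K2 * N powr p * (3 * L) powr \<theta>)"
        using L \<theta> K2 by (intro mult_left_mono ennreal_leI powr_mono2) auto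
      also have "\<dots> = ennreal (K * (K2 * (3 / c) powr \<theta>) * N powr p) * epowr (ennreal w) \<theta>"
      proof -
        have "(3 * L) powr \<theta> = (3 / c) powr \<theta> * w powr \<theta>"
          using w c by (subst powr_mult[symmetric]) (auto simp: L_def)
        then show ?thesis using w K K2 by (simp add: epowr_ennreal_pos ennreal_mult'[symmetric] mult_ac)
      qed
      finally show "polya_mass s f p g (heis_ball a R)
        \<le> ennreal (K * (K2 * (3 / c) powr \<theta>) * N powr p) * epowr (power_mass (heis_ball a R) (- ?Q)) (p * l + 1)"
        unfolding w(2) \<theta>_def .
    qed
  qed
qed

lemma polya_op_bounded:
  fixes p l \<alpha> g s b :: real
  assumes b: "b = real (hom_dim TYPE('n::finite)) * l - g / p + \<alpha> * (l + 1 / p)"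
    and p: "1 < p" and l: "- 1 / p \<le> l" "l < 0" and s: "0 < b + hom_dim TYPE('n)" "b + hom_dim TYPE('n) < s"
  shows "polya_op_bounded_on p l \<alpha> g s (\<lambda>(a :: 'n heis) R. True)"
proof (cases "l = - 1 / p")
  case True
  then show ?thesis using polya_op_bounded_Lebesgue[OF b p _ s] by simp
next
  case False
  then have l': "- 1 / p < l" using l by simp
  have large: "polya_op_bounded_on p l \<alpha> g s (\<lambda>(a :: 'n heis) R. heis_norm a < 4 * R)"
  proof (cases "\<alpha> = - real (hom_dim TYPE('n))")
    case True
    show ?thesis using polya_op_bounded_large_balls_critical[OF _ p l' s] b unfolding True by simp
  qed (rule polya_op_bounded_large_balls[OF b p l' s])
  have "(\<lambda>(a :: 'n heis) R. 4 * R \<le> heis_norm a \<or> heis_norm a < 4 * R) = (\<lambda>a R. True)"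
    by (auto simp: fun_eq_iff)
  then show ?thesis
    using polya_op_bounded_on_disj[OF polya_op_bounded_small_balls[OF b p l' l(2) s] large] by simp
qed

section \<open>From the linear operators to the multilinear one\<close>

lemma epowr_sum:
  assumes "\<And>j. j \<in> I \<Longrightarrow> 0 \<le> k j"
  shows "epowr x (\<Sum>j\<in>I. k j) = (\<Prod>j\<in>I. epowr x (k j))"
  using assms by (induction I rule: infinite_finite_induct) (auto simp: epowr_add sum_nonneg)

lemma HLP_bounded_sufficient:
  fixes m :: nat and q lam \<alpha> \<gamma> :: real and qs ls gs b :: "nat \<Rightarrow> real"
  assumes m: "m \<ge> 1" and q: "1 \<le> q"
    and qs: "\<And>j. j \<in> {1..m} \<Longrightarrow> 1 < qs j"
    and ls: "\<And>j. j \<in> {1..m} \<Longrightarrow> - 1 / qs j \<le> ls j" "\<And>j. j \<in> {1..m} \<Longrightarrow> ls j < 0"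
    and q_sum: "1 / q = (\<Sum>j\<in>{1..m}. 1 / qs j)"
    and lam_sum: "lam = (\<Sum>j\<in>{1..m}. ls j)"
    and g_sum: "\<gamma> = (\<Sum>j\<in>{1..m}. gs j)"
    and b: "\<And>j. b j = hom_dim TYPE('n::finite) * ls j - gs j / q + \<alpha> * (ls j + 1 / qs j)"
    and pos: "\<And>j. j \<in> {1..m} \<Longrightarrow> 0 < b j + hom_dim TYPE('n)" and neg: "(\<Sum>j\<in>{1..m}. b j) < 0"
  shows "HLP_bounded m qs ls (\<lambda>j (x :: 'n heis). heis_norm x powr \<alpha>)
            (\<lambda>j x. heis_norm x powr (qs j * gs j / q)) q lam
            (\<lambda>x. heis_norm x powr \<alpha>) (\<lambda>x. heis_norm x powr \<gamma>)"
proof -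
  let ?Q = "real (hom_dim TYPE('n))"
  let ?w1 = "\<lambda>x :: 'n heis. heis_norm x powr \<alpha>" and ?w2 = "\<lambda>x :: 'n heis. heis_norm x powr \<gamma>"
  let ?u = "\<lambda>j (x :: 'n heis). heis_norm x powr (qs j * gs j / q)"
  define B where "B = (\<Sum>j\<in>{1..m}. b j)"
  \<comment> \<open>The exponents must exceed b j + Q, for convergence of the linear operators, and
    sum to mQ. As B < 0, the surplus - B can be shared evenly among the m operators.\<close>
  define s where "s j = b j + ?Q - B / m" for j
  define k where "k j = ls j + 1 / qs j" for j
  have s: "b j + ?Q < s j" for j using neg m by (simp add: s_def B_def divide_neg_pos)
  have s_sum: "(\<Sum>j\<in>{1..m}. s j) = real m * ?Q"
    using m by (simp add: s_def sum.distrib sum_subtractf B_def)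
  have k: "0 \<le> k j" if "j \<in> {1..m}" for j using ls(1)[OF that] by (simp add: k_def)
  have k_sum: "(\<Sum>j\<in>{1..m}. k j) = lam + 1 / q" by (simp add: k_def sum.distrib lam_sum q_sum)
  let ?\<Phi> = "\<lambda>j C. 0 \<le> C \<and> (\<forall>(f :: 'n heis \<Rightarrow> real) N a R. f \<in> borel_measurable borel \<longrightarrow> (\<forall>x. 0 \<le> f x) \<longrightarrow> 0 \<le> N \<longrightarrow>
       morrey_norm (qs j) (ls j) ?w1 (?u j) (\<lambda>x. ennreal \<bar>f x\<bar>) \<le> ennreal N \<longrightarrow>
       0 < R \<longrightarrow> True \<longrightarrow>
       (qs j * ls j + 1 = 0 \<or> (\<integral>\<^sup>+x\<in>heis_ball a R. ennreal (?w1 x) \<partial>lborel) < \<infinity>) \<longrightarrow>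
       (\<integral>\<^sup>+x\<in>heis_ball a R. epowr (polya_op (s j) f x) (qs j) * ennreal (?u j x) \<partial>lborel)
         \<le> ennreal (C * N powr qs j) * epowr (\<integral>\<^sup>+x\<in>heis_ball a R. ennreal (?w1 x) \<partial>lborel) (qs j * ls j + 1))"
  have "\<forall>j\<in>{1..m}. \<exists>C. ?\<Phi> j C"
  proof
    fix j assume j: "j \<in> {1..m}"
    have "qs j * gs j / q / qs j = gs j / q" using qs[OF j] by simp
    then have "b j = ?Q * ls j - (qs j * gs j / q) / qs j + \<alpha> * (ls j + 1 / qs j)" by (simp only: b)
    from polya_op_bounded[OF this qs[OF j] ls(1)[OF j] ls(2)[OF j] pos[OF j] s]
    show "\<exists>C. ?\<Phi> j C" unfolding polya_op_bounded_on_def .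
  qed
  from bchoice[OF this] obtain C where C\<Phi>: "\<forall>j\<in>{1..m}. ?\<Phi> j (C j)" ..
  have C: "0 \<le> C j" if "j \<in> {1..m}" for j using C\<Phi>[THEN bspec, OF that] by (rule conjunct1)
  have bd: "(\<integral>\<^sup>+x\<in>heis_ball a R. epowr (polya_op (s j) f x) (qs j) * ennreal (?u j x) \<partial>lborel)
         \<le> ennreal (C j * N powr qs j) * epowr (\<integral>\<^sup>+x\<in>heis_ball a R. ennreal (?w1 x) \<partial>lborel) (qs j * ls j + 1)"
    if j: "j \<in> {1..m}" and "f \<in> borel_measurable borel" "\<And>x. 0 \<le> f x" "0 \<le> N"
       "morrey_norm (qs j) (ls j) ?w1 (?u j) (\<lambda>x. ennreal \<bar>f x\<bar>) \<le> ennreal N" "0 < R"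
       "qs j * ls j + 1 = 0 \<or> (\<integral>\<^sup>+x\<in>heis_ball a R. ennreal (?w1 x) \<partial>lborel) < \<infinity>"
    for j N R and a :: "'n heis" and f :: "'n heis \<Rightarrow> real"
    by (rule conjunct2[OF C\<Phi>[THEN bspec, OF j], rule_format, OF that(2-6) TrueI that(7)])
  define D where "D = (\<Prod>j\<in>{1..m}. C j powr (1 / qs j))"
  have D: "0 \<le> D" by (simp add: D_def prod_nonneg)
  have main: "morrey_norm q lam ?w1 ?w2 (HLP m f) \<le> ennreal D * (\<Prod>j\<in>{1..m}. morrey_norm (qs j) (ls j) ?w1 (?u j) (\<lambda>x. ennreal \<bar>f j x\<bar>))"
    if f: "\<forall>j\<in>{1..m}. f j \<in> morrey_space (qs j) (ls j) ?w1 (?u j) \<and> (\<forall>x. 0 \<le> f j x)" for f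
  proof -
    define N where "N j = enn2real (morrey_norm (qs j) (ls j) ?w1 (?u j) (\<lambda>x. ennreal \<bar>f j x\<bar>))" for j
    have N: "morrey_norm (qs j) (ls j) ?w1 (?u j) (\<lambda>x. ennreal \<bar>f j x\<bar>) = ennreal (N j)" "0 \<le> N j" if "j \<in> {1..m}" for j
      using f that by (auto simp: N_def morrey_space_def)
    have meas: "f j \<in> borel_measurable borel" if "j \<in> {1..m}" for j
      using f that by (auto simp: morrey_space_def Lq_loc_def)
    have f0: "0 \<le> f j x" if "j \<in> {1..m}" for j x using f that by blast
    have "morrey_norm q lam ?w1 ?w2 (HLP m f) \<le> ennreal (D * (\<Prod>j\<in>{1..m}. N j))"
      unfolding morrey_norm_def
    proof (intro SUP_least, clarify)
      fix a :: "'n heis" and R :: real assume R: "0 < R"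
      define W where "W = (\<integral>\<^sup>+x\<in>heis_ball a R. ennreal (?w1 x) \<partial>lborel)"
      define I where "I = (\<integral>\<^sup>+x\<in>heis_ball a R. epowr (HLP m f x) q * ennreal (?w2 x) \<partial>lborel)"
      have "epowr W (- (lam + 1 / q)) * epowr I (1 / q) \<le> ennreal (D * (\<Prod>j\<in>{1..m}. N j))"
      \<comment> \<open>A ball of infinite mass has first factor 0 unless lam + 1/q = 0. In the
        remaining case the linear estimates may be used.\<close>
      proof (cases "W = top \<and> lam + 1 / q \<noteq> 0")
        case True
        have "0 \<le> lam + 1 / q" unfolding k_sum[symmetric] by (intro sum_nonneg k)
        then have "epowr W (- (lam + 1 / q)) = 0" using True by (simp add: epowr_top)
        then show ?thesis by simp
      next
        case False
        define G where "G j x = epowr (polya_op (s j) (f j) x) (qs j) * ennreal (?u j x) * indicator (heis_ball a R) x" for j x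
        have G: "(\<integral>\<^sup>+x. G j x \<partial>lborel) \<le> ennreal (C j * N j powr qs j) * epowr W (qs j * ls j + 1)" if j: "j \<in> {1..m}" for j
        proof -
          \<comment> \<open>If W is infinite here, the nonnegative exponents k j add up to 0, so
            each of them vanishes and every source space is a Lebesgue space.\<close>
          have "qs j * ls j + 1 = 0 \<or> W < \<infinity>"
          proof (cases "W = top")
            case True
            then have "(\<Sum>j\<in>{1..m}. k j) = 0" using False k_sum by simp
            then have "k j = 0" using j k by (subst (asm) sum_nonneg_eq_0_iff) auto
            then show ?thesis using qs[OF j] by (simp add: k_def field_simps)
          qed (simp add: less_top)
          then show ?thesis
            unfolding G_def W_def using j N[OF j] R by (intro bd meas f0) auto
        qed
        \<comment> \<open>The weight is distributed along with the operator: raising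
          \<open>|x|^(qs j * gs j / q)\<close> to the power q / qs j gives
          \<open>|x|^(gs j)\<close>, and these multiply to the target weight. The powers q / qs j
          add up to 1, which is the form Hoelder's inequality needs.\<close>
        have "I \<le> (\<integral>\<^sup>+x. (\<Prod>j\<in>{1..m}. epowr (G j x) (q / qs j)) \<partial>lborel)"
          unfolding I_def
        proof (rule nn_integral_mono_AE, rule AE_mp[OF AE_heis_nonzero], intro AE_I2 impI)
          fix x :: "'n heis" assume x: "x \<noteq> 0"
          show "epowr (HLP m f x) q * ennreal (?w2 x) * indicator (heis_ball a R) x \<le> (\<Prod>j\<in>{1..m}. epowr (G j x) (q / qs j))"
          proof (cases "x \<in> heis_ball a R")
            case True
            have "s j \<ge> 0" if "j \<in> {1..m}" for j using s[of j] pos[OF that] by linarith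
            then have "HLP m f x \<le> (\<Prod>j\<in>{1..m}. polya_op (s j) (f j) x)"
              by (intro HLP_le_prod_polya_op m x meas f0 s_sum)
            then have "epowr (HLP m f x) q \<le> epowr (\<Prod>j\<in>{1..m}. polya_op (s j) (f j) x) q"
              using q by (intro epowr_mono) auto
            also have "\<dots> = (\<Prod>j\<in>{1..m}. epowr (polya_op (s j) (f j) x) q)" using q by (intro epowr_prod) simp
            finally have 1: "epowr (HLP m f x) q \<le> (\<Prod>j\<in>{1..m}. epowr (polya_op (s j) (f j) x) q)" .
            have "?w2 x = (\<Prod>j\<in>{1..m}. heis_norm x powr gs j)"
              unfolding g_sum using x by (intro powr_sum) auto
            then have 2: "ennreal (?w2 x) = (\<Prod>j\<in>{1..m}. ennreal (heis_norm x powr gs j))"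
              by (simp add: prod_ennreal)
            have "epowr (HLP m f x) q * ennreal (?w2 x) \<le> (\<Prod>j\<in>{1..m}. epowr (polya_op (s j) (f j) x) q * ennreal (heis_norm x powr gs j))"
              unfolding 2 prod.distrib by (intro mult_right_mono 1) simp
            also have "\<dots> = (\<Prod>j\<in>{1..m}. epowr (G j x) (q / qs j))"
            proof (rule prod.cong[OF refl])
              fix j assume j: "j \<in> {1..m}"
              have qj: "0 < q / qs j" "qs j * (q / qs j) = q" "qs j * gs j / q * (q / qs j) = gs j"
                using q qs[OF j] by auto
              have "epowr (G j x) (q / qs j) = epowr (polya_op (s j) (f j) x) (qs j * (q / qs j)) * ennreal (heis_norm x powr (qs j * gs j / q * (q / qs j)))"
                using True x qj(1) qs[OF j] by (simp add: G_def epowr_mult epowr_epowr epowr_ennreal_pos powr_powr)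
              then show "epowr (polya_op (s j) (f j) x) q * ennreal (heis_norm x powr gs j) = epowr (G j x) (q / qs j)"
                by (simp only: qj)
            qed
            finally show ?thesis using True by simp
          qed simp
        qed
        also have "\<dots> \<le> (\<Prod>j\<in>{1..m}. epowr (\<integral>\<^sup>+x. G j x \<partial>lborel) (q / qs j))"
        proof (rule Hoelder_nn_integral_prod)
          show "0 < q / qs j" if "j \<in> {1..m}" for j using q qs[OF that] by simp
          have "(\<Sum>j\<in>{1..m}. q / qs j) = q * (\<Sum>j\<in>{1..m}. 1 / qs j)" by (simp add: sum_distrib_left)
          then show "(\<Sum>j\<in>{1..m}. q / qs j) = 1" using q unfolding q_sum[symmetric] by simp
          show "G j \<in> borel_measurable lborel" if "j \<in> {1..m}" for j
            unfolding G_def using meas[OF that] by measurable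
        qed simp
        finally have "epowr I (1 / q) \<le> epowr (\<Prod>j\<in>{1..m}. epowr (\<integral>\<^sup>+x. G j x \<partial>lborel) (q / qs j)) (1 / q)"
          using q by (intro epowr_mono) auto
        also have "\<dots> = (\<Prod>j\<in>{1..m}. epowr (\<integral>\<^sup>+x. G j x \<partial>lborel) (1 / qs j))"
        proof -
          have "epowr (epowr (\<integral>\<^sup>+x. G j x \<partial>lborel) (q / qs j)) (1 / q) = epowr (\<integral>\<^sup>+x. G j x \<partial>lborel) (1 / qs j)" if "j \<in> {1..m}" for j
            using q qs[OF that] by (simp add: epowr_epowr)
          then show ?thesis using q by (simp add: epowr_prod)
        qed
        also have "\<dots> \<le> (\<Prod>j\<in>{1..m}. ennreal (C j powr (1 / qs j) * N j) * epowr W (k j))"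
        proof (rule prod_mono_ennreal)
          fix j assume j: "j \<in> {1..m}"
          have qj: "1 < qs j" by (rule qs[OF j])
          have \<theta>: "0 \<le> qs j * ls j + 1" "(qs j * ls j + 1) * (1 / qs j) = k j"
            using ls(1)[OF j] qj by (auto simp: k_def field_simps)
          have "epowr (\<integral>\<^sup>+x. G j x \<partial>lborel) (1 / qs j) \<le> epowr (ennreal (C j * N j powr qs j) * epowr W (qs j * ls j + 1)) (1 / qs j)"
            using qj by (intro epowr_mono G j) auto
          also have "\<dots> = epowr (ennreal (C j * N j powr qs j)) (1 / qs j) * epowr (epowr W (qs j * ls j + 1)) (1 / qs j)"
            using qj by (intro epowr_mult) simp
          also have "epowr (epowr W (qs j * ls j + 1)) (1 / qs j) = epowr W (k j)"
            using qj \<theta>(1) by (subst epowr_epowr) (simp_all only: \<theta>(2), simp_all)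
          also have "epowr (ennreal (C j * N j powr qs j)) (1 / qs j) = ennreal (C j powr (1 / qs j) * N j)"
            using qj C[OF j] N(2)[OF j] by (simp add: epowr_ennreal powr_mult powr_powr)
          finally show "epowr (\<integral>\<^sup>+x. G j x \<partial>lborel) (1 / qs j) \<le> ennreal (C j powr (1 / qs j) * N j) * epowr W (k j)" .
        qed
        also have "\<dots> = ennreal (D * (\<Prod>j\<in>{1..m}. N j)) * epowr W (lam + 1 / q)"
        proof -
          have "(\<Prod>j\<in>{1..m}. ennreal (C j powr (1 / qs j) * N j)) = ennreal (\<Prod>j\<in>{1..m}. C j powr (1 / qs j) * N j)"
            by (intro prod_ennreal mult_nonneg_nonneg N(2)) auto
          moreover have "(\<Prod>j\<in>{1..m}. epowr W (k j)) = epowr W (lam + 1 / q)"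
            unfolding k_sum[symmetric] by (intro epowr_sum[symmetric] k)
          ultimately show ?thesis by (simp add: prod.distrib D_def)
        qed
        finally have "epowr W (- (lam + 1 / q)) * epowr I (1 / q)
           \<le> epowr W (- (lam + 1 / q)) * (ennreal (D * (\<Prod>j\<in>{1..m}. N j)) * epowr W (lam + 1 / q))"
          by (intro mult_left_mono) auto
        also have "\<dots> = epowr W (- (lam + 1 / q)) * epowr W (lam + 1 / q) * ennreal (D * (\<Prod>j\<in>{1..m}. N j))"
          by (simp only: mult_ac)
        \<comment> \<open>The exponents k j sum to lam + 1/q, so the powers of W cancel against the
          factor of the target norm, up to the convention for the values 0 and \<infinity>.\<close>
        also have "\<dots> \<le> 1 * ennreal (D * (\<Prod>j\<in>{1..m}. N j))"
          by (intro mult_right_mono epowr_minus_mult_le) simp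
        finally show ?thesis by simp
      qed
      then show "epowr (\<integral>\<^sup>+x\<in>heis_ball a R. ennreal (?w1 x) \<partial>lborel) (- (lam + 1 / q)) *
          epowr (\<integral>\<^sup>+x\<in>heis_ball a R. epowr (HLP m f x) q * ennreal (?w2 x) \<partial>lborel) (1 / q)
          \<le> ennreal (D * (\<Prod>j\<in>{1..m}. N j))" unfolding W_def I_def .
    qed
    also have "\<dots> = ennreal D * (\<Prod>j\<in>{1..m}. ennreal (N j))"
      using D N(2) by (subst prod_ennreal) (auto simp: ennreal_mult')
    also have "(\<Prod>j\<in>{1..m}. ennreal (N j)) = (\<Prod>j\<in>{1..m}. morrey_norm (qs j) (ls j) ?w1 (?u j) (\<lambda>x. ennreal \<bar>f j x\<bar>))"
      by (intro prod.cong refl N(1)[symmetric])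
    finally show ?thesis .
  qed
  show ?thesis
    unfolding HLP_bounded_def using D main by (intro exI[of _ D] conjI allI impI) auto
qed

text \<open>The factors of the denominator are minus the sum of the b j and the numbers b i + Q, all
  positive exactly when A is finite. These signs differ from those of the English formula, whose
  first bracket is that sum itself and whose other brackets are Q - b i: for m = 1 and finite A that
  expression is negative, whereas A is positive.\<close>

theorem corollary1:
  fixes m :: nat
    and q lam \<alpha> \<gamma> :: real
    and qs ls gs :: "nat \<Rightarrow> real"
  defines "Q \<equiv> real (hom_dim TYPE('n::finite))"
    and "A \<equiv> HLP_const TYPE('n) m q \<alpha> qs ls gs"
  assumes "m \<ge> 1"
    and "1 \<le> q" and "- 1 / q \<le> lam" and "lam < 0"
    and "\<And>j. j \<in> {1..m} \<Longrightarrow> 1 < qs j"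
    and "\<And>j. j \<in> {1..m} \<Longrightarrow> - 1 / qs j \<le> ls j"
    and "\<And>j. j \<in> {1..m} \<Longrightarrow> ls j < 0"
    and "1 / q = (\<Sum>j\<in>{1..m}. 1 / qs j)"
    and "lam = (\<Sum>j\<in>{1..m}. ls j)"
    and "\<gamma> = (\<Sum>j\<in>{1..m}. gs j)"
  shows "(HLP_bounded m qs ls
            (\<lambda>j (x :: 'n heis). heis_norm x powr \<alpha>)
            (\<lambda>j x. heis_norm x powr (qs j * gs j / q))
            q lam
            (\<lambda>x. heis_norm x powr \<alpha>)
            (\<lambda>x. heis_norm x powr \<gamma>)
          \<longleftrightarrow> A < \<infinity>) \<and>
         (A < \<infinity> \<longrightarrow>
          enn2real A =
            real m * Q * omega_Q TYPE('n) ^ m /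
            (- (Q * lam - \<gamma> / q + \<alpha> * (lam + 1 / q)) *
             (\<Prod>i\<in>{1..m}. Q * (1 + ls i) - gs i / q + \<alpha> * (ls i + 1 / qs i))))"
proof -
  define b where "b j = Q * ls j - gs j / q + \<alpha> * (ls j + 1 / qs j)" for j
  have b: "b j = real (hom_dim TYPE('n)) * ls j - gs j / q + \<alpha> * (ls j + 1 / qs j)" for j
    by (simp add: b_def Q_def)
  have sum_b: "(\<Sum>j\<in>{1..m}. b j) = real (hom_dim TYPE('n)) * lam - \<gamma> / q + \<alpha> * (lam + 1 / q)"
  proof -
    have "(\<Sum>j\<in>{1..m}. \<alpha> * (ls j + 1 / qs j)) = \<alpha> * (\<Sum>j\<in>{1..m}. ls j + 1 / qs j)"
      by (rule sum_distrib_left[symmetric])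
    also have "\<dots> = \<alpha> * (lam + 1 / q)" unfolding assms(10,11) by (simp add: sum.distrib)
    finally show ?thesis
      unfolding b by (simp add: sum.distrib sum_subtractf assms(11,12) sum_distrib_left[symmetric] sum_divide_distrib[symmetric])
  qed
  have prod_b: "(\<Prod>j\<in>{1..m}. b j + real (hom_dim TYPE('n))) = (\<Prod>i\<in>{1..m}. Q * (1 + ls i) - gs i / q + \<alpha> * (ls i + 1 / qs i))"
    by (intro prod.cong) (simp_all add: b_def Q_def algebra_simps)
  let ?ok = "(\<forall>j\<in>{1..m}. 0 < b j + real (hom_dim TYPE('n))) \<and> (\<Sum>j\<in>{1..m}. b j) < 0"
  have A: "A = (if ?ok then ennreal (real m * real (hom_dim TYPE('n)) * omega_Q TYPE('n) ^ m /
            (- (\<Sum>j\<in>{1..m}. b j) * (\<Prod>j\<in>{1..m}. b j + real (hom_dim TYPE('n))))) else \<infinity>)"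
    unfolding A_def b by (rule HLP_const_eq[OF assms(3)])
  have "HLP_bounded m qs ls (\<lambda>j (x :: 'n heis). heis_norm x powr \<alpha>)
            (\<lambda>j x. heis_norm x powr (qs j * gs j / q)) q lam
            (\<lambda>x. heis_norm x powr \<alpha>) (\<lambda>x. heis_norm x powr \<gamma>) \<longleftrightarrow> ?ok"
  proof
    assume "?ok"
    then show "HLP_bounded m qs ls (\<lambda>j (x :: 'n heis). heis_norm x powr \<alpha>)
            (\<lambda>j x. heis_norm x powr (qs j * gs j / q)) q lam
            (\<lambda>x. heis_norm x powr \<alpha>) (\<lambda>x. heis_norm x powr \<gamma>)"
      by (intro HLP_bounded_sufficient[OF assms(3,4,7-12) b]) auto
  next
    assume "HLP_bounded m qs ls (\<lambda>j (x :: 'n heis). heis_norm x powr \<alpha>)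
            (\<lambda>j x. heis_norm x powr (qs j * gs j / q)) q lam
            (\<lambda>x. heis_norm x powr \<alpha>) (\<lambda>x. heis_norm x powr \<gamma>)"
    then show "?ok"
      by - (rule HLP_bounded_necessary[OF assms(3-6) assms(7,8,9,11) b sum_b]; assumption)
  qed
  moreover have "A < \<infinity> \<longleftrightarrow> ?ok" by (simp add: A)
  moreover have "enn2real A = real m * Q * omega_Q TYPE('n) ^ m /
            (- (Q * lam - \<gamma> / q + \<alpha> * (lam + 1 / q)) *
             (\<Prod>i\<in>{1..m}. Q * (1 + ls i) - gs i / q + \<alpha> * (ls i + 1 / qs i)))" if ok: ?ok
  proof -
    have "0 \<le> real m * real (hom_dim TYPE('n)) * omega_Q TYPE('n) ^ m /
            (- (\<Sum>j\<in>{1..m}. b j) * (\<Prod>j\<in>{1..m}. b j + real (hom_dim TYPE('n))))"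
      using ok omega_Q_pos[where ?'n = 'n]
      by (intro divide_nonneg_nonneg mult_nonneg_nonneg prod_nonneg) (auto simp: less_imp_le)
    then have "enn2real A = real m * real (hom_dim TYPE('n)) * omega_Q TYPE('n) ^ m /
            (- (\<Sum>j\<in>{1..m}. b j) * (\<Prod>j\<in>{1..m}. b j + real (hom_dim TYPE('n))))"
      using ok by (simp add: A)
    then show ?thesis unfolding sum_b prod_b unfolding Q_def .
  qed
  ultimately show ?thesis by blast
qed

end
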